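(* Let $0<p<\frac12$ and let $\lambda$ be a real constant. Let $\tau,\nu,\mu$ be functions on $\overline D$ such that $\tau\in C(\overline D)$, $\tau_{xy}\in C(\overline D)$, $\nu\in C^{(2)}(\overline D)$, $\mu\in C^{(2)}(\overline D)$. Then the following problem (Problem $C$) has a unique solution: find a function $U$, continuous on $\overline{\mathcal H}$, satisfying in $\mathcal H$ the equation $$U_{xyz}-\frac{p}{x-y-z}U_{xz}+\frac{p}{x-y-z}U_{yz}-\lambda U_z=0$$ and the conditions $$U(x,y,x-y)=\tau(x,y),\qquad 0\le y\le x<+\infty,$$ $$\lim_{z\to x-y-0}\frac{\partial U}{\partial z}(x,y,z)=\nu(x,y),\qquad 0<y<x<+\infty,$$ $$\lim_{z\to x-y-0}(x-y-z)^{2p}\,(U_{xz}-U_{yz})(x,y,z)=\mu(x,y),\qquad 0<y<x<+\infty.$$ Moreover, this unique solution is given by the formula $$U(x_0,y_0,z_0)=\tau(x_0,y_0)-\frac12\,\frac{\Gamma(1-2p)}{\Gamma^2(1-p)}\int_{y_0}^{x_0-z_0}ds\int_{z_0+s}^{x_0}\mu(t,s)\,(x_0-t)^{-p}(s-y_0)^{-p}\,{}_0F_1\bigl(1-p;\lambda(x_0-t)(y_0-s)\bigr)\,dt$$ $$-\frac{\Gamma(2p)}{\Gamma^2(p)}\int_{y_0}^{x_0-z_0}ds\int_{z_0+s}^{x_0}\nu(t,s)\,(x_0-t)^{p-1}(s-y_0)^{p-1}(x_0-y_0-t+s)^{1-2p}\,{}_0F_1\bigl(p;\lambda(x_0-t)(y_0-s)\bigr)\,dt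 .$$
   Context: $\mathcal H=\{(x,y,z)\in\mathbb R^3: 0<z<x-y,\ 0<y<x<+\infty\}$ and $D=\{(x,y)\in\mathbb R^2: 0<y<x<+\infty\}$; bars denote closures. Subscripts denote partial derivatives. The limits $z\to x-y-0$ are taken with $(x,y)$ fixed and $z$ approaching $x-y$ from below. $\Gamma$ is the Gamma function and ${}_0F_1(\alpha;w)=\sum_{n=0}^\infty\frac{w^n}{(\alpha)_n\,n!}$, where $(\alpha)_n=\alpha(\alpha+1)\cdots(\alpha+n-1)$, $(\alpha)_0=1$. *)

theory Defs
  imports "HOL-Analysis.Analysis"
begin

definition domH :: "(real \<times> real \<times> real) set" where
  "domH = {(x, y, z). 0 < z \<and> z < x - y \<and> 0 < y \<and> y < x}"

definition domD :: "(real \<times> real) set" where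
  "domD = {(x, y). 0 < y \<and> y < x}"

definition hyp0F1 :: "real \<Rightarrow> real \<Rightarrow> real" where
  "hyp0F1 a w = (\<Sum>n. w ^ n / (pochhammer a n * fact n))"

text \<open>
  Partial derivatives of curried functions. A subscript string such as \<open>U\<^sub>x\<^sub>y\<^sub>z\<close> is read as the
  composition of operators \<open>\<partial>x (\<partial>y (\<partial>z U))\<close>. As \<^const>\<open>deriv\<close> is total, existence of the
  derivatives is always required separately.
\<close>

definition pdx2 :: "(real \<Rightarrow> real \<Rightarrow> real) \<Rightarrow> real \<Rightarrow> real \<Rightarrow> real" where
  "pdx2 f x y = deriv (\<lambda>t. f t y) x"

definition pdy2 :: "(real \<Rightarrow> real \<Rightarrow> real) \<Rightarrow> real \<Rightarrow> real \<Rightarrow> real" where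
  "pdy2 f x y = deriv (\<lambda>t. f x t) y"

definition has_pdx2 :: "(real \<Rightarrow> real \<Rightarrow> real) \<Rightarrow> bool" where
  "has_pdx2 f \<longleftrightarrow> (\<forall>(x, y)\<in>domD. (\<lambda>t. f t y) field_differentiable at x)"

definition has_pdy2 :: "(real \<Rightarrow> real \<Rightarrow> real) \<Rightarrow> bool" where
  "has_pdy2 f \<longleftrightarrow> (\<forall>(x, y)\<in>domD. (\<lambda>t. f x t) field_differentiable at y)"

definition pdx3 :: "(real \<Rightarrow> real \<Rightarrow> real \<Rightarrow> real) \<Rightarrow> real \<Rightarrow> real \<Rightarrow> real \<Rightarrow> real" where
  "pdx3 U x y z = deriv (\<lambda>t. U t y z) x"

definition pdy3 :: "(real \<Rightarrow> real \<Rightarrow> real \<Rightarrow> real) \<Rightarrow> real \<Rightarrow> real \<Rightarrow> real \<Rightarrow> real" where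
  "pdy3 U x y z = deriv (\<lambda>t. U x t z) y"

definition pdz3 :: "(real \<Rightarrow> real \<Rightarrow> real \<Rightarrow> real) \<Rightarrow> real \<Rightarrow> real \<Rightarrow> real \<Rightarrow> real" where
  "pdz3 U x y z = deriv (\<lambda>t. U x y t) z"

definition has_pdx3 :: "(real \<Rightarrow> real \<Rightarrow> real \<Rightarrow> real) \<Rightarrow> bool" where
  "has_pdx3 U \<longleftrightarrow> (\<forall>(x, y, z)\<in>domH. (\<lambda>t. U t y z) field_differentiable at x)"

definition has_pdy3 :: "(real \<Rightarrow> real \<Rightarrow> real \<Rightarrow> real) \<Rightarrow> bool" where
  "has_pdy3 U \<longleftrightarrow> (\<forall>(x, y, z)\<in>domH. (\<lambda>t. U x t z) field_differentiable at y)"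

definition has_pdz3 :: "(real \<Rightarrow> real \<Rightarrow> real \<Rightarrow> real) \<Rightarrow> bool" where
  "has_pdz3 U \<longleftrightarrow> (\<forall>(x, y, z)\<in>domH. (\<lambda>t. U x y t) field_differentiable at z)"

text \<open>
  A derivative belongs to \<open>C(closure domD)\<close> if, on the open set \<^const>\<open>domD\<close> where it is formed,
  it coincides with a function continuous on the closure.
\<close>

definition cont_ext_D :: "(real \<Rightarrow> real \<Rightarrow> real) \<Rightarrow> bool" where
  "cont_ext_D f \<longleftrightarrow>
     (\<exists>g. continuous_on (closure domD) g \<and> (\<forall>(x, y)\<in>domD. g (x, y) = f x y))"

primrec Ck_ext_D :: "nat \<Rightarrow> (real \<Rightarrow> real \<Rightarrow> real) \<Rightarrow> bool" where
  "Ck_ext_D 0 f \<longleftrightarrow> cont_ext_D f"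
| "Ck_ext_D (Suc k) f \<longleftrightarrow> cont_ext_D f \<and> has_pdx2 f \<and> has_pdy2 f \<and>
     Ck_ext_D k (pdx2 f) \<and> Ck_ext_D k (pdy2 f)"

definition Ck_closed_D :: "nat \<Rightarrow> (real \<Rightarrow> real \<Rightarrow> real) \<Rightarrow> bool" where
  "Ck_closed_D k f \<longleftrightarrow> continuous_on (closure domD) (\<lambda>(x, y). f x y) \<and> Ck_ext_D k f"

definition mixed_C_closed_D :: "(real \<Rightarrow> real \<Rightarrow> real) \<Rightarrow> bool" where
  "mixed_C_closed_D f \<longleftrightarrow>
     has_pdy2 f \<and> has_pdx2 (pdy2 f) \<and> cont_ext_D (pdx2 (pdy2 f))"

text \<open>
  Classical solutions: the derivatives occurring in the equation exist and are continuous in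
  the open domain.
\<close>

definition classical_regularity :: "(real \<Rightarrow> real \<Rightarrow> real \<Rightarrow> real) \<Rightarrow> bool" where
  "classical_regularity U \<longleftrightarrow>
     has_pdz3 U \<and> has_pdx3 (pdz3 U) \<and> has_pdy3 (pdz3 U) \<and> has_pdx3 (pdy3 (pdz3 U)) \<and>
     continuous_on domH (\<lambda>(x, y, z). pdz3 U x y z) \<and>
     continuous_on domH (\<lambda>(x, y, z). pdx3 (pdz3 U) x y z) \<and>
     continuous_on domH (\<lambda>(x, y, z). pdy3 (pdz3 U) x y z) \<and>
     continuous_on domH (\<lambda>(x, y, z). pdx3 (pdy3 (pdz3 U)) x y z)"

definition solves_problem_C ::
  "real \<Rightarrow> real \<Rightarrow> (real \<Rightarrow> real \<Rightarrow> real) \<Rightarrow> (real \<Rightarrow> real \<Rightarrow> real) \<Rightarrow> (real \<Rightarrow> real \<Rightarrow> real) \<Rightarrow>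
   (real \<Rightarrow> real \<Rightarrow> real \<Rightarrow> real) \<Rightarrow> bool" where
  "solves_problem_C p lam \<tau> \<nu> \<mu> U \<longleftrightarrow>
     continuous_on (closure domH) (\<lambda>(x, y, z). U x y z) \<and>
     classical_regularity U \<and>
     (\<forall>(x, y, z)\<in>domH.
        pdx3 (pdy3 (pdz3 U)) x y z
        - p / (x - y - z) * pdx3 (pdz3 U) x y z
        + p / (x - y - z) * pdy3 (pdz3 U) x y z
        - lam * pdz3 U x y z = 0) \<and>
     (\<forall>x y. 0 \<le> y \<and> y \<le> x \<longrightarrow> U x y (x - y) = \<tau> x y) \<and>
     (\<forall>x y. 0 < y \<and> y < x \<longrightarrow>
        ((\<lambda>z. pdz3 U x y z) \<longlongrightarrow> \<nu> x y) (at_left (x - y))) \<and>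
     (\<forall>x y. 0 < y \<and> y < x \<longrightarrow>
        ((\<lambda>z. (x - y - z) powr (2 * p) * (pdx3 (pdz3 U) x y z - pdy3 (pdz3 U) x y z))
           \<longlongrightarrow> \<mu> x y) (at_left (x - y)))"

definition formula_C ::
  "real \<Rightarrow> real \<Rightarrow> (real \<Rightarrow> real \<Rightarrow> real) \<Rightarrow> (real \<Rightarrow> real \<Rightarrow> real) \<Rightarrow> (real \<Rightarrow> real \<Rightarrow> real) \<Rightarrow>
   real \<Rightarrow> real \<Rightarrow> real \<Rightarrow> real" where
  "formula_C p lam \<tau> \<nu> \<mu> x0 y0 z0 =
     \<tau> x0 y0
     - 1 / 2 * (Gamma (1 - 2 * p) / (Gamma (1 - p))\<^sup>2) *
       integral {y0..x0 - z0} (\<lambda>s. integral {z0 + s..x0} (\<lambda>t.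
         \<mu> t s * (x0 - t) powr (- p) * (s - y0) powr (- p) *
         hyp0F1 (1 - p) (lam * (x0 - t) * (y0 - s))))
     - Gamma (2 * p) / (Gamma p)\<^sup>2 *
       integral {y0..x0 - z0} (\<lambda>s. integral {z0 + s..x0} (\<lambda>t.
         \<nu> t s * (x0 - t) powr (p - 1) * (s - y0) powr (p - 1) *
         (x0 - y0 - t + s) powr (1 - 2 * p) *
         hyp0F1 p (lam * (x0 - t) * (y0 - s))))"

end

theory Submission
  imports Defs
begin

text \<open>
  Only the derivative \<open>W = U\<^sub>z\<close> occurs in the equation, and \<open>z\<close> is a parameter there: in the variables
  \<open>x - z\<close> and \<open>y\<close> each slice of \<open>W\<close> solves the Euler-Poisson-Darboux equation with exponent \<open>p\<close>, which is
  singular on the diagonal. The last two boundary conditions are Cauchy data for \<open>W\<close> on the diagonal,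
  the value \<open>\<nu>\<close> and the weighted normal derivative \<open>\<mu>\<close>; the first one fixes the primitive
  \<open>U = \<tau> - \<integral> W\<close>.

  Existence is a computation. The mean of the data over the diagonal segment below a point, with the
  weight of \<open>Beta q q\<close> and a factor \<open>hyp0F1 q\<close>, solves the equation with exponent \<open>q\<close>, because the
  defect is an exact derivative (\<open>V_pde\<close>). Taken with \<open>q = p\<close> it attains \<open>\<nu>\<close>; with \<open>q = 1 - p\<close>, multiplied
  by the power \<open>1 - 2 * p\<close> of the distance to the diagonal, it solves the equation with
  exponent \<open>p\<close> and attains \<open>\<mu>\<close> (\<open>Y_pde\<close>). Integrating over \<open>z\<close> and exchanging integrals
  (\<open>triangle_Fubini\<close>) gives the double integrals of \<open>formula_C\<close>.

  Uniqueness is the delicate part. The data are attained only pointwise, and along a limit in which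
  \<open>(x, y)\<close> is fixed and \<open>z\<close> moves, so that the point crosses from slice to slice. Nothing is assumed
  about uniformity. What saves the situation is that near the diagonal a classical solution is
  controlled by its values far from the diagonal: they are Goursat data on two characteristics, and a
  comparison argument with the critical power gives \<open>\<bar>w\<^sub>x\<bar>, \<bar>w\<^sub>y\<bar> \<le> M * d powr (- 2 * p)\<close> at distance \<open>d\<close>
  (\<open>epd_bound_near_diagonal\<close>). With these bounds dominated convergence applies. Averages of \<open>W\<close> over
  \<open>z\<close> therefore have zero limits within the plane (\<open>zero_boundary_limits_unique\<close>), and a second average
  along the diagonal turns the tangential derivative into a difference of values, so that all
  first derivatives tend to zero uniformly (\<open>epd_zero_data_unique\<close>). A maximum principle whose constant
  does not degenerate at the diagonal (\<open>epd_max_principle\<close>) then shows that the averages vanish, and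
  hence \<open>W\<close>.
\<close>

section \<open>Joint continuity\<close>

abbreviation continuous3_on :: "(real \<times> real \<times> real) set \<Rightarrow> (real \<Rightarrow> real \<Rightarrow> real \<Rightarrow> real) \<Rightarrow> bool" where
  "continuous3_on S W \<equiv> continuous_on S (\<lambda>(x, y, z). W x y z)"

text \<open>
  Slices and averages are families of functions on \<open>domD\<close>; continuity of such a family is
  always joint continuity in the point and the parameter.
\<close>

abbreviation continuous_family ::
  "real set \<Rightarrow> (real \<Rightarrow> real \<Rightarrow> real \<Rightarrow> real) \<Rightarrow> bool" where
  "continuous_family A w \<equiv> continuous_on (domD \<times> A) (\<lambda>(q, k). w k (fst q) (snd q))"

lemma continuous_on_binary_compose:
  assumes "continuous_on T (\<lambda>(x, y). f x y)" "continuous_on S a" "continuous_on S b"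
    and "\<And>u. u \<in> S \<Longrightarrow> (a u, b u) \<in> T"
  shows "continuous_on S (\<lambda>u. f (a u) (b u))"
  using continuous_on_compose2[OF assms(1) continuous_on_Pair[OF assms(2,3)]] assms(4) by auto

lemma continuous_on_ternary_compose:
  assumes "continuous_on T (\<lambda>(x, y, z). f x y z)" "continuous_on S a" "continuous_on S b" "continuous_on S c"
    and "\<And>u. u \<in> S \<Longrightarrow> (a u, b u, c u) \<in> T"
  shows "continuous_on S (\<lambda>u. f (a u) (b u) (c u))"
  using continuous_on_compose2[OF assms(1) continuous_on_Pair[OF assms(2) continuous_on_Pair[OF assms(3,4)]]]
    assms(5) by auto

section \<open>A comparison form of the mean value theorem\<close>

lemma abs_diff_le_of_deriv_bound:
  fixes G H :: "real \<Rightarrow> real"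
  assumes "a \<le> b"
    and G: "\<And>t. a \<le> t \<Longrightarrow> t \<le> b \<Longrightarrow> (G has_real_derivative G' t) (at t)"
    and H: "\<And>t. a \<le> t \<Longrightarrow> t \<le> b \<Longrightarrow> (H has_real_derivative H' t) (at t)"
    and le: "\<And>t. a \<le> t \<Longrightarrow> t \<le> b \<Longrightarrow> \<bar>G' t\<bar> \<le> H' t"
  shows "\<bar>G b - G a\<bar> \<le> H b - H a"
proof -
  have "(\<lambda>t. H t - G t) a \<le> (\<lambda>t. H t - G t) b"
    by (rule DERIV_nonneg_imp_nondecreasing[OF \<open>a \<le> b\<close>])
       (metis DERIV_diff G H abs_le_D1 diff_ge_0_iff_ge le)
  moreover have "(\<lambda>t. H t + G t) a \<le> (\<lambda>t. H t + G t) b"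
  proof (rule DERIV_nonneg_imp_nondecreasing[OF \<open>a \<le> b\<close>])
    fix t assume t: "a \<le> t" "t \<le> b"
    have "((\<lambda>t. H t + G t) has_real_derivative H' t + G' t) (at t)"
      by (intro DERIV_add G H t)
    moreover have "H' t + G' t \<ge> 0" using le[OF t] by linarith
    ultimately show "\<exists>y. ((\<lambda>t. H t + G t) has_real_derivative y) (at t) \<and> 0 \<le> y" by blast
  qed
  ultimately show ?thesis by auto
qed

section \<open>The Euler-Poisson-Darboux equation and its maximum principle\<close>

text \<open>
  The Euler-Poisson-Darboux equation
  \<open>w\<^sub>x\<^sub>y - p / (x - y) * (w\<^sub>x - w\<^sub>y) - lam * w = 0\<close> as a first-order system: the right-hand side is
  both the \<open>y\<close>-derivative of \<open>w\<^sub>x\<close> and the \<open>x\<close>-derivative of \<open>w\<^sub>y\<close>. In this form the equation can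
  be integrated along both families of characteristics, and it survives translation along the
  diagonal and averaging over a parameter.
\<close>

definition epd ::
  "real \<Rightarrow> real \<Rightarrow> (real \<Rightarrow> real \<Rightarrow> real) \<Rightarrow> (real \<Rightarrow> real \<Rightarrow> real) \<Rightarrow> (real \<Rightarrow> real \<Rightarrow> real) \<Rightarrow> bool"
  where
  "epd p lam w wx wy \<longleftrightarrow>
     continuous_on domD (\<lambda>(x, y). w x y) \<and>
     continuous_on domD (\<lambda>(x, y). wx x y) \<and>
     continuous_on domD (\<lambda>(x, y). wy x y) \<and>
     (\<forall>x y. 0 < y \<longrightarrow> y < x \<longrightarrow>
        ((\<lambda>t. w t y) has_real_derivative wx x y) (at x) \<and>
        ((\<lambda>t. w x t) has_real_derivative wy x y) (at y) \<and>
        ((\<lambda>t. wx x t) has_real_derivative p / (x - y) * (wx x y - wy x y) + lam * w x y) (at y) \<and>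
        ((\<lambda>t. wy t y) has_real_derivative p / (x - y) * (wx x y - wy x y) + lam * w x y) (at x))"

lemma epdD:
  assumes "epd p lam w wx wy"
  shows "continuous_on domD (\<lambda>(x, y). w x y)"
    and "continuous_on domD (\<lambda>(x, y). wx x y)"
    and "continuous_on domD (\<lambda>(x, y). wy x y)"
    and "0 < y \<Longrightarrow> y < x \<Longrightarrow> ((\<lambda>t. w t y) has_real_derivative wx x y) (at x)"
    and "0 < y \<Longrightarrow> y < x \<Longrightarrow> ((\<lambda>t. w x t) has_real_derivative wy x y) (at y)"
    and "0 < y \<Longrightarrow> y < x \<Longrightarrow> ((\<lambda>t. wx x t) has_real_derivative
           p / (x - y) * (wx x y - wy x y) + lam * w x y) (at y)"
    and "0 < y \<Longrightarrow> y < x \<Longrightarrow> ((\<lambda>t. wy t y) has_real_derivative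
           p / (x - y) * (wx x y - wy x y) + lam * w x y) (at x)"
  using assms unfolding epd_def by blast+

text \<open>
  The weight \<open>d powr p\<close> cancels the singular term that multiplies the derivative being
  transported, so along a characteristic only the \<^emph>\<open>other\<close> first derivative carries the factor
  \<open>p / d\<close>.
\<close>

lemma weight_absorbs_own_derivative:
  fixes d :: real
  assumes "d > 0"
  shows "- (p * d powr (p - 1)) * a + (p / d * (a - b) + c) * d powr p = d powr p * c - p * d powr (p - 1) * b"
    and "p * d powr (p - 1) * b + (p / d * (a - b) + c) * d powr p = d powr p * c + p * d powr (p - 1) * a"
proof -
  define P where "P = d powr (p - 1)"
  have "d powr p = P * d" using assms by (simp add: P_def powr_diff)
  then show "- (p * d powr (p - 1)) * a + (p / d * (a - b) + c) * d powr p = d powr p * c - p * d powr (p - 1) * b"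
    and "p * d powr (p - 1) * b + (p / d * (a - b) + c) * d powr p = d powr p * c + p * d powr (p - 1) * a"
    using assms unfolding P_def[symmetric] by (simp_all add: field_simps)
qed

lemma epd_weighted_wx_deriv:
  assumes "epd p lam w wx wy" "0 < y" "y < x"
  shows "((\<lambda>t. (x - t) powr p * wx x t) has_real_derivative
           lam * ((x - y) powr p * w x y) - p * (x - y) powr (p - 1) * wy x y) (at y)"
proof -
  have "((\<lambda>t. (x - t) powr p * wx x t) has_real_derivative
          (- (p * (x - y) powr (p - 1))) * wx x y +
          (p / (x - y) * (wx x y - wy x y) + lam * w x y) * (x - y) powr p) (at y)"
    by (intro DERIV_mult epdD[OF assms(1)] assms)
       (use assms in \<open>auto intro!: derivative_eq_intros simp: powr_diff field_simps\<close>)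
  also have "(- (p * (x - y) powr (p - 1))) * wx x y +
          (p / (x - y) * (wx x y - wy x y) + lam * w x y) * (x - y) powr p
        = lam * ((x - y) powr p * w x y) - p * (x - y) powr (p - 1) * wy x y"
    using assms weight_absorbs_own_derivative[of "x - y" p "wx x y" "wy x y" "lam * w x y"] by (simp add: mult_ac)
  finally show ?thesis .
qed

lemma epd_weighted_wy_deriv:
  assumes "epd p lam w wx wy" "0 < y" "y < x"
  shows "((\<lambda>t. (t - y) powr p * wy t y) has_real_derivative
           lam * ((x - y) powr p * w x y) + p * (x - y) powr (p - 1) * wx x y) (at x)"
proof -
  have "((\<lambda>t. (t - y) powr p * wy t y) has_real_derivative
          (p * (x - y) powr (p - 1)) * wy x y +
          (p / (x - y) * (wx x y - wy x y) + lam * w x y) * (x - y) powr p) (at x)"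
    by (intro DERIV_mult epdD[OF assms(1)] assms)
       (use assms in \<open>auto intro!: derivative_eq_intros simp: powr_diff field_simps\<close>)
  also have "(p * (x - y) powr (p - 1)) * wy x y +
          (p / (x - y) * (wx x y - wy x y) + lam * w x y) * (x - y) powr p
        = lam * ((x - y) powr p * w x y) + p * (x - y) powr (p - 1) * wx x y"
    using assms weight_absorbs_own_derivative[of "x - y" p "wx x y" "wy x y" "lam * w x y"] by (simp add: mult_ac)
  finally show ?thesis .
qed

text \<open>
  Going away from the diagonal, the first derivatives obey
  \<open>d powr p * \<bar>w\<^sub>x\<bar> \<le> e powr p * \<kappa> + \<integral> p * s powr (p - 1) * \<bar>w\<^sub>y\<bar> ds + \<dots>\<close> and the same with \<open>x\<close>
  and \<open>y\<close> exchanged. Since \<open>p * s powr (p - 1)\<close> is the derivative of \<open>s powr p\<close>, the constant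
  \<open>\<kappa>\<close> reproduces itself, and the term with \<open>lam\<close> costs only an exponential factor. The resulting
  bound does not depend on the distance \<open>e\<close> from the diagonal to the line that carries the data.
\<close>

lemma epd_max_principle:
  assumes epd: "epd p lam w wx wy" and p: "0 < p"
    and e: "0 < e" and y0: "0 < y0" and x0: "y0 + e \<le> x0"
    and k: "\<And>y. y0 \<le> y \<Longrightarrow> y + e \<le> x0 \<Longrightarrow>
       \<bar>w (y + e) y\<bar> \<le> \<kappa> \<and> \<bar>wx (y + e) y\<bar> \<le> \<kappa> \<and> \<bar>wy (y + e) y\<bar> \<le> \<kappa>"
  shows "\<bar>w x0 y0\<bar> \<le> \<kappa> * exp ((1 + \<bar>lam\<bar>) * (x0 - y0))"
proof -
  \<comment> \<open>\<open>K \<ge> \<bar>lam\<bar>\<close> absorbs the zero-order term and \<open>K \<ge> 1\<close> makes \<open>E\<close> dominate its own integral, which bounds \<open>w\<close>\<close>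
  define K where "K = 1 + \<bar>lam\<bar>"
  have K: "K \<ge> 1" "K \<ge> \<bar>lam\<bar>" by (auto simp: K_def)
  define T where "T = {(x, y). y0 \<le> y \<and> x \<le> x0 \<and> y + e \<le> x}"
  define E where "E = (\<lambda>s. exp (K * (s - e)))"
  define \<phi> where "\<phi> = (\<lambda>(x, y). max \<bar>w x y\<bar> (max \<bar>wx x y\<bar> \<bar>wy x y\<bar>) / E (x - y))"
  have Epos: "E s > 0" for s by (simp add: E_def)
  have TD: "T \<subseteq> domD" using e y0 by (auto simp: T_def domD_def)
  have "closed T"
  proof -
    have "T = {q. y0 \<le> snd q} \<inter> {q. fst q \<le> x0} \<inter> {q. snd q + e \<le> fst q}"
      by (auto simp: T_def)
    then show ?thesis by (auto intro!: closed_Int closed_Collect_le continuous_intros)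
  qed
  moreover have "bounded T"
    by (rule bounded_subset[of "cbox (y0, y0) (x0, x0)"]) (use e in \<open>auto simp: T_def\<close>)
  ultimately have cT: "compact T" by (simp add: compact_eq_bounded_closed)
  have neT: "(x0, y0) \<in> T" using x0 by (auto simp: T_def)
  have cont: "continuous_on T \<phi>"
  proof -
    have w: "continuous_on T (\<lambda>q. w (fst q) (snd q))" "continuous_on T (\<lambda>q. wx (fst q) (snd q))"
      "continuous_on T (\<lambda>q. wy (fst q) (snd q))"
      using epdD(1-3)[OF epd] TD by (auto simp: case_prod_unfold elim: continuous_on_subset)
    show ?thesis unfolding \<phi>_def E_def case_prod_unfold
      by (intro continuous_intros w) auto
  qed
  obtain x1 y1 where m: "(x1, y1) \<in> T" "\<And>q. q \<in> T \<Longrightarrow> \<phi> q \<le> \<phi> (x1, y1)"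
    using continuous_attains_sup[OF cT _ cont] neT by (metis empty_iff surj_pair)
  define S where "S = \<phi> (x1, y1)"
  have S0: "S \<ge> 0" unfolding S_def \<phi>_def using Epos by (auto simp: le_max_iff_disj less_imp_le)
  have bd: "\<bar>w x y\<bar> \<le> S * E (x - y)" "\<bar>wx x y\<bar> \<le> S * E (x - y)" "\<bar>wy x y\<bar> \<le> S * E (x - y)"
    if "(x, y) \<in> T" for x y
    using m(2)[OF that] Epos[of "x - y"] unfolding S_def[symmetric]
    by (auto simp: \<phi>_def pos_divide_le_eq)
  \<comment> \<open>If the supremum \<open>S\<close> exceeded \<open>\<kappa>\<close>, it could not be attained: every value would be strictly smaller.\<close>
  have main: "\<bar>w x y\<bar> < S * E (x - y)" "\<bar>wx x y\<bar> < S * E (x - y)" "\<bar>wy x y\<bar> < S * E (x - y)"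
    if Sk: "\<kappa> < S" and xy: "(x, y) \<in> T" for x y
  proof -
    have xy': "y0 \<le> y" "x \<le> x0" "y + e \<le> x" using xy by (auto simp: T_def)
    have pos: "x - y > 0" using xy' e by auto
    have bdE: "\<bar>lam * (s powr p * a) + c * (p * s powr (p - 1) * b)\<bar>
        \<le> S * (p * s powr (p - 1) * E s + s powr p * (K * E s))"
      if s: "s \<ge> e" and ab: "\<bar>a\<bar> \<le> S * E s" "\<bar>b\<bar> \<le> S * E s" and c: "\<bar>c\<bar> = 1" for s a b c
    proof -
      have "\<bar>lam * (s powr p * a) + c * (p * s powr (p - 1) * b)\<bar>
          \<le> \<bar>lam\<bar> * (s powr p * \<bar>a\<bar>) + (p * s powr (p - 1) * \<bar>b\<bar>)"
        by (rule order_trans[OF abs_triangle_ineq]) (use c p in \<open>simp add: abs_mult\<close>)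
      also have "\<dots> \<le> K * (s powr p * (S * E s)) + (p * s powr (p - 1) * (S * E s))"
        using ab K p S0 by (intro add_mono mult_mono mult_left_mono) auto
      finally show ?thesis by (simp add: algebra_simps)
    qed
    have 1: "\<bar>w x y\<bar> \<le> \<kappa> + (S * E (x - y) - S)"
    proof -
      have "\<bar>w x y - w (y + e) y\<bar> \<le> S * E (x - y) - S * E ((y + e) - y)"
      proof (rule abs_diff_le_of_deriv_bound[where G' = "\<lambda>t. wx t y" and H' = "\<lambda>t. S * (K * E (t - y))"])
        fix t assume t: "y + e \<le> t" "t \<le> x"
        then have tT: "(t, y) \<in> T" using xy' by (auto simp: T_def)
        show "((\<lambda>t. w t y) has_real_derivative wx t y) (at t)"
          by (rule epdD[OF epd]) (use t e y0 xy' in auto)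
        show "((\<lambda>t. S * E (t - y)) has_real_derivative S * (K * E (t - y))) (at t)"
          unfolding E_def by (auto intro!: derivative_eq_intros)
        have "S * E (t - y) \<le> S * (K * E (t - y))"
          using K S0 Epos[of "t - y"] by (intro mult_left_mono) auto
        then show "\<bar>wx t y\<bar> \<le> S * (K * E (t - y))" using bd(2)[OF tT] by linarith
      qed (use xy' in auto)
      moreover have "\<bar>w (y + e) y\<bar> \<le> \<kappa>" using k xy' by auto
      ultimately show ?thesis by (auto simp: E_def)
    qed
    have Hd: "((\<lambda>t. S * ((t - y) powr p * E (t - y))) has_real_derivative
        S * (p * (t - y) powr (p - 1) * E (t - y) + (t - y) powr p * (K * E (t - y)))) (at t)"
      if "t > y" for t y
      using that unfolding E_def by (auto intro!: derivative_eq_intros simp: powr_diff field_simps)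
    have Hd': "((\<lambda>t. - (S * ((x - t) powr p * E (x - t)))) has_real_derivative
        S * (p * (x - t) powr (p - 1) * E (x - t) + (x - t) powr p * (K * E (x - t)))) (at t)"
      if "t < x" for t x
      using that unfolding E_def by (auto intro!: derivative_eq_intros simp: powr_diff field_simps)
    have 2: "(x - y) powr p * \<bar>wy x y\<bar> \<le> e powr p * \<kappa> + S * ((x - y) powr p * E (x - y)) - S * e powr p"
    proof -
      have "\<bar>(x - y) powr p * wy x y - ((y + e) - y) powr p * wy (y + e) y\<bar>
         \<le> S * ((x - y) powr p * E (x - y)) - S * (((y + e) - y) powr p * E ((y + e) - y))"
      proof (rule abs_diff_le_of_deriv_bound[OF _ epd_weighted_wy_deriv[OF epd] Hd])
        fix t assume t: "y + e \<le> t" "t \<le> x"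
        then have tT: "(t, y) \<in> T" using xy' by (auto simp: T_def)
        show "\<bar>lam * ((t - y) powr p * w t y) + p * (t - y) powr (p - 1) * wx t y\<bar> \<le>
          S * (p * (t - y) powr (p - 1) * E (t - y) + (t - y) powr p * (K * E (t - y)))"
          using bdE[OF _ bd(1)[OF tT] bd(2)[OF tT], of 1] t by simp
      qed (use xy' e y0 in auto)
      moreover have "e powr p * \<bar>wy (y + e) y\<bar> \<le> e powr p * \<kappa>"
        using k xy' by (auto intro!: mult_left_mono)
      moreover have "\<bar>(x - y) powr p * wy x y\<bar> = (x - y) powr p * \<bar>wy x y\<bar>"
         "\<bar>e powr p * wy (y + e) y\<bar> = e powr p * \<bar>wy (y + e) y\<bar>" by (auto simp: abs_mult)
      ultimately show ?thesis by (auto simp: E_def)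
    qed
    have 3: "(x - y) powr p * \<bar>wx x y\<bar> \<le> e powr p * \<kappa> + S * ((x - y) powr p * E (x - y)) - S * e powr p"
    proof -
      have "\<bar>(x - (x - e)) powr p * wx x (x - e) - (x - y) powr p * wx x y\<bar>
         \<le> - (S * ((x - (x - e)) powr p * E (x - (x - e)))) - - (S * ((x - y) powr p * E (x - y)))"
      proof (rule abs_diff_le_of_deriv_bound[OF _ epd_weighted_wx_deriv[OF epd] Hd'])
        fix t assume t: "y \<le> t" "t \<le> x - e"
        then have tT: "(x, t) \<in> T" using xy' by (auto simp: T_def)
        show "\<bar>lam * ((x - t) powr p * w x t) - p * (x - t) powr (p - 1) * wy x t\<bar> \<le>
          S * (p * (x - t) powr (p - 1) * E (x - t) + (x - t) powr p * (K * E (x - t)))"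
          using bdE[OF _ bd(1)[OF tT] bd(3)[OF tT], of "-1"] t by simp
      qed (use xy' e y0 in auto)
      moreover have "\<bar>wx x (x - e)\<bar> \<le> \<kappa>" using k[of "x - e"] xy' by auto
      then have "e powr p * \<bar>wx x (x - e)\<bar> \<le> e powr p * \<kappa>"
        by (auto intro!: mult_left_mono)
      moreover have "\<bar>(x - y) powr p * wx x y\<bar> = (x - y) powr p * \<bar>wx x y\<bar>"
         "\<bar>e powr p * wx x (x - e)\<bar> = e powr p * \<bar>wx x (x - e)\<bar>" by (auto simp: abs_mult)
      ultimately show ?thesis by (auto simp: E_def)
    qed
    have ep: "e powr p * \<kappa> < e powr p * S" using Sk e by simp
    show "\<bar>w x y\<bar> < S * E (x - y)" using 1 Sk by linarith
    have "(x - y) powr p * \<bar>wx x y\<bar> < (x - y) powr p * (S * E (x - y))"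
      using 3 ep by (simp add: algebra_simps)
    then show "\<bar>wx x y\<bar> < S * E (x - y)" using pos by (simp add: mult_less_cancel_left)
    have "(x - y) powr p * \<bar>wy x y\<bar> < (x - y) powr p * (S * E (x - y))"
      using 2 ep by (simp add: algebra_simps)
    then show "\<bar>wy x y\<bar> < S * E (x - y)" using pos by (simp add: mult_less_cancel_left)
  qed
  have Sk: "S \<le> \<kappa>"
  proof (rule ccontr)
    assume "\<not> S \<le> \<kappa>"
    then have "max \<bar>w x1 y1\<bar> (max \<bar>wx x1 y1\<bar> \<bar>wy x1 y1\<bar>) < S * E (x1 - y1)"
      using main[OF _ m(1)] by auto
    then have "\<phi> (x1, y1) < S" using Epos[of "x1 - y1"] by (simp add: \<phi>_def pos_divide_less_eq)
    then show False by (simp add: S_def)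
  qed
  have "\<bar>w x0 y0\<bar> \<le> S * E (x0 - y0)" using bd neT by auto
  also have "\<dots> \<le> \<kappa> * exp ((1 + \<bar>lam\<bar>) * (x0 - y0))"
    using Sk S0 e K unfolding E_def K_def[symmetric] by (intro mult_mono) auto
  finally show ?thesis .
qed

section \<open>A priori bounds up to the singular diagonal\<close>

text \<open>
  A solution that is bounded, with its first derivatives, on the two far sides \<open>y = y0\<close> and \<open>x = X\<close>
  of a characteristic rectangle is controlled up to the diagonal: these sides determine it as
  data of a Goursat problem, and both stay away from the diagonal. This is why the first derivatives
  grow at most like \<open>(x - y) powr (- 2 * p)\<close>, whatever the solution does on the diagonal.

  The comparison functions are \<open>g\<close> for \<open>d powr p * w\<^sub>x\<close> and \<open>d powr p * w\<^sub>y\<close>, and \<open>h\<close> for \<open>w\<close>.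
  They decrease in the distance \<open>s\<close> to the diagonal fast enough,
  \<open>- g' = (p / s + K) * g\<close> and \<open>- h' = K * h + s powr (- p) * g\<close>, to dominate the integrals along the
  characteristics. The exponent \<open>- p\<close> in \<open>g\<close> is exactly the critical one; \<open>h\<close> stays bounded
  because \<open>2 * p < 1\<close>. The constant \<open>M\<close> is chosen before the solution, so that the bound is uniform
  over families.
\<close>

lemma epd_bound_near_diagonal:
  assumes p: "0 < p" "p < 1/2" and ord: "0 < y0" "y0 < c1" "c1 \<le> c2" "c2 < X" and C: "0 \<le> C"
  shows "\<exists>M\<ge>0. \<forall>w wx wy. epd p lam w wx wy \<longrightarrow>
     (\<forall>x\<in>{c1..X}. \<bar>wx x y0\<bar> \<le> C) \<longrightarrow> (\<forall>y\<in>{y0..c2}. \<bar>w X y\<bar> \<le> C \<and> \<bar>wy X y\<bar> \<le> C) \<longrightarrow>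
     (\<forall>x\<in>{c1..X}. \<forall>y\<in>{y0..c2}. y < x \<longrightarrow>
        \<bar>w x y\<bar> \<le> M \<and> \<bar>wx x y\<bar> \<le> M * (x - y) powr (- 2 * p) \<and> \<bar>wy x y\<bar> \<le> M * (x - y) powr (- 2 * p))"
proof -
  define L where "L = X - y0"
  have L: "L > 0" using ord by (simp add: L_def)
  define a where "a = 1 - 2 * p"
  have a: "a > 0" using p by (simp add: a_def)
  define H where "H = 1 + L powr a / a"
  have H: "H \<ge> 1" using a L by (simp add: H_def)
  define K where "K = 1 + \<bar>lam\<bar> * (L powr (2 * p) * H)"
  have K1: "K \<ge> 1" using H by (simp add: K_def)
  define g where "g = (\<lambda>s. s powr (- p) * exp (- K * s))"
  define h where "h = (\<lambda>s. exp (- K * s) * (H - s powr a / a))"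
  define S0 where "S0 = C * exp (K * L) * (1 + L powr (2 * p))"
  have S0: "S0 \<ge> 0" using C by (simp add: S0_def)
  have gpos: "g s > 0" if "s > 0" for s using that by (simp add: g_def)
  have h1: "h s \<ge> exp (- K * s)" if "0 \<le> s" "s \<le> L" for s
  proof -
    have "s powr a \<le> L powr a" using that a by (intro powr_mono2) auto
    then have "H - s powr a / a \<ge> 1" using a by (simp add: H_def divide_right_mono)
    then show ?thesis unfolding h_def using mult_left_mono[of 1 _ "exp (- K * s)"] by simp
  qed
  have hpos: "h s > 0" if "0 \<le> s" "s \<le> L" for s using h1[OF that] by (smt (verit) exp_gt_zero)
  have hH: "h s \<le> exp (- K * s) * H" if "0 \<le> s" for s
    unfolding h_def using a that by (intro mult_left_mono) auto
  have dg: "(g has_real_derivative - (p / s * g s + K * g s)) (at s)" if "s > 0" for s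
    unfolding g_def using that
    by (auto intro!: derivative_eq_intros simp: powr_minus powr_diff field_simps)
  have dh: "(h has_real_derivative - (K * h s + s powr (- p) * g s)) (at s)" if "s > 0" for s
  proof -
    have "(h has_real_derivative (- K * exp (- K * s)) * (H - s powr a / a)
        + exp (- K * s) * (- (s powr (a - 1)))) (at s)"
      unfolding h_def using that a
      by (auto intro!: derivative_eq_intros)
    moreover have "s powr (a - 1) = s powr (- p) * s powr (- p)"
      by (simp add: a_def powr_add[symmetric])
    ultimately show ?thesis by (simp add: h_def g_def algebra_simps)
  qed
  have Kg: "\<bar>lam\<bar> * (s powr p * h s) \<le> K * g s" if "0 < s" "s \<le> L" for s
  proof -
    have "\<bar>lam\<bar> * (s powr p * h s) \<le> \<bar>lam\<bar> * (s powr p * (exp (- K * s) * H))"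
      using hH[of s] that by (intro mult_left_mono) auto
    also have "\<dots> = (\<bar>lam\<bar> * (s powr (2 * p) * H)) * g s"
    proof -
      have "s powr p = s powr (2 * p) * s powr (- p)" by (simp flip: powr_add)
      then show ?thesis by (simp add: g_def)
    qed
    also have "\<dots> \<le> K * g s"
    proof -
      have "s powr (2 * p) \<le> L powr (2 * p)" using that p by (intro powr_mono2) auto
      then have "\<bar>lam\<bar> * (s powr (2 * p) * H) \<le> \<bar>lam\<bar> * (L powr (2 * p) * H)"
        using H by (intro mult_left_mono mult_right_mono) auto
      then show ?thesis using gpos[OF that(1)] by (intro mult_right_mono) (auto simp: K_def)
    qed
    finally show ?thesis .
  qed
  have main: "\<bar>w x y\<bar> \<le> S0 * h (x - y) \<and> (x - y) powr p * \<bar>wx x y\<bar> \<le> S0 * g (x - y)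
       \<and> (x - y) powr p * \<bar>wy x y\<bar> \<le> S0 * g (x - y)"
    if epd: "epd p lam w wx wy" and C1: "\<And>x. x \<in> {c1..X} \<Longrightarrow> \<bar>wx x y0\<bar> \<le> C"
      and C2: "\<And>y. y \<in> {y0..c2} \<Longrightarrow> \<bar>w X y\<bar> \<le> C"
      and C3: "\<And>y. y \<in> {y0..c2} \<Longrightarrow> \<bar>wy X y\<bar> \<le> C"
      and xy: "c1 \<le> x" "x \<le> X" "y0 \<le> y" "y \<le> c2" "y < x"
    for w wx wy x y
  proof -
    \<comment> \<open>The supremum is taken over the part of the rectangle at distance at least that of the given point, where everything is continuous; its bound does not depend on \<open>e\<close>.\<close>
    define e where "e = x - y"
    have e: "e > 0" using xy by (simp add: e_def)
    define T where "T = {(x, y). c1 \<le> x \<and> x \<le> X \<and> y0 \<le> y \<and> y \<le> c2 \<and> y + e \<le> x}"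
    define \<phi> where "\<phi> = (\<lambda>(x, y). max (\<bar>w x y\<bar> / h (x - y))
       ((x - y) powr p * max \<bar>wx x y\<bar> \<bar>wy x y\<bar> / g (x - y)))"
    have TD: "T \<subseteq> domD" using e ord by (auto simp: T_def domD_def)
    have Tpos: "0 < x - y" "x - y \<le> L" if "(x, y) \<in> T" for x y
      using that e by (auto simp: T_def L_def)
    have cT: "compact T"
    proof -
      have "T = cbox (c1, y0) (X, c2) \<inter> {q. snd q + e \<le> fst q}" by (auto simp: T_def)
      then show ?thesis by (auto intro!: closed_Collect_le continuous_intros)
    qed
    have neT: "(x, y) \<in> T" using xy by (auto simp: T_def e_def)
    have cont: "continuous_on T \<phi>"
    proof -
      have w: "continuous_on T (\<lambda>q. w (fst q) (snd q))" "continuous_on T (\<lambda>q. wx (fst q) (snd q))"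
        "continuous_on T (\<lambda>q. wy (fst q) (snd q))"
        using epdD(1-3)[OF epd] TD by (auto simp: case_prod_unfold elim: continuous_on_subset)
      have ne: "h (fst q - snd q) \<noteq> 0" "g (fst q - snd q) \<noteq> 0" "fst q - snd q \<noteq> 0" if "q \<in> T" for q
        using Tpos[of "fst q" "snd q"] hpos[of "fst q - snd q"] gpos[of "fst q - snd q"] that by auto
      have hg: "continuous_on T (\<lambda>q. h (fst q - snd q))" "continuous_on T (\<lambda>q. g (fst q - snd q))"
        unfolding h_def g_def
        by (intro continuous_intros ballI; use ne a in force)+
      show ?thesis unfolding \<phi>_def case_prod_unfold
        by (intro continuous_intros w hg ballI) (use ne in auto)
    qed
    obtain x1 y1 where m: "(x1, y1) \<in> T" "\<And>q. q \<in> T \<Longrightarrow> \<phi> q \<le> \<phi> (x1, y1)"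
      using continuous_attains_sup[OF cT _ cont] neT by (metis empty_iff surj_pair)
    define S where "S = \<phi> (x1, y1)"
    have Spos: "S \<ge> 0"
    proof -
      have "0 \<le> \<bar>w x1 y1\<bar> / h (x1 - y1)" using hpos[of "x1 - y1"] Tpos[OF m(1)] by simp
      also have "\<dots> \<le> S" by (simp add: S_def \<phi>_def)
      finally show ?thesis .
    qed
    have bd: "\<bar>w x y\<bar> \<le> S * h (x - y)" "(x - y) powr p * \<bar>wx x y\<bar> \<le> S * g (x - y)"
         "(x - y) powr p * \<bar>wy x y\<bar> \<le> S * g (x - y)" if "(x, y) \<in> T" for x y
    proof -
      have 1: "\<bar>w x y\<bar> / h (x - y) \<le> S" "(x - y) powr p * max \<bar>wx x y\<bar> \<bar>wy x y\<bar> / g (x - y) \<le> S"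
        using m(2)[OF that] unfolding S_def[symmetric] by (auto simp: \<phi>_def)
      note t = Tpos[OF that]
      show "\<bar>w x y\<bar> \<le> S * h (x - y)" using 1(1) hpos[of "x - y"] t by (simp add: pos_divide_le_eq)
      have 2: "(x - y) powr p * max \<bar>wx x y\<bar> \<bar>wy x y\<bar> \<le> S * g (x - y)"
        using 1(2) gpos[of "x - y"] t by (simp add: pos_divide_le_eq)
      have "(x - y) powr p * \<bar>wx x y\<bar> \<le> (x - y) powr p * max \<bar>wx x y\<bar> \<bar>wy x y\<bar>"
        "(x - y) powr p * \<bar>wy x y\<bar> \<le> (x - y) powr p * max \<bar>wx x y\<bar> \<bar>wy x y\<bar>"
        by (intro mult_left_mono; simp)+
      with 2 show "(x - y) powr p * \<bar>wx x y\<bar> \<le> S * g (x - y)"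
         "(x - y) powr p * \<bar>wy x y\<bar> \<le> S * g (x - y)" by linarith+
    qed
    have bdg: "\<bar>lam * (s powr p * a) + c * (p * s powr (p - 1) * b)\<bar> \<le> S * (p / s * g s + K * g s)"
      if s: "0 < s" "s \<le> L" and ab: "\<bar>a\<bar> \<le> S * h s" "s powr p * \<bar>b\<bar> \<le> S * g s" and c: "\<bar>c\<bar> = 1"
      for s a b c
    proof -
      have "\<bar>lam * (s powr p * a) + c * (p * s powr (p - 1) * b)\<bar>
          \<le> \<bar>lam\<bar> * (s powr p * \<bar>a\<bar>) + p / s * (s powr p * \<bar>b\<bar>)"
        by (rule order_trans[OF abs_triangle_ineq]) (use c p s in \<open>simp add: abs_mult powr_diff\<close>)
      also have "\<dots> \<le> \<bar>lam\<bar> * (s powr p * (S * h s)) + p / s * (S * g s)"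
        using ab p s by (intro add_mono mult_left_mono) auto
      also have "\<dots> = S * (\<bar>lam\<bar> * (s powr p * h s)) + p / s * (S * g s)" by simp
      also have "\<dots> \<le> S * (K * g s) + p / s * (S * g s)"
        using mult_left_mono[OF Kg[OF s] Spos] by simp
      finally show ?thesis by (simp add: algebra_simps)
    qed
    have data_h: "C < S * h s" if "S0 < S" "0 \<le> s" "s \<le> L" for s
    proof -
      have "exp (- K * L) \<le> exp (- K * s)" using that K1 by simp
      also have "\<dots> \<le> h s" by (rule h1[OF that(2,3)])
      finally have "S * exp (- K * L) \<le> S * h s" using Spos by (intro mult_left_mono) auto
      moreover have "C \<le> S0 * exp (- K * L)"
        using C by (simp add: S0_def exp_minus field_simps)
      moreover have "S0 * exp (- K * L) < S * exp (- K * L)" using that by simp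
      ultimately show ?thesis by linarith
    qed
    have data_g: "s powr p * C < S * g s" if "S0 < S" "0 < s" "s \<le> L" for s
    proof -
      have "s powr (2 * p) * C \<le> L powr (2 * p) * C"
        using that C p by (intro mult_right_mono powr_mono2) auto
      also have "\<dots> \<le> S0 * exp (- K * L)" using C by (simp add: S0_def exp_minus field_simps)
      also have "\<dots> < S * exp (- K * L)" using that by simp
      also have "\<dots> \<le> S * exp (- K * s)" using that K1 Spos by (intro mult_left_mono) auto
      finally have "s powr (- p) * (s powr (2 * p) * C) < s powr (- p) * (S * exp (- K * s))"
        using that by simp
      moreover have "s powr (- p) * (s powr (2 * p) * C) = s powr p * C"
        by (simp add: mult.assoc[symmetric] powr_add[symmetric])
      ultimately have "s powr p * C < s powr (- p) * (S * exp (- K * s))" by metis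
      also have "\<dots> = S * g s" by (simp add: g_def)
      finally show ?thesis .
    qed
    \<comment> \<open>At a maximum point with \<open>S > S0\<close> the data are strictly below \<open>S * g\<close> and \<open>S * h\<close>, which contradicts the integrated inequality for whichever of the three quantities attains the maximum.\<close>
    have SS: "S \<le> S0"
    proof (rule ccontr)
      assume "\<not> S \<le> S0"
      then have SS: "S0 < S" by simp
      let ?d = "x1 - y1"
      have q: "c1 \<le> x1" "x1 \<le> X" "y0 \<le> y1" "y1 \<le> c2" "y1 + e \<le> x1" using m(1) by (auto simp: T_def)
      have d: "0 < ?d" "?d \<le> L" using Tpos[OF m(1)] .
      have 1: "\<bar>w x1 y1\<bar> < S * h ?d"
      proof -
        have "\<bar>w X y1 - w x1 y1\<bar> \<le> - (S * h (X - y1)) - - (S * h (x1 - y1))"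
        proof (rule abs_diff_le_of_deriv_bound[where G = "\<lambda>t. w t y1" and G' = "\<lambda>t. wx t y1" and
              H = "\<lambda>t. - (S * h (t - y1))" and
              H' = "\<lambda>t. S * (K * h (t - y1) + (t - y1) powr (- p) * g (t - y1))"])
          fix t assume t: "x1 \<le> t" "t \<le> X"
          then have tT: "(t, y1) \<in> T" using q by (auto simp: T_def)
          note tp = Tpos[OF tT]
          show "((\<lambda>t. w t y1) has_real_derivative wx t y1) (at t)"
            by (rule epdD[OF epd]) (use tp q ord in auto)
          have "((\<lambda>t. h (t - y1)) has_real_derivative - (K * h (t - y1) + (t - y1) powr (- p) * g (t - y1)) * 1) (at t)"
            by (rule DERIV_chain2[where f = h and g = "\<lambda>t. t - y1", OF dh[OF tp(1)]]) (auto intro!: derivative_eq_intros)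
          from DERIV_minus[OF DERIV_cmult[OF this, of S]]
          show "((\<lambda>t. - (S * h (t - y1))) has_real_derivative
             S * (K * h (t - y1) + (t - y1) powr (- p) * g (t - y1))) (at t)" by (simp add: algebra_simps)
          have "\<bar>wx t y1\<bar> = (t - y1) powr (- p) * ((t - y1) powr p * \<bar>wx t y1\<bar>)"
            using tp by (simp add: powr_minus)
          also have "\<dots> \<le> (t - y1) powr (- p) * (S * g (t - y1))"
            by (intro mult_left_mono bd(2)[OF tT]) auto
          also have "\<dots> \<le> (t - y1) powr (- p) * (S * g (t - y1)) + S * (K * h (t - y1))"
            using Spos K1 hpos[of "t - y1"] tp by simp
          finally show "\<bar>wx t y1\<bar> \<le> S * (K * h (t - y1) + (t - y1) powr (- p) * g (t - y1))"
            by (simp add: algebra_simps)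
        qed (use q in auto)
        moreover have "\<bar>w X y1\<bar> \<le> C" using C2 q by auto
        moreover have "C < S * h (X - y1)" by (rule data_h[OF SS]) (use q d in \<open>auto simp: L_def\<close>)
        ultimately show ?thesis by linarith
      qed
      have 2: "?d powr p * \<bar>wy x1 y1\<bar> < S * g ?d"
      proof -
        have "\<bar>(X - y1) powr p * wy X y1 - (x1 - y1) powr p * wy x1 y1\<bar>
            \<le> - (S * g (X - y1)) - - (S * g (x1 - y1))"
        proof (rule abs_diff_le_of_deriv_bound[OF _ epd_weighted_wy_deriv[OF epd], where
              H = "\<lambda>t. - (S * g (t - y1))" and
              H' = "\<lambda>t. S * (p / (t - y1) * g (t - y1) + K * g (t - y1))"])
          fix t assume t: "x1 \<le> t" "t \<le> X"
          then have tT: "(t, y1) \<in> T" using q by (auto simp: T_def)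
          note tp = Tpos[OF tT]
          have "((\<lambda>t. g (t - y1)) has_real_derivative - (p / (t - y1) * g (t - y1) + K * g (t - y1)) * 1) (at t)"
            by (rule DERIV_chain2[where f = g and g = "\<lambda>t. t - y1", OF dg[OF tp(1)]]) (auto intro!: derivative_eq_intros)
          from DERIV_minus[OF DERIV_cmult[OF this, of S]]
          show "((\<lambda>t. - (S * g (t - y1))) has_real_derivative
             S * (p / (t - y1) * g (t - y1) + K * g (t - y1))) (at t)" by (simp add: algebra_simps)
          show "\<bar>lam * ((t - y1) powr p * w t y1) + p * (t - y1) powr (p - 1) * wx t y1\<bar>
             \<le> S * (p / (t - y1) * g (t - y1) + K * g (t - y1))"
            using bdg[OF tp bd(1,2)[OF tT], of 1] by simp
        qed (use q d ord in auto)
        moreover have "(X - y1) powr p * \<bar>wy X y1\<bar> \<le> (X - y1) powr p * C"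
          using C3 q by (intro mult_left_mono) auto
        moreover have "(X - y1) powr p * C < S * g (X - y1)"
          by (rule data_g[OF SS]) (use q d in \<open>auto simp: L_def\<close>)
        moreover have "\<bar>(X - y1) powr p * wy X y1\<bar> = (X - y1) powr p * \<bar>wy X y1\<bar>"
           "\<bar>?d powr p * wy x1 y1\<bar> = ?d powr p * \<bar>wy x1 y1\<bar>" by (auto simp: abs_mult)
        ultimately show ?thesis by linarith
      qed
      have 3: "?d powr p * \<bar>wx x1 y1\<bar> < S * g ?d"
      proof -
        have "\<bar>(x1 - y1) powr p * wx x1 y1 - (x1 - y0) powr p * wx x1 y0\<bar>
            \<le> S * g (x1 - y1) - S * g (x1 - y0)"
        proof (rule abs_diff_le_of_deriv_bound[OF _ epd_weighted_wx_deriv[OF epd], where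
              H = "\<lambda>t. S * g (x1 - t)" and
              H' = "\<lambda>t. S * (p / (x1 - t) * g (x1 - t) + K * g (x1 - t))"])
          fix t assume t: "y0 \<le> t" "t \<le> y1"
          then have tT: "(x1, t) \<in> T" using q by (auto simp: T_def)
          note tp = Tpos[OF tT]
          have "((\<lambda>t. g (x1 - t)) has_real_derivative - (p / (x1 - t) * g (x1 - t) + K * g (x1 - t)) * (-1)) (at t)"
            by (rule DERIV_chain2[where f = g and g = "\<lambda>t. x1 - t", OF dg[OF tp(1)]]) (auto intro!: derivative_eq_intros)
          from DERIV_cmult[OF this, of S]
          show "((\<lambda>t. S * g (x1 - t)) has_real_derivative
             S * (p / (x1 - t) * g (x1 - t) + K * g (x1 - t))) (at t)" by (simp add: algebra_simps)
          show "\<bar>lam * ((x1 - t) powr p * w x1 t) - p * (x1 - t) powr (p - 1) * wy x1 t\<bar>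
             \<le> S * (p / (x1 - t) * g (x1 - t) + K * g (x1 - t))"
            using bdg[OF tp bd(1,3)[OF tT], of "-1"] by simp
        qed (use q d ord in auto)
        moreover have "(x1 - y0) powr p * \<bar>wx x1 y0\<bar> \<le> (x1 - y0) powr p * C"
          using C1 q by (intro mult_left_mono) auto
        moreover have "(x1 - y0) powr p * C < S * g (x1 - y0)"
          by (rule data_g[OF SS]) (use q d in \<open>auto simp: L_def\<close>)
        moreover have "\<bar>(x1 - y0) powr p * wx x1 y0\<bar> = (x1 - y0) powr p * \<bar>wx x1 y0\<bar>"
           "\<bar>?d powr p * wx x1 y1\<bar> = ?d powr p * \<bar>wx x1 y1\<bar>" by (auto simp: abs_mult)
        ultimately show ?thesis by linarith
      qed
      have "\<phi> (x1, y1) < S"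
        using 1 2 3 hpos[of ?d] gpos[of ?d] d
        by (auto simp: \<phi>_def pos_divide_less_eq max_mult_distrib_left)
      then show False by (simp add: S_def)
    qed
    have "S * h (x - y) \<le> S0 * h (x - y)" "S * g (x - y) \<le> S0 * g (x - y)"
      using SS hpos[of "x - y"] gpos[of "x - y"] Tpos[OF neT] by (auto intro!: mult_right_mono)
    with bd[OF neT] show ?thesis by linarith
  qed
  show ?thesis
  proof (intro exI[of _ "S0 * H"] conjI allI impI ballI)
    show "0 \<le> S0 * H" using S0 H by simp
    fix w wx wy x y
    assume *: "epd p lam w wx wy" "\<forall>x\<in>{c1..X}. \<bar>wx x y0\<bar> \<le> C" 
       "\<forall>y\<in>{y0..c2}. \<bar>w X y\<bar> \<le> C \<and> \<bar>wy X y\<bar> \<le> C"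
       "x \<in> {c1..X}" "y \<in> {y0..c2}" "y < x"
    have m: "\<bar>w x y\<bar> \<le> S0 * h (x - y) \<and> (x - y) powr p * \<bar>wx x y\<bar> \<le> S0 * g (x - y)
       \<and> (x - y) powr p * \<bar>wy x y\<bar> \<le> S0 * g (x - y)"
      by (rule main[OF *(1)]) (use * in auto)
    have d: "0 < x - y" using * by auto
    have ex: "exp (- K * (x - y)) \<le> 1" using K1 d by simp
    have "h (x - y) \<le> exp (- K * (x - y)) * H" using hH d by auto
    also have "\<dots> \<le> 1 * H" using ex H by (intro mult_right_mono) auto
    finally have "S0 * h (x - y) \<le> S0 * H" using S0 by (simp add: mult_left_mono)
    with m show "\<bar>w x y\<bar> \<le> S0 * H" by linarith
    have gg: "\<bar>b\<bar> \<le> S0 * H * (x - y) powr (- 2 * p)" if "(x - y) powr p * \<bar>b\<bar> \<le> S0 * g (x - y)" for b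
    proof -
      have "\<bar>b\<bar> = (x - y) powr (- p) * ((x - y) powr p * \<bar>b\<bar>)" using d by (simp add: powr_minus)
      also have "\<dots> \<le> (x - y) powr (- p) * (S0 * g (x - y))"
        by (intro mult_left_mono that) auto
      also have "\<dots> = S0 * exp (- K * (x - y)) * (x - y) powr (- 2 * p)"
      proof -
        have "(x - y) powr (- 2 * p) = (x - y) powr (- p) * (x - y) powr (- p)" by (simp flip: powr_add)
        then show ?thesis by (simp add: g_def)
      qed
      also have "\<dots> \<le> S0 * H * (x - y) powr (- 2 * p)"
        by (intro mult_right_mono mult_left_mono order_trans[OF ex H] S0) auto
      finally show ?thesis .
    qed
    show "\<bar>wx x y\<bar> \<le> S0 * H * (x - y) powr (- 2 * p)" "\<bar>wy x y\<bar> \<le> S0 * H * (x - y) powr (- 2 * p)"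
      using gg m by auto
  qed
qed

section \<open>Derivatives along the diagonal and averages of solutions\<close>

lemma deriv_along_diagonal:
  fixes f fx fy :: "real \<Rightarrow> real \<Rightarrow> real"
  assumes fx: "\<And>x y. 0 < y \<Longrightarrow> y < x \<Longrightarrow> ((\<lambda>t. f t y) has_real_derivative fx x y) (at x)"
    and fy: "\<And>x y. 0 < y \<Longrightarrow> y < x \<Longrightarrow> ((\<lambda>t. f x t) has_real_derivative fy x y) (at y)"
    and c: "continuous_on domD (\<lambda>(x, y). fy x y)"
    and h: "0 < b + h" "b < a"
  shows "((\<lambda>h. f (a + h) (b + h)) has_real_derivative fx (a + h) (b + h) + fy (a + h) (b + h)) (at h)"
proof -
  define x y where "x = a + h" and "y = b + h"
  have xy: "0 < y" "y < x" using h by (auto simp: x_def y_def)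
  define m where "m = (x + y) / 2"
  define X Y where "X = {m<..}" and "Y = {0<..<m}"
  have XY: "X \<times> Y \<subseteq> domD" by (auto simp: X_def Y_def domD_def)
  have o: "open (X \<times> Y)" by (auto simp: X_def Y_def intro!: open_Times)
  have mem: "x \<in> X" "y \<in> Y" using xy by (auto simp: X_def Y_def m_def)
  have "((\<lambda>(x, y). f x y) has_derivative
      (\<lambda>(tx, ty). fx x y * tx + blinfun_mult_right (fy x y) ty)) (at (x, y) within X \<times> Y)"
  proof (rule has_derivative_partialsI[OF _ _ _ mem(2)])
    show "((\<lambda>x. f x y) has_derivative (*) (fx x y)) (at x within X)"
      using fx[OF xy] by (simp add: has_field_derivative_def has_derivative_at_withinI)
    fix x' y' assume "x' \<in> X" "y' \<in> Y"
    then have "0 < y'" "y' < x'" by (auto simp: X_def Y_def)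
    from fy[OF this]
    show "((\<lambda>y. f x' y) has_derivative blinfun_apply (blinfun_mult_right (fy x' y'))) (at y' within Y)"
      by (simp add: has_field_derivative_def has_derivative_at_withinI)
  next
    have "continuous_on (X \<times> Y) (\<lambda>q. blinfun_mult_right (fy (fst q) (snd q)))"
      using continuous_on_subset[OF c XY] by (intro continuous_intros) (simp add: case_prod_unfold)
    then show "continuous (at (x, y) within X \<times> Y) (\<lambda>(x, y). blinfun_mult_right (fy x y))"
      using mem by (simp add: continuous_on_eq_continuous_within case_prod_unfold)
  qed (auto simp: Y_def)
  then have D: "((\<lambda>(x, y). f x y) has_derivative (\<lambda>(tx, ty). fx x y * tx + fy x y * ty)) (at (x, y))"
    using mem by (simp add: at_within_open[OF _ o])
  have "((\<lambda>h. (a + h, b + h)) has_derivative (\<lambda>t. (t, t))) (at h)"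
    by (auto intro!: derivative_eq_intros)
  from has_derivative_compose[OF this, of "\<lambda>(x, y). f x y" "\<lambda>(tx, ty). fx x y * tx + fy x y * ty"] D
  have "((\<lambda>h. f (a + h) (b + h)) has_derivative (\<lambda>t. fx x y * t + fy x y * t)) (at h)"
    by (simp add: x_def y_def)
  moreover have "(\<lambda>t. fx x y * t + fy x y * t) = (*) (fx x y + fy x y)"
    by (auto simp: fun_eq_iff distrib_right)
  ultimately show ?thesis
    unfolding has_field_derivative_def x_def y_def by simp
qed

text \<open>
  A solution is only known to have the derivative \<open>\<partial>\<^sub>x (\<partial>\<^sub>y w)\<close>; the first-order system also needs
  \<open>\<partial>\<^sub>y (\<partial>\<^sub>x w)\<close>. Differentiating \<open>w x t - w x y1 = \<integral> w\<^sub>y x s ds\<close> under the integral expresses \<open>w\<^sub>x\<close> as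
  an integral of the continuous function \<open>w\<^sub>x\<^sub>y\<close>.
\<close>

lemma mixed_partial_commute:
  fixes w wx wy wxy :: "real \<Rightarrow> real \<Rightarrow> real"
  assumes wx: "\<And>x y. 0 < y \<Longrightarrow> y < x \<Longrightarrow> ((\<lambda>t. w t y) has_real_derivative wx x y) (at x)"
    and wy: "\<And>x y. 0 < y \<Longrightarrow> y < x \<Longrightarrow> ((\<lambda>t. w x t) has_real_derivative wy x y) (at y)"
    and wxy: "\<And>x y. 0 < y \<Longrightarrow> y < x \<Longrightarrow> ((\<lambda>t. wy t y) has_real_derivative wxy x y) (at x)"
    and c: "continuous_on domD (\<lambda>(x, y). wxy x y)"
    and xy: "0 < y" "y < x"
  shows "((\<lambda>t. wx x t) has_real_derivative wxy x y) (at y)"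
proof -
  define m where "m = (x + y) / 2"
  define y1 where "y1 = y / 2"
  have m: "y < m" "m < x" "y1 < y" "0 < y1" using xy by (auto simp: m_def y1_def)
  have eq: "wx x t = wx x y1 + integral {y1..t} (wxy x)" if t: "y1 \<le> t" "t \<le> m" for t
  proof -
    have I: "(wy x' has_integral w x' t - w x' y1) {y1..t}" if "x' \<in> {m<..}" for x'
    proof (rule fundamental_theorem_of_calculus)
      fix s assume "s \<in> {y1..t}"
      then have "0 < s" "s < x'" using t m that by auto
      from wy[OF this] show "(w x' has_vector_derivative wy x' s) (at s within {y1..t})"
        unfolding has_real_derivative_iff_has_vector_derivative by (rule has_vector_derivative_at_within)
    qed (use t in auto)
    have "((\<lambda>x'. integral (cbox y1 t) (wy x')) has_field_derivative integral (cbox y1 t) (wxy x))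
          (at x within {m<..})"
    proof (rule leibniz_rule_field_derivative)
      fix x' s assume "x' \<in> {m<..}" "s \<in> cbox y1 t"
      then have "0 < s" "s < x'" using t m by auto
      then show "((\<lambda>x. wy x s) has_real_derivative wxy x' s) (at x' within {m<..})"
        by (rule has_field_derivative_at_within[OF wxy])
    next
      show "wy x' integrable_on cbox y1 t" if "x' \<in> {m<..}" for x' using I[OF that] by auto
      show "continuous_on ({m<..} \<times> cbox y1 t) (\<lambda>(x, t). wxy x t)"
        by (rule continuous_on_subset[OF c]) (use t m in \<open>auto simp: domD_def\<close>)
    qed (use m in auto)
    then have "((\<lambda>x'. integral {y1..t} (wy x')) has_field_derivative integral {y1..t} (wxy x)) (at x)"
      using m by (simp add: at_within_open[of x "{m<..}"])
    then have "((\<lambda>x'. w x' t - w x' y1) has_field_derivative integral {y1..t} (wxy x)) (at x)"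
      by (rule has_field_derivative_transform_within_open[of _ _ _ "{m<..}"])
         (use m integral_unique[OF I] in simp_all)
    moreover have "((\<lambda>x'. w x' t - w x' y1) has_field_derivative wx x t - wx x y1) (at x)"
      by (intro DERIV_diff wx) (use t m in auto)
    ultimately have "integral {y1..t} (wxy x) = wx x t - wx x y1" by (rule DERIV_unique)
    then show ?thesis by simp
  qed
  have "continuous_on {y1..m} (wxy x)"
    by (rule continuous_on_binary_compose[OF c])
       (use m in \<open>auto simp: domD_def intro!: continuous_intros\<close>)
  then have "((\<lambda>t. integral {y1..t} (wxy x)) has_real_derivative wxy x y) (at y within {y1..m})"
    by (rule integral_has_real_derivative) (use m in auto)
  then have "((\<lambda>t. integral {y1..t} (wxy x)) has_real_derivative wxy x y) (at y)"
    using m at_within_Icc_at[of y1 y m] by simp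
  from DERIV_add[OF DERIV_const[of "wx x y1"] this]
  have "((\<lambda>t. wx x y1 + integral {y1..t} (wxy x)) has_real_derivative wxy x y) (at y)"
    by simp
  then show ?thesis
  proof (rule has_field_derivative_transform_within_open[of _ _ _ "{y1<..<m}"])
    show "wx x y1 + integral {y1..t} (wxy x) = wx x t" if "t \<in> {y1<..<m}" for t
      using eq[of t, symmetric] that by auto
  qed (use m in auto)
qed

lemma continuous_on_section:
  assumes "continuous_family A w" "0 < y" "y < x"
  shows "continuous_on A (\<lambda>k. w k x y)"
  using continuous_on_binary_compose[OF assms(1), of A "\<lambda>_. (x, y)" "\<lambda>k. k"] assms(2,3)
  by (simp add: domD_def)

lemma deriv_integral_param:
  fixes f fx :: "real \<Rightarrow> real \<Rightarrow> real"
  assumes "open S" "convex S" "x \<in> S"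
    and "\<And>x k. x \<in> S \<Longrightarrow> k \<in> {a..b} \<Longrightarrow> ((\<lambda>x. f x k) has_real_derivative fx x k) (at x)"
    and "\<And>x. x \<in> S \<Longrightarrow> continuous_on {a..b} (f x)"
    and "continuous_on (S \<times> {a..b}) (\<lambda>(x, k). fx x k)"
  shows "((\<lambda>x. integral {a..b} (f x)) has_real_derivative integral {a..b} (fx x)) (at x)"
proof -
  have "((\<lambda>x. integral (cbox a b) (f x)) has_field_derivative integral (cbox a b) (fx x)) (at x within S)"
    by (rule leibniz_rule_field_derivative)
      (use assms in \<open>simp_all add: has_field_derivative_at_within integrable_continuous_interval\<close>)
  then show ?thesis using at_within_open[OF \<open>x \<in> S\<close> \<open>open S\<close>] by simp
qed

lemma epd_average:
  fixes w wx wy :: "real \<Rightarrow> real \<Rightarrow> real \<Rightarrow> real"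
  assumes epd: "\<And>k. k \<in> {a..b} \<Longrightarrow> epd p lam (w k) (wx k) (wy k)"
    and c: "continuous_family {a..b} w"
    and cx: "continuous_family {a..b} wx"
    and cy: "continuous_family {a..b} wy"
  shows "epd p lam (\<lambda>x y. integral {a..b} (\<lambda>k. w k x y)) (\<lambda>x y. integral {a..b} (\<lambda>k. wx k x y))
           (\<lambda>x y. integral {a..b} (\<lambda>k. wy k x y))"
proof -
  have C: "continuous_on domD (\<lambda>(x, y). integral {a..b} (\<lambda>k. v k x y))"
    if "continuous_family {a..b} v" for v :: "real \<Rightarrow> real \<Rightarrow> real \<Rightarrow> real"
    using integral_continuous_on_param[of domD a b "\<lambda>q k. v k (fst q) (snd q)"] that
    by (simp add: case_prod_unfold)
  have X: "((\<lambda>t. integral {a..b} (\<lambda>k. u k t y)) has_real_derivative integral {a..b} (\<lambda>k. v k x y)) (at x)"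
    if u: "continuous_family {a..b} u"
     and v: "continuous_family {a..b} v"
     and d: "\<And>x y k. k \<in> {a..b} \<Longrightarrow> 0 < y \<Longrightarrow> y < x \<Longrightarrow> ((\<lambda>t. u k t y) has_real_derivative v k x y) (at x)"
     and xy: "0 < y" "y < x"
    for u v :: "real \<Rightarrow> real \<Rightarrow> real \<Rightarrow> real" and x y
  proof (rule deriv_integral_param[where S = "{y<..}"])
    have "continuous_on ({y<..} \<times> {a..b}) (\<lambda>q. (\<lambda>(q, k). v k (fst q) (snd q)) ((fst q, y), snd q))"
      by (rule continuous_on_compose2[OF v]) (use xy in \<open>auto simp: domD_def intro!: continuous_intros\<close>)
    then show "continuous_on ({y<..} \<times> {a..b}) (\<lambda>(x, k). v k x y)" by (simp add: case_prod_unfold)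
  qed (use xy d in \<open>auto intro: continuous_on_section[OF u]\<close>)
  have Y: "((\<lambda>t. integral {a..b} (\<lambda>k. u k x t)) has_real_derivative integral {a..b} (\<lambda>k. v k x y)) (at y)"
    if u: "continuous_family {a..b} u"
     and v: "continuous_family {a..b} v"
     and d: "\<And>x y k. k \<in> {a..b} \<Longrightarrow> 0 < y \<Longrightarrow> y < x \<Longrightarrow> ((\<lambda>t. u k x t) has_real_derivative v k x y) (at y)"
     and xy: "0 < y" "y < x"
    for u v :: "real \<Rightarrow> real \<Rightarrow> real \<Rightarrow> real" and x y
  proof (rule deriv_integral_param[where S = "{0<..<x}"])
    have "continuous_on ({0<..<x} \<times> {a..b}) (\<lambda>q. (\<lambda>(q, k). v k (fst q) (snd q)) ((x, fst q), snd q))"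
      by (rule continuous_on_compose2[OF v]) (use xy in \<open>auto simp: domD_def intro!: continuous_intros\<close>)
    then show "continuous_on ({0<..<x} \<times> {a..b}) (\<lambda>(y, k). v k x y)" by (simp add: case_prod_unfold)
  qed (use xy d in \<open>auto intro: continuous_on_section[OF u]\<close>)
  define R where "R = (\<lambda>k x y. p / (x - y) * (wx k x y - wy k x y) + lam * w k x y)"
  have cR: "continuous_family {a..b} R"
    using c cx cy unfolding R_def case_prod_unfold
    by (intro continuous_intros) (auto simp: domD_def)
  have IR: "integral {a..b} (\<lambda>k. R k x y) = p / (x - y) * (integral {a..b} (\<lambda>k. wx k x y)
      - integral {a..b} (\<lambda>k. wy k x y)) + lam * integral {a..b} (\<lambda>k. w k x y)"
    if "0 < y" "y < x" for x y
  proof -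
    note i = integrable_continuous_interval[OF continuous_on_section[OF c that]]
      integrable_continuous_interval[OF continuous_on_section[OF cx that]]
      integrable_continuous_interval[OF continuous_on_section[OF cy that]]
    have "((\<lambda>k. R k x y) has_integral p / (x - y) * (integral {a..b} (\<lambda>k. wx k x y)
      - integral {a..b} (\<lambda>k. wy k x y)) + lam * integral {a..b} (\<lambda>k. w k x y)) {a..b}"
      unfolding R_def by (intro has_integral_add has_integral_mult_right has_integral_diff integrable_integral i)
    then show ?thesis by (rule integral_unique)
  qed
  show ?thesis unfolding epd_def
  proof (intro conjI allI impI C c cx cy)
    fix x y :: real assume xy: "0 < y" "y < x"
    show "((\<lambda>t. integral {a..b} (\<lambda>k. w k t y)) has_real_derivative integral {a..b} (\<lambda>k. wx k x y)) (at x)"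
      by (rule X[OF c cx epdD(4)[OF epd] xy])
    show "((\<lambda>t. integral {a..b} (\<lambda>k. w k x t)) has_real_derivative integral {a..b} (\<lambda>k. wy k x y)) (at y)"
      by (rule Y[OF c cy epdD(5)[OF epd] xy])
    show "((\<lambda>t. integral {a..b} (\<lambda>k. wx k x t)) has_real_derivative p / (x - y) * (integral {a..b} (\<lambda>k. wx k x y)
      - integral {a..b} (\<lambda>k. wy k x y)) + lam * integral {a..b} (\<lambda>k. w k x y)) (at y)"
      unfolding IR[OF xy, symmetric] by (rule Y[OF cx cR _ xy]) (use epdD(6)[OF epd] in \<open>simp add: R_def\<close>)
    show "((\<lambda>t. integral {a..b} (\<lambda>k. wy k t y)) has_real_derivative p / (x - y) * (integral {a..b} (\<lambda>k. wx k x y)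
      - integral {a..b} (\<lambda>k. wy k x y)) + lam * integral {a..b} (\<lambda>k. w k x y)) (at x)"
      unfolding IR[OF xy, symmetric] by (rule X[OF cy cR _ xy]) (use epdD(7)[OF epd] in \<open>simp add: R_def\<close>)
  qed
qed

lemma epd_shift:
  assumes epd: "epd p lam w wx wy" and h: "0 \<le> h"
  shows "epd p lam (\<lambda>x y. w (x + h) (y + h)) (\<lambda>x y. wx (x + h) (y + h)) (\<lambda>x y. wy (x + h) (y + h))"
proof -
  have C: "continuous_on domD (\<lambda>(x, y). v (x + h) (y + h))"
    if "continuous_on domD (\<lambda>(x, y). v x y)" for v :: "real \<Rightarrow> real \<Rightarrow> real"
  proof -
    have "continuous_on domD (\<lambda>q. (\<lambda>(x, y). v x y) (fst q + h, snd q + h))"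
      by (rule continuous_on_compose2[OF that]) (use h in \<open>auto simp: domD_def intro!: continuous_intros\<close>)
    then show ?thesis by (simp add: case_prod_unfold)
  qed
  show ?thesis unfolding epd_def
  proof (intro conjI allI impI C epdD(1-3)[OF epd])
    fix x y :: real assume xy: "0 < y" "y < x"
    then have xy': "0 < y + h" "y + h < x + h" using h by auto
    show "((\<lambda>t. w (t + h) (y + h)) has_real_derivative wx (x + h) (y + h)) (at x)"
      using epdD(4)[OF epd xy'] DERIV_shift[of "\<lambda>t. w t (y + h)"] by blast
    show "((\<lambda>t. w (x + h) (t + h)) has_real_derivative wy (x + h) (y + h)) (at y)"
      using epdD(5)[OF epd xy'] DERIV_shift[of "\<lambda>t. w (x + h) t"] by blast
    show "((\<lambda>t. wx (x + h) (t + h)) has_real_derivative p / (x - y) * (wx (x + h) (y + h) - wy (x + h) (y + h))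
        + lam * w (x + h) (y + h)) (at y)"
      using epdD(6)[OF epd xy'] DERIV_shift[of "\<lambda>t. wx (x + h) t"] by simp
    show "((\<lambda>t. wy (t + h) (y + h)) has_real_derivative p / (x - y) * (wx (x + h) (y + h) - wy (x + h) (y + h))
        + lam * w (x + h) (y + h)) (at x)"
      using epdD(7)[OF epd xy'] DERIV_shift[of "\<lambda>t. wy t (y + h)"] by simp
  qed
qed

text \<open>
  On the far sides of the rectangle the family is bounded by compactness, so
  \<open>epd_bound_near_diagonal\<close> applies with one constant for all members. These bounds supply the
  dominating functions for every passage to the limit on the diagonal.
\<close>

lemma epd_family_bounded_near_diagonal:
  fixes w wx wy :: "real \<Rightarrow> real \<Rightarrow> real \<Rightarrow> real"
  assumes p: "0 < p" "p < 1/2" and c12: "0 < c1" "c1 \<le> c2"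
    and epd: "\<And>k. k \<in> {a..b} \<Longrightarrow> epd p lam (w k) (wx k) (wy k)"
    and c: "continuous_family {a..b} w"
    and cx: "continuous_family {a..b} wx"
    and cy: "continuous_family {a..b} wy"
  obtains M where "0 \<le> M" "\<And>k y d. k \<in> {a..b} \<Longrightarrow> y \<in> {c1..c2} \<Longrightarrow> 0 < d \<Longrightarrow> d \<le> 1 \<Longrightarrow>
      \<bar>w k (y + d) y\<bar> \<le> M \<and> \<bar>wx k (y + d) y\<bar> \<le> M * d powr (- 2 * p) \<and> \<bar>wy k (y + d) y\<bar> \<le> M * d powr (- 2 * p)"
proof -
  define y0 X where "y0 = c1 / 2" and "X = c2 + 1"
  define T where "T = {c1..X} \<times> {y0} \<union> {X} \<times> {y0..c2}"
  have T: "T \<subseteq> domD" using c12 by (auto simp: T_def y0_def X_def domD_def)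
  have cT: "compact (T \<times> {a..b})" unfolding T_def by (intro compact_Times compact_Un) auto
  have B: "\<exists>C. \<forall>q\<in>T. \<forall>k\<in>{a..b}. \<bar>v k (fst q) (snd q)\<bar> \<le> C"
    if "continuous_family {a..b} v" for v :: "real \<Rightarrow> real \<Rightarrow> real \<Rightarrow> real"
  proof -
    have "continuous_on (T \<times> {a..b}) (\<lambda>(q, k). v k (fst q) (snd q))"
      by (rule continuous_on_subset[OF that]) (use T in auto)
    from compact_imp_bounded[OF compact_continuous_image[OF this cT]]
    obtain C where "\<And>u. u \<in> (\<lambda>(q, k). v k (fst q) (snd q)) ` (T \<times> {a..b}) \<Longrightarrow> norm u \<le> C"
      unfolding bounded_iff by blast
    then show ?thesis by (intro exI[of _ C]) (force simp: image_iff)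
  qed
  obtain C1 where C1: "\<And>q k. q \<in> T \<Longrightarrow> k \<in> {a..b} \<Longrightarrow> \<bar>w k (fst q) (snd q)\<bar> \<le> C1" using B[OF c] by blast
  obtain C2 where C2: "\<And>q k. q \<in> T \<Longrightarrow> k \<in> {a..b} \<Longrightarrow> \<bar>wx k (fst q) (snd q)\<bar> \<le> C2" using B[OF cx] by blast
  obtain C3 where C3: "\<And>q k. q \<in> T \<Longrightarrow> k \<in> {a..b} \<Longrightarrow> \<bar>wy k (fst q) (snd q)\<bar> \<le> C3" using B[OF cy] by blast
  define C where "C = max 0 (max C1 (max C2 C3))"
  have C: "C \<ge> 0" "C1 \<le> C" "C2 \<le> C" "C3 \<le> C" by (auto simp: C_def)
  obtain M where M: "M \<ge> 0" "\<And>w wx wy x y. epd p lam w wx wy \<Longrightarrow>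
     (\<forall>x\<in>{c1..X}. \<bar>wx x y0\<bar> \<le> C) \<Longrightarrow> (\<forall>y\<in>{y0..c2}. \<bar>w X y\<bar> \<le> C \<and> \<bar>wy X y\<bar> \<le> C) \<Longrightarrow>
     x\<in>{c1..X} \<Longrightarrow> y\<in>{y0..c2} \<Longrightarrow> y < x \<Longrightarrow>
        \<bar>w x y\<bar> \<le> M \<and> \<bar>wx x y\<bar> \<le> M * (x - y) powr (- 2 * p) \<and> \<bar>wy x y\<bar> \<le> M * (x - y) powr (- 2 * p)"
    using epd_bound_near_diagonal[OF p, of y0 c1 c2 X C lam] c12 C(1) unfolding y0_def X_def
    by auto
  show ?thesis
  proof (rule that[OF M(1)])
    fix k y d :: real assume k: "k \<in> {a..b}" and y: "y \<in> {c1..c2}" and d: "0 < d" "d \<le> 1"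
    have "\<bar>w k (y + d) y\<bar> \<le> M \<and> \<bar>wx k (y + d) y\<bar> \<le> M * ((y + d) - y) powr (- 2 * p)
       \<and> \<bar>wy k (y + d) y\<bar> \<le> M * ((y + d) - y) powr (- 2 * p)"
    proof (rule M(2)[OF epd[OF k]])
      show "\<forall>x\<in>{c1..X}. \<bar>wx k x y0\<bar> \<le> C"
      proof
        fix x assume "x \<in> {c1..X}"
        then have "(x, y0) \<in> T" by (simp add: T_def)
        from C2[OF this k] show "\<bar>wx k x y0\<bar> \<le> C" using C by simp
      qed
      show "\<forall>y\<in>{y0..c2}. \<bar>w k X y\<bar> \<le> C \<and> \<bar>wy k X y\<bar> \<le> C"
      proof
        fix y assume "y \<in> {y0..c2}"
        then have "(X, y) \<in> T" by (simp add: T_def)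
        from C1[OF this k] C3[OF this k] show "\<bar>w k X y\<bar> \<le> C \<and> \<bar>wy k X y\<bar> \<le> C" using C by simp
      qed
    qed (use y d c12 in \<open>auto simp: y0_def X_def\<close>)
    then show "\<bar>w k (y + d) y\<bar> \<le> M \<and> \<bar>wx k (y + d) y\<bar> \<le> M * d powr (- 2 * p) \<and> \<bar>wy k (y + d) y\<bar> \<le> M * d powr (- 2 * p)"
      by simp
  qed
qed

section \<open>Passing to the limit under averages\<close>

lemma bounded_limit_integral_zero:
  fixes f :: "real \<Rightarrow> real \<Rightarrow> real"
  assumes "0 < r"
    and c: "\<And>d. 0 < d \<Longrightarrow> d < r \<Longrightarrow> f d integrable_on {a..b}"
    and bd: "\<And>d v. 0 < d \<Longrightarrow> d < r \<Longrightarrow> v \<in> {a..b} \<Longrightarrow> \<bar>f d v\<bar> \<le> M"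
    and lim: "\<And>v. v \<in> {a..b} \<Longrightarrow> ((\<lambda>d. f d v) \<longlongrightarrow> 0) (at_right 0)"
  shows "((\<lambda>d. integral {a..b} (f d)) \<longlongrightarrow> 0) (at_right 0)"
proof (rule tendsto_at_right_sequentially[OF \<open>0 < r\<close>])
  fix S :: "nat \<Rightarrow> real" assume S: "\<And>n. 0 < S n" "\<And>n. S n < r" "S \<longlonglongrightarrow> 0"
  have "filterlim S (at_right 0) sequentially"
    unfolding filterlim_at using S(1) less_imp_neq[OF S(1)] S(3) by (auto intro!: always_eventually)
  then have "(\<lambda>n. f (S n) v) \<longlonglongrightarrow> 0" if "v \<in> {a..b}" for v
    using filterlim_compose[OF lim[OF that]] by blast
  then have "(\<lambda>n. integral {a..b} (f (S n))) \<longlonglongrightarrow> integral {a..b} (\<lambda>_. 0 :: real)"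
    using S c bd by (intro dominated_convergence(2)[where h = "\<lambda>_. M"]) auto
  then show "(\<lambda>n. integral {a..b} (f (S n))) \<longlonglongrightarrow> 0" by simp
qed

text \<open>
  The boundary conditions of the problem fix \<open>(x, y)\<close> and let \<open>z\<close> tend to \<open>x - y\<close>, so the limit moves
  from slice to slice. After integration over the slice parameter this does not matter: replacing
  \<open>f d v\<close> by \<open>f d (v - d)\<close> shifts the interval of integration by \<open>d\<close>, and the two end pieces
  contribute at most \<open>2 * M * d\<close>.
\<close>

lemma bounded_oblique_limit_integral_zero:
  fixes f :: "real \<Rightarrow> real \<Rightarrow> real"
  assumes "a \<le> b" "0 < r"
    and c: "\<And>d. 0 < d \<Longrightarrow> d < r \<Longrightarrow> continuous_on {a - r..b} (f d)"
    and bd: "\<And>d v. 0 < d \<Longrightarrow> d < r \<Longrightarrow> v \<in> {a - r..b} \<Longrightarrow> \<bar>f d v\<bar> \<le> M"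
    and lim: "\<And>v. v \<in> {a..b} \<Longrightarrow> ((\<lambda>d. f d (v - d)) \<longlongrightarrow> 0) (at_right 0)"
  shows "((\<lambda>d. integral {a..b} (f d)) \<longlongrightarrow> 0) (at_right 0)"
proof -
  have ev: "eventually (\<lambda>d. 0 < d \<and> d < r) (at_right (0::real))"
    using \<open>0 < r\<close> by (auto simp: eventually_at_right_field)
  have sh: "integral {a..b} (\<lambda>v. f d (v - d)) = integral {a - d..b - d} (f d)" if d: "0 < d" "d < r" for d
    using integral_shift[of a "- d" b "f d"] continuous_on_subset[OF c[OF d], of "{a - d..b - d}"] d
    by (simp add: o_def)
  have 1: "((\<lambda>d. integral {a..b} (\<lambda>v. f d (v - d))) \<longlongrightarrow> 0) (at_right 0)"
  proof (rule bounded_limit_integral_zero[OF \<open>0 < r\<close>, where M = M])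
    fix d :: real assume d: "0 < d" "d < r"
    have "continuous_on {a..b} (\<lambda>v. f d (v - d))"
      by (rule continuous_on_compose2[OF c[OF d]]) (use d in \<open>auto intro!: continuous_intros\<close>)
    then show "(\<lambda>v. f d (v - d)) integrable_on {a..b}" by (rule integrable_continuous_interval)
  qed (use lim bd in auto)
  have 2: "\<bar>integral {a..b} (f d) - integral {a - d..b - d} (f d)\<bar> \<le> 2 * M * d" if d: "0 < d" "d < r" for d
  proof -
    have I: "f d integrable_on {s..t}" if "a - r \<le> s" "t \<le> b" for s t
      by (rule integrable_continuous_interval[OF continuous_on_subset[OF c[OF d]]]) (use that in auto)
    have "integral {a - d..a} (f d) + integral {a..b} (f d) = integral {a - d..b} (f d)"
      using d assms(1) by (intro Henstock_Kurzweil_Integration.integral_combine I) auto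
    moreover have "integral {a - d..b - d} (f d) + integral {b - d..b} (f d) = integral {a - d..b} (f d)"
      using d assms(1) by (intro Henstock_Kurzweil_Integration.integral_combine I) auto
    moreover have "norm (integral {a - d..a} (f d)) \<le> M * (a - (a - d))"
      by (rule integral_bound) (use d assms(1) in \<open>auto intro!: continuous_on_subset[OF c[OF d]] bd\<close>)
    moreover have "norm (integral {b - d..b} (f d)) \<le> M * (b - (b - d))"
      by (rule integral_bound) (use d assms(1) in \<open>auto intro!: continuous_on_subset[OF c[OF d]] bd\<close>)
    ultimately show ?thesis by (auto simp: algebra_simps abs_if split: if_splits)
  qed
  have "((\<lambda>d. 2 * M * d) \<longlongrightarrow> 2 * M * 0) (at_right 0)" by (intro tendsto_intros)
  then have "((\<lambda>d. 2 * M * d) \<longlongrightarrow> 0) (at_right 0)" by simp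
  then have "((\<lambda>d. integral {a..b} (f d) - integral {a - d..b - d} (f d)) \<longlongrightarrow> 0) (at_right 0)"
    by (rule Lim_null_comparison[rotated]) (rule eventually_mono[OF ev], use 2 in simp)
  moreover have "((\<lambda>d. integral {a - d..b - d} (f d)) \<longlongrightarrow> 0) (at_right 0)"
    by (rule Lim_transform_eventually[OF 1]) (rule eventually_mono[OF ev], use sh in simp)
  ultimately have "((\<lambda>d. (integral {a..b} (f d) - integral {a - d..b - d} (f d)) + integral {a - d..b - d} (f d)) \<longlongrightarrow> 0 + 0) (at_right 0)"
    by (rule tendsto_add)
  then show ?thesis by simp
qed

lemma zero_if_initial_integrals_zero:
  fixes f :: "real \<Rightarrow> real"
  assumes "a < c" and f: "continuous_on {a..c} f"
    and z: "\<And>b. a < b \<Longrightarrow> b \<le> c \<Longrightarrow> integral {a..b} f = 0"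
  shows "f a = 0"
proof -
  have "((\<lambda>x. integral {a..x} f) has_vector_derivative f a) (at a within {a..c})"
    by (rule integral_has_vector_derivative[OF f]) (use assms in auto)
  moreover have "((\<lambda>x. integral {a..x} f) has_vector_derivative 0) (at a within {a..c})"
  proof (rule has_vector_derivative_transform[of _ _ _ "\<lambda>_. 0"])
    fix x assume "x \<in> {a..c}"
    then show "integral {a..x} f = 0" using z[of x] by (cases "x = a") auto
  qed (use assms in auto)
  ultimately show ?thesis
    using vector_derivative_unique_within_closed_interval[of a c a] assms by auto
qed

section \<open>Uniqueness in the plane\<close>

text \<open>
  Averaging along the diagonal direction turns the tangential derivative \<open>w\<^sub>x + w\<^sub>y\<close> into a difference
  of values of \<open>w\<close>, which tends to zero on the diagonal although the derivative itself need not.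
\<close>

lemma epd_averaged_tangential_derivative:
  assumes epd: "epd p lam w wx wy" and b: "0 \<le> b" and xy: "0 < y" "y < x"
  shows "integral {0..b} (\<lambda>h. wx (x + h) (y + h)) + integral {0..b} (\<lambda>h. wy (x + h) (y + h))
    = w (x + b) (y + b) - w x y"
proof -
  have c: "continuous_on {0..b} (\<lambda>h. v (x + h) (y + h))"
    if "continuous_on domD (\<lambda>(x, y). v x y)" for v :: "real \<Rightarrow> real \<Rightarrow> real"
    by (rule continuous_on_binary_compose[OF that])
       (use xy in \<open>auto simp: domD_def intro!: continuous_intros\<close>)
  have "((\<lambda>h. wx (x + h) (y + h) + wy (x + h) (y + h)) has_integral w (x + b) (y + b) - w (x + 0) (y + 0)) {0..b}"
  proof (rule fundamental_theorem_of_calculus[OF b])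
    fix h assume "h \<in> {0..b}"
    then show "((\<lambda>h. w (x + h) (y + h)) has_vector_derivative wx (x + h) (y + h) + wy (x + h) (y + h)) (at h within {0..b})"
      using deriv_along_diagonal[OF epdD(4,5)[OF epd] epdD(3)[OF epd], of y h x] xy
      by (simp add: has_real_derivative_iff_has_vector_derivative has_vector_derivative_at_within)
  qed
  moreover have "((\<lambda>h. wx (x + h) (y + h) + wy (x + h) (y + h)) has_integral
     integral {0..b} (\<lambda>h. wx (x + h) (y + h)) + integral {0..b} (\<lambda>h. wy (x + h) (y + h))) {0..b}"
    by (intro has_integral_add integrable_integral integrable_continuous_interval c epdD(2,3)[OF epd])
  ultimately show ?thesis by (simp add: has_integral_unique)
qed

lemma deriv_bound_at_right_zero:
  fixes G H :: "real \<Rightarrow> real"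
  assumes "0 < d"
    and G: "\<And>t. 0 < t \<Longrightarrow> t \<le> d \<Longrightarrow> (G has_real_derivative G' t) (at t)"
    and H: "\<And>t. 0 < t \<Longrightarrow> t \<le> d \<Longrightarrow> (H has_real_derivative H' t) (at t)"
    and le: "\<And>t. 0 < t \<Longrightarrow> t \<le> d \<Longrightarrow> \<bar>G' t\<bar> \<le> H' t"
    and G0: "(G \<longlongrightarrow> 0) (at_right 0)" and H0: "\<And>t. 0 < t \<Longrightarrow> 0 \<le> H t"
  shows "\<bar>G d\<bar> \<le> H d"
proof -
  have ev: "eventually (\<lambda>s. \<bar>G d - G s\<bar> \<le> H d) (at_right 0)"
  proof -
    have "eventually (\<lambda>s. 0 < s \<and> s < d) (at_right (0::real))"
      using \<open>0 < d\<close> by (auto simp: eventually_at_right_field)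
    then show ?thesis
    proof (rule eventually_mono)
      fix s assume s: "0 < s \<and> s < d"
      have "\<bar>G d - G s\<bar> \<le> H d - H s"
        by (rule abs_diff_le_of_deriv_bound[OF _ G H le]) (use s in auto)
      then show "\<bar>G d - G s\<bar> \<le> H d" using H0[of s] s by linarith
    qed
  qed
  have "((\<lambda>s. \<bar>G d - G s\<bar>) \<longlongrightarrow> \<bar>G d - 0\<bar>) (at_right 0)"
    by (intro tendsto_rabs tendsto_diff tendsto_const G0)
  from tendsto_upperbound[OF this ev] show ?thesis by simp
qed

text \<open>
  Uniqueness for the singular Cauchy problem in the plane, with data attained only pointwise. The
  bounds near the diagonal give \<open>\<bar>w\<bar> \<le> M / a * d powr a\<close> with \<open>a = 1 - 2 * p\<close>. Let \<open>v\<close> be the average of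
  \<open>w\<close> over the translations by \<open>(h, h)\<close>, \<open>0 \<le> h \<le> b\<close>. Then \<open>v\<close> and \<open>v\<^sub>x + v\<^sub>y\<close> are \<open>O(d powr a)\<close>. The
  product \<open>d powr (2 * p) * v\<^sub>y\<close> tends to zero by dominated convergence, and its derivative is bounded
  because only \<open>v\<^sub>x + v\<^sub>y\<close> and \<open>v\<close> occur in it; hence \<open>v\<^sub>y\<close>, and with it \<open>v\<^sub>x\<close>, is \<open>O(d powr a)\<close> too. The
  maximum principle forces \<open>v = 0\<close>, for every \<open>b > 0\<close>, and so \<open>w = 0\<close>.
\<close>

lemma epd_zero_data_unique:
  assumes epd: "epd p lam w wx wy" and p: "0 < p" "p < 1/2"
    and lim: "\<And>c. 0 < c \<Longrightarrow> ((\<lambda>d. w (c + d) c) \<longlongrightarrow> 0) (at_right 0)"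
    and limN: "\<And>c. 0 < c \<Longrightarrow>
       ((\<lambda>d. d powr (2 * p) * (wx (c + d) c - wy (c + d) c)) \<longlongrightarrow> 0) (at_right 0)"
    and xy: "0 < y0" "y0 < x0"
  shows "w x0 y0 = 0"
proof -
  define a where "a = 1 - 2 * p"
  have a: "0 < a" "a < 1" using p by (auto simp: a_def)
  have cF: "continuous_on (domD \<times> {0..B}) (\<lambda>(q, h). v (fst q + h) (snd q + h))"
    if "continuous_on domD (\<lambda>(x, y). v x y)" for v :: "real \<Rightarrow> real \<Rightarrow> real" and B
  proof -
    have "continuous_on (domD \<times> {0..B}) (\<lambda>u. (\<lambda>(x, y). v x y) (fst (fst u) + snd u, snd (fst u) + snd u))"
      by (rule continuous_on_compose2[OF that]) (auto simp: domD_def intro!: continuous_intros)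
    then show ?thesis by (simp add: case_prod_unfold)
  qed
  have zero: "integral {0..b} (\<lambda>h. w (x0 + h) (y0 + h)) = 0" if b: "0 < b" for b
  proof -
    define c2 where "c2 = x0 + b"
    \<comment> \<open>a single function is a family over the one-point interval \<open>{0..0}\<close>\<close>
    note fam = epd_family_bounded_near_diagonal[of p y0 c2 0 0 lam "\<lambda>_. w" "\<lambda>_. wx" "\<lambda>_. wy"]
    have cF0: "continuous_on (domD \<times> {0..0::real}) (\<lambda>(q, k). v (fst q) (snd q))"
      if "continuous_on domD (\<lambda>(x, y). v x y)" for v :: "real \<Rightarrow> real \<Rightarrow> real"
    proof -
      have "continuous_on (domD \<times> {0..0}) (\<lambda>u :: (real \<times> real) \<times> real. (\<lambda>(x, y). v x y) (fst u))"
        by (rule continuous_on_compose2[OF that]) (auto intro!: continuous_intros)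
      then show ?thesis by (simp add: case_prod_unfold)
    qed
    have le: "y0 \<le> c2" using xy b by (simp add: c2_def)
    obtain M where M: "0 \<le> M" and MM: "\<And>k y d. k \<in> {0..0::real} \<Longrightarrow> y \<in> {y0..c2} \<Longrightarrow> 0 < d \<Longrightarrow> d \<le> 1 \<Longrightarrow>
      \<bar>w (y + d) y\<bar> \<le> M \<and> \<bar>wx (y + d) y\<bar> \<le> M * d powr (- 2 * p) \<and> \<bar>wy (y + d) y\<bar> \<le> M * d powr (- 2 * p)"
      by (rule fam[OF p xy(1) le epd cF0[OF epdD(1)[OF epd]] cF0[OF epdD(2)[OF epd]] cF0[OF epdD(3)[OF epd]]])
        (rule that; blast)
    have M1: "\<bar>wx (y + d) y\<bar> \<le> M * d powr (- 2 * p)" and M2: "\<bar>wy (y + d) y\<bar> \<le> M * d powr (- 2 * p)"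
      if "y \<in> {y0..c2}" "0 < d" "d \<le> 1" for y d
      using MM[of 0, OF _ that] by auto
    have w: "\<bar>w (y + d) y\<bar> \<le> M / a * d powr a" if y: "y \<in> {y0..c2}" and d: "0 < d" "d \<le> 1" for y d
    proof (rule deriv_bound_at_right_zero[where G = "\<lambda>d. w (y + d) y" and H = "\<lambda>d. M / a * d powr a"
            and G' = "\<lambda>t. wx (y + t) y" and H' = "\<lambda>t. M * t powr (- 2 * p)"])
      fix t assume t: "0 < t" "t \<le> d"
      show "((\<lambda>d. w (y + d) y) has_real_derivative wx (y + t) y) (at t)"
        using epdD(4)[OF epd, of y "y + t"] DERIV_shift[of "\<lambda>x. w x y" _ t y] t y xy
        by (simp add: add.commute)
      show "((\<lambda>d. M / a * d powr a) has_real_derivative M * t powr (- 2 * p)) (at t)"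
        using t a by (auto intro!: derivative_eq_intros simp: a_def)
      show "\<bar>wx (y + t) y\<bar> \<le> M * t powr (- 2 * p)" using M1[OF y] t d by auto
    next
      show "((\<lambda>d. w (y + d) y) \<longlongrightarrow> 0) (at_right 0)" by (rule lim) (use y xy in auto)
    qed (use d M a in auto)
    define v vx vy where "v = (\<lambda>x y. integral {0..b} (\<lambda>h. w (x + h) (y + h)))"
      and "vx = (\<lambda>x y. integral {0..b} (\<lambda>h. wx (x + h) (y + h)))"
      and "vy = (\<lambda>x y. integral {0..b} (\<lambda>h. wy (x + h) (y + h)))"
    have epdv: "epd p lam v vx vy"
      unfolding v_def vx_def vy_def
      by (rule epd_average[OF epd_shift[OF epd]]) (auto intro: cF epdD(1-3)[OF epd])
    have P: "vx x y + vy x y = w (x + b) (y + b) - w x y" if "0 < y" "y < x" for x y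
      unfolding vx_def vy_def using epd_averaged_tangential_derivative[OF epd _ that] b by simp
    define M' where "M' = M / a"
    have M': "M' \<ge> 0" using M a by (simp add: M'_def)
    have cs: "continuous_on {0..b} (\<lambda>h. u (x + h) (y + h))"
      if "continuous_on domD (\<lambda>(x, y). u x y)" "0 < y" "y < x" for u :: "real \<Rightarrow> real \<Rightarrow> real" and x y
      using continuous_on_section[OF cF[OF that(1)], of y x] that by auto
    have vb: "\<bar>v (y + d) y\<bar> \<le> b * M' * d powr a" if y: "y0 \<le> y" "y \<le> x0" and d: "0 < d" "d \<le> 1" for y d
    proof -
      have "norm (v (y + d) y) \<le> (M' * d powr a) * (b - 0)"
        unfolding v_def
      proof (rule integral_bound)
        show "continuous_on {0..b} (\<lambda>h. w (y + d + h) (y + h))"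
          by (rule cs[OF epdD(1)[OF epd]]) (use y d xy in auto)
        fix h assume "h \<in> {0..b}"
        then show "norm (w (y + d + h) (y + h)) \<le> M' * d powr a"
          using w[of "y + h" d] y d by (simp add: c2_def M'_def add_ac)
      qed (use b in auto)
      then show ?thesis by (simp add: mult_ac)
    qed
    have Pb: "\<bar>vx (y + d) y + vy (y + d) y\<bar> \<le> 2 * M' * d powr a"
      if y: "y0 \<le> y" "y \<le> x0" and d: "0 < d" "d \<le> 1" for y d
      using P[of y "y + d"] w[of "y + b" d] w[of y d] y d xy b
      by (simp add: c2_def M'_def add_ac)
    define C where "C = p * (2 * M') + \<bar>lam\<bar> * (b * M')"
    have C0: "C \<ge> 0" using M' b p by (simp add: C_def)
    have vyb: "\<bar>vy (y + d) y\<bar> \<le> C * d powr a"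
      if y: "y0 \<le> y" "y \<le> x0" and d: "0 < d" "d \<le> 1" for y d
    proof -
      define Q where "Q = (\<lambda>t. t powr (2 * p) * vy (y + t) y)"
      have ypos: "0 < y" using y xy by simp
      have "\<bar>Q d\<bar> \<le> C * d"
      proof (rule deriv_bound_at_right_zero[where G = Q and H = "(*) C" and d = d and H' = "\<lambda>_. C" and
            G' = "\<lambda>t. t powr (2 * p) * (p / t * (vx (y + t) y + vy (y + t) y) + lam * v (y + t) y)"])
        fix t assume t: "0 < t" "t \<le> d"
        have "((\<lambda>t. vy (y + t) y) has_real_derivative p / t * (vx (y + t) y - vy (y + t) y) + lam * v (y + t) y) (at t)"
          using epdD(7)[OF epdv, of y "y + t"] DERIV_shift[of "\<lambda>x. vy x y" _ t y] t ypos
          by (simp add: add.commute)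
        moreover have "((\<lambda>t. t powr (2 * p)) has_real_derivative 2 * p * t powr (2 * p - 1)) (at t)"
          using t by (auto intro!: derivative_eq_intros)
        ultimately have "(Q has_real_derivative 2 * p * t powr (2 * p - 1) * vy (y + t) y +
            (p / t * (vx (y + t) y - vy (y + t) y) + lam * v (y + t) y) * t powr (2 * p)) (at t)"
          unfolding Q_def by (intro DERIV_mult)
        moreover have "2 * p * t powr (2 * p - 1) * vy (y + t) y +
            (p / t * (vx (y + t) y - vy (y + t) y) + lam * v (y + t) y) * t powr (2 * p)
          = t powr (2 * p) * (p / t * (vx (y + t) y + vy (y + t) y) + lam * v (y + t) y)"
          using t by (simp add: powr_diff field_simps)
        ultimately show "(Q has_real_derivative
            t powr (2 * p) * (p / t * (vx (y + t) y + vy (y + t) y) + lam * v (y + t) y)) (at t)" by simp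
        have "t powr (2 * p) * \<bar>p / t * (vx (y + t) y + vy (y + t) y) + lam * v (y + t) y\<bar>
          \<le> t powr (2 * p) * (p / t * (2 * M' * t powr a) + \<bar>lam\<bar> * (b * M' * t powr a))"
        proof (intro mult_left_mono)
          have "\<bar>p / t * (vx (y + t) y + vy (y + t) y) + lam * v (y + t) y\<bar>
            \<le> p / t * \<bar>vx (y + t) y + vy (y + t) y\<bar> + \<bar>lam\<bar> * \<bar>v (y + t) y\<bar>"
            by (rule order_trans[OF abs_triangle_ineq]) (use p t in \<open>simp add: abs_mult\<close>)
          also have "\<dots> \<le> p / t * (2 * M' * t powr a) + \<bar>lam\<bar> * (b * M' * t powr a)"
            using p t d by (intro add_mono mult_left_mono Pb vb y) auto
          finally show "\<bar>p / t * (vx (y + t) y + vy (y + t) y) + lam * v (y + t) y\<bar>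
            \<le> p / t * (2 * M' * t powr a) + \<bar>lam\<bar> * (b * M' * t powr a)" .
        qed auto
        also have "\<dots> = (t powr (2 * p) * t powr a) * (p * (2 * M') / t + \<bar>lam\<bar> * (b * M'))"
          using t by (simp add: field_simps)
        also have "t powr (2 * p) * t powr a = t" using t by (simp add: a_def powr_add[symmetric])
        also have "t * (p * (2 * M') / t + \<bar>lam\<bar> * (b * M')) = p * (2 * M') + t * (\<bar>lam\<bar> * (b * M'))"
          using t by (simp add: distrib_left)
        also have "\<dots> \<le> C" unfolding C_def
          using mult_right_mono[of t 1 "\<bar>lam\<bar> * (b * M')"] t d M' b by simp
        finally show "\<bar>t powr (2 * p) * (p / t * (vx (y + t) y + vy (y + t) y) + lam * v (y + t) y)\<bar> \<le> C"
          by (simp add: abs_mult)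
      next
        fix t show "((*) C has_real_derivative C) (at t)" by (auto intro!: derivative_eq_intros)
      next
        define N where "N = (\<lambda>t h. t powr (2 * p) * (wx (y + h + t) (y + h) - wy (y + h + t) (y + h)))"
        have e01: "eventually (\<lambda>t. 0 < t \<and> t < 1) (at_right (0::real))"
          by (auto simp: eventually_at_right_field intro: exI[of _ 1])
        \<comment> \<open>\<open>2 * t powr (2 * p) * v\<^sub>y\<close> is the difference of the weighted \<open>v\<^sub>x + v\<^sub>y\<close> and the weighted \<open>v\<^sub>x - v\<^sub>y\<close>; the latter is the average of \<open>N\<close>.\<close>
        have "((\<lambda>t. integral {0..b} (N t)) \<longlongrightarrow> 0) (at_right 0)"
        proof (rule bounded_limit_integral_zero[of 1, where M = "2 * M"])
          fix t :: real assume t: "0 < t" "t < 1"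
          show "N t integrable_on {0..b}" unfolding N_def
            using cs[OF epdD(2)[OF epd], of y "y + t"] cs[OF epdD(3)[OF epd], of y "y + t"] t ypos
            by (intro integrable_continuous_interval continuous_intros) (simp_all add: add_ac)
          fix h assume h: "h \<in> {0..b}"
          have yh: "y + h \<in> {y0..c2}" using h y by (auto simp: c2_def)
          have "\<bar>wx (y + h + t) (y + h) - wy (y + h + t) (y + h)\<bar> \<le> 2 * M * t powr (- 2 * p)"
            using M1[OF yh, of t] M2[OF yh, of t] t by simp
          then have "t powr (2 * p) * \<bar>wx (y + h + t) (y + h) - wy (y + h + t) (y + h)\<bar>
             \<le> t powr (2 * p) * (2 * M * t powr (- 2 * p))" by (intro mult_left_mono) auto
          also have "\<dots> = 2 * M" using t by (simp add: powr_minus)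
          finally show "\<bar>N t h\<bar> \<le> 2 * M" by (simp add: N_def abs_mult)
        next
          fix h assume "h \<in> {0..b}"
          then show "((\<lambda>t. N t h) \<longlongrightarrow> 0) (at_right 0)"
            unfolding N_def by (intro limN) (use ypos in auto)
        qed simp
        moreover have "((\<lambda>t. t powr (2 * p) * (vx (y + t) y + vy (y + t) y)) \<longlongrightarrow> 0) (at_right 0)"
        proof (rule Lim_null_comparison)
          show "\<forall>\<^sub>F t in at_right 0. norm (t powr (2 * p) * (vx (y + t) y + vy (y + t) y)) \<le> 2 * M' * t"
          proof (rule eventually_mono[OF e01])
            fix t :: real assume t: "0 < t \<and> t < 1"
            have "t powr (2 * p) * \<bar>vx (y + t) y + vy (y + t) y\<bar> \<le> t powr (2 * p) * (2 * M' * t powr a)"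
              using t by (intro mult_left_mono Pb y) auto
            also have "\<dots> = 2 * M' * (t powr (2 * p) * t powr a)" by simp
            also have "t powr (2 * p) * t powr a = t" using t by (simp add: a_def powr_add[symmetric])
            finally show "norm (t powr (2 * p) * (vx (y + t) y + vy (y + t) y)) \<le> 2 * M' * t"
              by (simp add: abs_mult)
          qed
          have "((\<lambda>t. 2 * M' * t) \<longlongrightarrow> 2 * M' * 0) (at_right 0)" by (intro tendsto_intros)
          then show "((\<lambda>t. 2 * M' * t) \<longlongrightarrow> 0) (at_right 0)" by simp
        qed
        ultimately have "((\<lambda>t. (t powr (2 * p) * (vx (y + t) y + vy (y + t) y) - integral {0..b} (N t)) / 2)
            \<longlongrightarrow> (0 - 0) / 2) (at_right 0)" by (intro tendsto_divide tendsto_diff tendsto_const) auto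
        then have "((\<lambda>t. (t powr (2 * p) * (vx (y + t) y + vy (y + t) y) - integral {0..b} (N t)) / 2)
            \<longlongrightarrow> 0) (at_right 0)" by simp
        then show "(Q \<longlongrightarrow> 0) (at_right 0)"
        proof (rule Lim_transform_eventually)
          show "\<forall>\<^sub>F t in at_right 0. (t powr (2 * p) * (vx (y + t) y + vy (y + t) y) - integral {0..b} (N t)) / 2 = Q t"
          proof (rule eventually_mono[OF e01])
            fix t :: real assume t: "0 < t \<and> t < 1"
            have "integral {0..b} (N t) = t powr (2 * p) * (vx (y + t) y - vy (y + t) y)"
              unfolding N_def vx_def vy_def
              using cs[OF epdD(2)[OF epd], of y "y + t"] cs[OF epdD(3)[OF epd], of y "y + t"] t ypos
              by (simp add: integral_diff integrable_continuous_interval add_ac)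
            then show "(t powr (2 * p) * (vx (y + t) y + vy (y + t) y) - integral {0..b} (N t)) / 2 = Q t"
              by (simp add: Q_def algebra_simps)
          qed
        qed
      qed (use d C0 in auto)
      then have "d powr (2 * p) * \<bar>vy (y + d) y\<bar> \<le> C * d" by (simp add: Q_def abs_mult)
      also have "\<dots> = d powr (2 * p) * (C * d powr a)"
      proof -
        have "d powr (2 * p) * d powr a = d" using d by (simp add: a_def powr_add[symmetric])
        then show ?thesis by (metis mult.left_commute)
      qed
      finally show ?thesis using d by simp
    qed
    define E where "E = exp ((1 + \<bar>lam\<bar>) * (x0 - y0))"
    define C' where "C' = b * M' + 2 * M' + C"
    have fin: "\<bar>v x0 y0\<bar> \<le> C' * d powr a * E" if d: "0 < d" "d \<le> 1" "y0 + d \<le> x0" for d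
      unfolding E_def
    proof (rule epd_max_principle[OF epdv p(1) d(1) xy(1) d(3)])
      fix y assume y: "y0 \<le> y" "y + d \<le> x0"
      then have y': "y0 \<le> y" "y \<le> x0" using d by auto
      have n: "0 \<le> b * M' * d powr a" "0 \<le> M' * d powr a" "0 \<le> C * d powr a"
        using M' C0 b by auto
      have "C' * d powr a = b * M' * d powr a + 2 * M' * d powr a + C * d powr a"
        by (simp add: C'_def algebra_simps)
      then show "\<bar>v (y + d) y\<bar> \<le> C' * d powr a \<and> \<bar>vx (y + d) y\<bar> \<le> C' * d powr a \<and> \<bar>vy (y + d) y\<bar> \<le> C' * d powr a"
        using vb[OF y' d(1,2)] Pb[OF y' d(1,2)] vyb[OF y' d(1,2)] n by linarith
    qed
    have "((\<lambda>d. C' * d powr a * E) \<longlongrightarrow> C' * 0 powr a * E) (at_right 0)"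
      by (intro tendsto_intros tendsto_powr') (use a in \<open>auto simp: eventually_at_right_field intro: exI[of _ 1]\<close>)
    moreover have "eventually (\<lambda>d. \<bar>v x0 y0\<bar> \<le> C' * d powr a * E) (at_right 0)"
      unfolding eventually_at_right_field using fin xy by (intro exI[of _ "min 1 (x0 - y0)"]) auto
    ultimately have "\<bar>v x0 y0\<bar> \<le> C' * 0 powr a * E" by (intro tendsto_lowerbound) auto
    then show ?thesis by (simp add: v_def)
  qed
  have "w (x0 + 0) (y0 + 0) = 0"
  proof (rule zero_if_initial_integrals_zero[of 0 1 "\<lambda>h. w (x0 + h) (y0 + h)"])
    show "continuous_on {0..1} (\<lambda>h. w (x0 + h) (y0 + h))"
      using continuous_on_section[OF cF[OF epdD(1)[OF epd]]] xy by simp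
  qed (use zero in auto)
  then show ?thesis by simp
qed

section \<open>Uniqueness for Problem C\<close>

lemma slice_continuous:
  assumes "continuous3_on domH W" "0 < a"
  shows "continuous_on (domD \<times> {a..b}) (\<lambda>(q, k). W (fst q + k) (snd q) k)"
proof -
  have "continuous_on (domD \<times> {a..b}) (\<lambda>u. (\<lambda>(x, y, z). W x y z) (fst (fst u) + snd u, snd (fst u), snd u))"
    by (rule continuous_on_compose2[OF assms(1)])
       (use assms(2) in \<open>auto simp: domD_def domH_def intro!: continuous_intros\<close>)
  then show ?thesis by (simp add: case_prod_unfold)
qed

text \<open>
  Classical regularity and the equation, stated for \<open>W = U\<^sub>z\<close> alone; by linearity, differences of
  solutions satisfy the same conditions. The variable \<open>z\<close> enters only as a parameter, and \<open>x - z\<close>, \<open>y\<close>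
  are the variables of an Euler-Poisson-Darboux equation.
\<close>

locale classical_z_derivative =
  fixes p lam :: real and W Wx Wy Wxy :: "real \<Rightarrow> real \<Rightarrow> real \<Rightarrow> real"
  assumes c: "continuous3_on domH W"
    and cx: "continuous3_on domH Wx"
    and cy: "continuous3_on domH Wy"
    and cxy: "continuous3_on domH Wxy"
    and dx: "\<And>x y z. (x, y, z) \<in> domH \<Longrightarrow> ((\<lambda>t. W t y z) has_real_derivative Wx x y z) (at x)"
    and dy: "\<And>x y z. (x, y, z) \<in> domH \<Longrightarrow> ((\<lambda>t. W x t z) has_real_derivative Wy x y z) (at y)"
    and dxy: "\<And>x y z. (x, y, z) \<in> domH \<Longrightarrow> ((\<lambda>t. Wy t y z) has_real_derivative Wxy x y z) (at x)"
    and pde: "\<And>x y z. (x, y, z) \<in> domH \<Longrightarrow>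
       Wxy x y z = p / (x - y - z) * (Wx x y z - Wy x y z) + lam * W x y z"

lemma (in classical_z_derivative) slice_epd:
  assumes k: "0 < k"
  shows "epd p lam (\<lambda>x y. W (x + k) y k) (\<lambda>x y. Wx (x + k) y k) (\<lambda>x y. Wy (x + k) y k)"
proof -
  have H: "(x + k, y, k) \<in> domH" if "0 < y" "y < x" for x y
    using that k by (auto simp: domH_def)
  have C: "continuous_on domD (\<lambda>(x, y). V (x + k) y k)"
    if "continuous3_on domH V" for V :: "real \<Rightarrow> real \<Rightarrow> real \<Rightarrow> real"
  proof -
    have "continuous_on domD (\<lambda>q. (\<lambda>(x, y, z). V x y z) (fst q + k, snd q, k))"
      by (rule continuous_on_compose2[OF that]) (use k in \<open>auto simp: domD_def domH_def intro!: continuous_intros\<close>)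
    then show ?thesis by (simp add: case_prod_unfold)
  qed
  have 1: "((\<lambda>t. W (t + k) y k) has_real_derivative Wx (x + k) y k) (at x)" if "0 < y" "y < x" for x y
    using dx[OF H[OF that]] DERIV_shift[of "\<lambda>x. W x y k"] by blast
  have 2: "((\<lambda>t. W (x + k) t k) has_real_derivative Wy (x + k) y k) (at y)" if "0 < y" "y < x" for x y
    using dy[OF H[OF that]] .
  have 3: "((\<lambda>t. Wy (t + k) y k) has_real_derivative Wxy (x + k) y k) (at x)" if "0 < y" "y < x" for x y
    using dxy[OF H[OF that]] DERIV_shift[of "\<lambda>x. Wy x y k"] by blast
  have 4: "((\<lambda>t. Wx (x + k) t k) has_real_derivative Wxy (x + k) y k) (at y)" if "0 < y" "y < x" for x y
    using mixed_partial_commute[of "\<lambda>x y. W (x + k) y k" "\<lambda>x y. Wx (x + k) y k" "\<lambda>x y. Wy (x + k) y k"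
        "\<lambda>x y. Wxy (x + k) y k", OF 1 2 3 C[OF cxy] that] .
  have 5: "Wxy (x + k) y k = p / (x - y) * (Wx (x + k) y k - Wy (x + k) y k) + lam * W (x + k) y k"
    if "0 < y" "y < x" for x y
    using pde[OF H[OF that]] by simp
  show ?thesis unfolding epd_def
    using 1 2 3 4 5 by (intro conjI allI impI C c cx cy) metis+
qed

text \<open>
  The average of the slices over \<open>a \<le> z \<le> b\<close> solves the plane equation and, by
  \<open>bounded_oblique_limit_integral_zero\<close>, has zero limits on the diagonal. Hence all these averages
  vanish, and so does \<open>W\<close>, which is continuous in \<open>z\<close>.
\<close>

lemma (in classical_z_derivative) zero_boundary_limits_unique:
  assumes p: "0 < p" "p < 1/2"
    and lim: "\<And>x y. 0 < y \<Longrightarrow> y < x \<Longrightarrow> ((\<lambda>z. W x y z) \<longlongrightarrow> 0) (at_left (x - y))"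
    and limN: "\<And>x y. 0 < y \<Longrightarrow> y < x \<Longrightarrow>
       ((\<lambda>z. (x - y - z) powr (2 * p) * (Wx x y z - Wy x y z)) \<longlongrightarrow> 0) (at_left (x - y))"
    and xyz: "(x, y, z) \<in> domH"
  shows "W x y z = 0"
proof -
  have zero: "integral {a..b} (\<lambda>k. W (x0 + k) y0 k) = 0"
    if ab: "0 < a" "a \<le> b" and xy0: "0 < y0" "y0 < x0" for a b x0 y0
  proof -
    \<comment> \<open>the shift by \<open>d\<close> reaches below \<open>a\<close>, so the bounds are needed on the slightly longer interval from \<open>a - r\<close>\<close>
    define r where "r = a / 2"
    have r: "0 < r" "0 < a - r" "a - r = r" using ab by (auto simp: r_def)
    have left: "filterlim (\<lambda>d. v - d) (at_left v) (at_right (0::real))" for v :: real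
      unfolding filterlim_at
      by (auto intro!: tendsto_eq_intros simp: eventually_at_right_field intro: exI[of _ 1])
    have sec: "continuous_on {a - r..b} (\<lambda>k. V (e + d + k) e k)"
      if "continuous3_on domH V" "0 < e" "0 < d" for V :: "real \<Rightarrow> real \<Rightarrow> real \<Rightarrow> real" and e d
      using continuous_on_section[OF slice_continuous[OF that(1) r(2), of b], of e "e + d"] that by simp
    have bd: "\<exists>M\<ge>0. \<forall>k\<in>{a - r..b}. \<forall>d. 0 < d \<longrightarrow> d \<le> 1 \<longrightarrow> \<bar>W (e + d + k) e k\<bar> \<le> M \<and>
         \<bar>Wx (e + d + k) e k\<bar> \<le> M * d powr (- 2 * p) \<and> \<bar>Wy (e + d + k) e k\<bar> \<le> M * d powr (- 2 * p)"
      if e: "0 < e" for e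
    proof (rule epd_family_bounded_near_diagonal[OF p e order_refl])
      show "epd p lam (\<lambda>x y. W (x + k) y k) (\<lambda>x y. Wx (x + k) y k) (\<lambda>x y. Wy (x + k) y k)"
        if "k \<in> {a - r..b}" for k by (rule slice_epd) (use that r in auto)
      fix M assume "0 \<le> M" "\<And>k y d. k \<in> {a - r..b} \<Longrightarrow> y \<in> {e..e} \<Longrightarrow> 0 < d \<Longrightarrow> d \<le> 1 \<Longrightarrow>
        \<bar>W (y + d + k) y k\<bar> \<le> M \<and> \<bar>Wx (y + d + k) y k\<bar> \<le> M * d powr (- 2 * p) \<and>
        \<bar>Wy (y + d + k) y k\<bar> \<le> M * d powr (- 2 * p)"
      then show ?thesis by (intro exI[of _ M]) auto
    qed (intro slice_continuous c cx cy r(2))+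
    define s where "s = min r 1"
    have s: "0 < s" "s \<le> r" "s \<le> 1" using r by (auto simp: s_def)
    have epd1: "epd p lam (\<lambda>x y. integral {a..b} (\<lambda>k. W (x + k) y k)) (\<lambda>x y. integral {a..b} (\<lambda>k. Wx (x + k) y k))
        (\<lambda>x y. integral {a..b} (\<lambda>k. Wy (x + k) y k))"
      by (rule epd_average[OF slice_epd]) (use ab in \<open>auto intro: slice_continuous c cx cy\<close>)
    show ?thesis
    proof (rule epd_zero_data_unique[OF epd1 p _ _ xy0])
      fix e :: real assume e: "0 < e"
      obtain M where M: "0 \<le> M" "\<And>k d. k \<in> {a - r..b} \<Longrightarrow> 0 < d \<Longrightarrow> d \<le> 1 \<Longrightarrow> \<bar>W (e + d + k) e k\<bar> \<le> M"
        "\<And>k d. k \<in> {a - r..b} \<Longrightarrow> 0 < d \<Longrightarrow> d \<le> 1 \<Longrightarrow> \<bar>Wx (e + d + k) e k\<bar> \<le> M * d powr (- 2 * p)"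
        "\<And>k d. k \<in> {a - r..b} \<Longrightarrow> 0 < d \<Longrightarrow> d \<le> 1 \<Longrightarrow> \<bar>Wy (e + d + k) e k\<bar> \<le> M * d powr (- 2 * p)"
        using bd[OF e] by blast
      show "((\<lambda>d. integral {a..b} (\<lambda>k. W (e + d + k) e k)) \<longlongrightarrow> 0) (at_right 0)"
      proof (rule bounded_oblique_limit_integral_zero[OF ab(2) s(1), where M = M])
        fix d assume d: "0 < d" "d < s"
        show "continuous_on {a - s..b} (\<lambda>k. W (e + d + k) e k)"
          by (rule continuous_on_subset[OF sec[OF c e d(1)]]) (use s in auto)
        fix v assume "v \<in> {a - s..b}"
        then show "\<bar>W (e + d + v) e v\<bar> \<le> M" using d s by (intro M) auto
      next
        fix v assume v: "v \<in> {a..b}"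
        have "((\<lambda>z. W (e + v) e z) \<longlongrightarrow> 0) (at_left v)" using lim[of e "e + v"] e v ab by simp
        from filterlim_compose[OF this left]
        show "((\<lambda>d. W (e + d + (v - d)) e (v - d)) \<longlongrightarrow> 0) (at_right 0)" by simp
      qed
      define N where "N = (\<lambda>d k. d powr (2 * p) * (Wx (e + d + k) e k - Wy (e + d + k) e k))"
      have "((\<lambda>d. integral {a..b} (N d)) \<longlongrightarrow> 0) (at_right 0)"
      proof (rule bounded_oblique_limit_integral_zero[OF ab(2) s(1), where M = "2 * M"])
        fix d assume d: "0 < d" "d < s"
        show "continuous_on {a - s..b} (N d)"
          unfolding N_def
          by (intro continuous_intros; rule continuous_on_subset[OF sec[OF cx e d(1)]] continuous_on_subset[OF sec[OF cy e d(1)]])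
             (use s in auto)
        fix v assume v: "v \<in> {a - s..b}"
        have "\<bar>Wx (e + d + v) e v\<bar> \<le> M * d powr (- 2 * p)" "\<bar>Wy (e + d + v) e v\<bar> \<le> M * d powr (- 2 * p)"
          using M(3)[of v d] M(4)[of v d] v d s by auto
        then have "\<bar>Wx (e + d + v) e v - Wy (e + d + v) e v\<bar> \<le> 2 * M * d powr (- 2 * p)" by linarith
        then have "d powr (2 * p) * \<bar>Wx (e + d + v) e v - Wy (e + d + v) e v\<bar>
             \<le> d powr (2 * p) * (2 * M * d powr (- 2 * p))" by (intro mult_left_mono) auto
        also have "\<dots> = 2 * M" using d by (simp add: powr_minus)
        finally show "\<bar>N d v\<bar> \<le> 2 * M" by (simp add: N_def abs_mult)
      next
        fix v assume v: "v \<in> {a..b}"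
        have "((\<lambda>z. (v - z) powr (2 * p) * (Wx (e + v) e z - Wy (e + v) e z)) \<longlongrightarrow> 0) (at_left v)"
          using limN[of e "e + v"] e v ab by simp
        from filterlim_compose[OF this left]
        show "((\<lambda>d. N d (v - d)) \<longlongrightarrow> 0) (at_right 0)" by (simp add: N_def)
      qed
      then show "((\<lambda>d. d powr (2 * p) * (integral {a..b} (\<lambda>k. Wx (e + d + k) e k)
          - integral {a..b} (\<lambda>k. Wy (e + d + k) e k))) \<longlongrightarrow> 0) (at_right 0)"
      proof (rule Lim_transform_eventually)
        have "eventually (\<lambda>d. 0 < d) (at_right (0::real))" by (simp add: eventually_at_right_less)
        then show "\<forall>\<^sub>F d in at_right 0. integral {a..b} (N d) =
          d powr (2 * p) * (integral {a..b} (\<lambda>k. Wx (e + d + k) e k) - integral {a..b} (\<lambda>k. Wy (e + d + k) e k))"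
        proof (rule eventually_mono)
          fix d :: real assume d: "0 < d"
          have "(\<lambda>k. Wx (e + d + k) e k) integrable_on {a..b}" "(\<lambda>k. Wy (e + d + k) e k) integrable_on {a..b}"
            using sec[OF cx e d] sec[OF cy e d] r
            by (auto intro!: integrable_continuous_interval elim!: continuous_on_subset)
          then show "integral {a..b} (N d) =
            d powr (2 * p) * (integral {a..b} (\<lambda>k. Wx (e + d + k) e k) - integral {a..b} (\<lambda>k. Wy (e + d + k) e k))"
            unfolding N_def by (simp add: integral_diff)
        qed
      qed
    qed
  qed
  have H: "0 < z" "z < x - y" "0 < y" "y < x" using xyz by (auto simp: domH_def)
  have "W ((x - z) + z) y z = 0"
  proof (rule zero_if_initial_integrals_zero[of z "z + 1" "\<lambda>k. W ((x - z) + k) y k"])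
    show "continuous_on {z..z + 1} (\<lambda>k. W (x - z + k) y k)"
      using continuous_on_section[OF slice_continuous[OF c H(1), of "z + 1"], of y "x - z"] H by simp
    show "integral {z..b} (\<lambda>k. W (x - z + k) y k) = 0" if "z < b" for b
      by (rule zero) (use H that in auto)
  qed auto
  then show ?thesis by simp
qed

lemma closure_domH: "closure domH = {(x, y, z). 0 \<le> z \<and> z \<le> x - y \<and> 0 \<le> y}"
proof
  have "closed ({q :: real \<times> real \<times> real. 0 \<le> snd (snd q)} \<inter> {q. snd (snd q) \<le> fst q - fst (snd q)} \<inter> {q. 0 \<le> fst (snd q)})"
    by (intro closed_Int closed_Collect_le continuous_intros)
  moreover have "{q :: real \<times> real \<times> real. 0 \<le> snd (snd q)} \<inter> {q. snd (snd q) \<le> fst q - fst (snd q)} \<inter> {q. 0 \<le> fst (snd q)}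
      = {(x, y, z). 0 \<le> z \<and> z \<le> x - y \<and> 0 \<le> y}" by auto
  ultimately show "closure domH \<subseteq> {(x, y, z). 0 \<le> z \<and> z \<le> x - y \<and> 0 \<le> y}"
    by (intro closure_minimal) (auto simp: domH_def)
next
  show "{(x, y, z). 0 \<le> z \<and> z \<le> x - y \<and> 0 \<le> y} \<subseteq> closure domH"
  proof clarify
    fix x y z :: real assume H: "0 \<le> z" "z \<le> x - y" "0 \<le> y"
    have "((\<lambda>e. (x + 3 * e, y + e, z + e)) \<longlongrightarrow> (x + 3 * 0, y + 0, z + 0)) (at_right 0)"
      by (intro tendsto_intros)
    moreover have "eventually (\<lambda>e. (x + 3 * e, y + e, z + e) \<in> domH) (at_right 0)"
      using H by (auto simp: domH_def eventually_at_right_field intro!: exI[of _ 1])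
    then have "eventually (\<lambda>e. (x + 3 * e, y + e, z + e) \<in> closure domH) (at_right 0)"
      by (rule eventually_mono) (use closure_subset in blast)
    ultimately have "(x + 3 * 0, y + 0, z + 0) \<in> closure domH"
      by (intro Lim_in_closed_set[OF closed_closure _ trivial_limit_at_right_real])
    then show "(x, y, z) \<in> closure domH" by simp
  qed
qed

lemma problem_C_solution_unique:
  assumes p: "0 < p" "p < 1/2"
    and U: "solves_problem_C p lam \<tau> \<nu> \<mu> U" and V: "solves_problem_C p lam \<tau> \<nu> \<mu> V"
    and q: "(x, y, z) \<in> closure domH"
  shows "U x y z = V x y z"
proof -
  note s = U[unfolded solves_problem_C_def classical_regularity_def]
    V[unfolded solves_problem_C_def classical_regularity_def]
  have dz: "((\<lambda>t. S x y t) has_real_derivative pdz3 S x y z) (at z)"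
    if "has_pdz3 S" "(x, y, z) \<in> domH" for S x y z
    using that by (auto simp: has_pdz3_def pdz3_def DERIV_deriv_iff_field_differentiable)
  have dx: "((\<lambda>t. S t y z) has_real_derivative pdx3 S x y z) (at x)"
    if "has_pdx3 S" "(x, y, z) \<in> domH" for S x y z
    using that by (auto simp: has_pdx3_def pdx3_def DERIV_deriv_iff_field_differentiable)
  have dy: "((\<lambda>t. S x t z) has_real_derivative pdy3 S x y z) (at y)"
    if "has_pdy3 S" "(x, y, z) \<in> domH" for S x y z
    using that by (auto simp: has_pdy3_def pdy3_def DERIV_deriv_iff_field_differentiable)
  define W Wx Wy Wxy where "W = (\<lambda>x y z. pdz3 U x y z - pdz3 V x y z)"
    and "Wx = (\<lambda>x y z. pdx3 (pdz3 U) x y z - pdx3 (pdz3 V) x y z)"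
    and "Wy = (\<lambda>x y z. pdy3 (pdz3 U) x y z - pdy3 (pdz3 V) x y z)"
    and "Wxy = (\<lambda>x y z. pdx3 (pdy3 (pdz3 U)) x y z - pdx3 (pdy3 (pdz3 V)) x y z)"
  interpret D: classical_z_derivative p lam W Wx Wy Wxy
  proof
    show "continuous3_on domH W" "continuous3_on domH Wx"
      "continuous3_on domH Wy" "continuous3_on domH Wxy"
      using s unfolding W_def Wx_def Wy_def Wxy_def case_prod_unfold by (auto intro!: continuous_on_diff)
    show "((\<lambda>t. W t y z) has_real_derivative Wx x y z) (at x)" if "(x, y, z) \<in> domH" for x y z
      unfolding W_def Wx_def by (intro DERIV_diff dx that) (use s in auto)
    show "((\<lambda>t. W x t z) has_real_derivative Wy x y z) (at y)" if "(x, y, z) \<in> domH" for x y z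
      unfolding W_def Wy_def by (intro DERIV_diff dy that) (use s in auto)
    show "((\<lambda>t. Wy t y z) has_real_derivative Wxy x y z) (at x)" if "(x, y, z) \<in> domH" for x y z
      unfolding Wxy_def Wy_def by (intro DERIV_diff dx that) (use s in auto)
    show "Wxy x y z = p / (x - y - z) * (Wx x y z - Wy x y z) + lam * W x y z"
      if "(x, y, z) \<in> domH" for x y z
    proof -
      have "pdx3 (pdy3 (pdz3 S)) x y z - p / (x - y - z) * pdx3 (pdz3 S) x y z
        + p / (x - y - z) * pdy3 (pdz3 S) x y z - lam * pdz3 S x y z = 0" if "S = U \<or> S = V" for S
        using s that \<open>(x, y, z) \<in> domH\<close> by fast
      from this[of U, OF disjI1[OF refl]] this[of V, OF disjI2[OF refl]] show ?thesis
        unfolding W_def Wx_def Wy_def Wxy_def right_diff_distrib by linarith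
    qed
  qed
  have W0: "W x y z = 0" if "(x, y, z) \<in> domH" for x y z
  proof (rule D.zero_boundary_limits_unique[OF p])
    show "((\<lambda>z. W x y z) \<longlongrightarrow> 0) (at_left (x - y))" if "0 < y" "y < x" for x y
    proof -
      have "((\<lambda>z. pdz3 U x y z) \<longlongrightarrow> \<nu> x y) (at_left (x - y))" "((\<lambda>z. pdz3 V x y z) \<longlongrightarrow> \<nu> x y) (at_left (x - y))"
        using s that by blast+
      from tendsto_diff[OF this] show ?thesis by (simp add: W_def)
    qed
    show "((\<lambda>z. (x - y - z) powr (2 * p) * (Wx x y z - Wy x y z)) \<longlongrightarrow> 0) (at_left (x - y))"
      if "0 < y" "y < x" for x y
    proof -
      have "((\<lambda>z. (x - y - z) powr (2 * p) * (pdx3 (pdz3 S) x y z - pdy3 (pdz3 S) x y z))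
           \<longlongrightarrow> \<mu> x y) (at_left (x - y))" if "S = U \<or> S = V" for S
        using s that \<open>0 < y\<close> \<open>y < x\<close> by blast
      from tendsto_diff[OF this[of U, OF disjI1[OF refl]] this[of V, OF disjI2[OF refl]]] show ?thesis
        by (simp add: Wx_def Wy_def algebra_simps)
    qed
  qed (rule that)
  have eqH: "U x y z = V x y z" if H: "(x, y, z) \<in> domH" for x y z
  proof -
    have h: "0 < z" "z < x - y" "0 < y" "y < x" using H by (auto simp: domH_def)
    have cz: "continuous_on {z..x - y} (\<lambda>t. S x y t)"
      if "continuous3_on (closure domH) S" for S :: "real \<Rightarrow> real \<Rightarrow> real \<Rightarrow> real"
      by (rule continuous_on_ternary_compose[OF that])
         (use h in \<open>auto simp: closure_domH intro!: continuous_intros\<close>)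
    have "(\<lambda>t. U x y t - V x y t) (x - y) = (\<lambda>t. U x y t - V x y t) z"
    proof (rule DERIV_isconst_end[where f = "\<lambda>t. U x y t - V x y t" and a = z and b = "x - y"])
      show "continuous_on {z..x - y} (\<lambda>t. U x y t - V x y t)"
        by (intro continuous_on_diff cz) (use s in auto)
      fix t assume t: "z < t" "t < x - y"
      then have tH: "(x, y, t) \<in> domH" using h by (auto simp: domH_def)
      have "((\<lambda>t. U x y t - V x y t) has_real_derivative pdz3 U x y t - pdz3 V x y t) (at t)"
        by (intro DERIV_diff dz tH) (use s in auto)
      then show "((\<lambda>t. U x y t - V x y t) has_real_derivative 0) (at t)"
        using W0[OF tH] by (simp add: W_def)
    qed (use h in auto)
    moreover have "U x y (x - y) = V x y (x - y)" using s h by auto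
    ultimately show ?thesis by simp
  qed
  have "continuous_on (closure domH) (\<lambda>(x, y, z). U x y z - V x y z)"
    using s by (auto simp: case_prod_unfold intro!: continuous_on_diff)
  from continuous_constant_on_closure[OF this, of 0 "(x, y, z)"] show ?thesis
    using eqH q by auto
qed

section \<open>The confluent hypergeometric limit function\<close>

lemma hyp0F1_summable:
  fixes a w :: real
  assumes "0 < a"
  shows "summable (\<lambda>n. w ^ n / (pochhammer a n * fact n))"
proof (rule summable_comparison_test')
  show "summable (\<lambda>n. (1 + 1 / a) * (inverse (fact n) * \<bar>w\<bar> ^ n))"
    by (intro summable_mult summable_exp)
  fix n :: nat assume "0 \<le> n"
  have "pochhammer a n * (1 + 1 / a) \<ge> 1"
  proof (cases n)
    case (Suc k)
    have "1 \<le> pochhammer (a + 1) k"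
      unfolding pochhammer_prod by (rule prod_ge_1) (use assms in auto)
    then have "a * 1 \<le> a * pochhammer (a + 1) k" using assms by (intro mult_left_mono) auto
    then have "a \<le> pochhammer a n" by (simp add: Suc pochhammer_rec)
    then have "a * (1 + 1 / a) \<le> pochhammer a n * (1 + 1 / a)" using assms by (intro mult_right_mono) auto
    then show ?thesis using assms by (simp add: distrib_left)
  qed (use assms in auto)
  then have "1 / pochhammer a n \<le> 1 + 1 / a"
    using pochhammer_pos[OF assms, of n] by (simp add: pos_divide_le_eq mult.commute)
  then have "(1 / pochhammer a n) * (inverse (fact n) * \<bar>w\<bar> ^ n) \<le> (1 + 1 / a) * (inverse (fact n) * \<bar>w\<bar> ^ n)"
    by (intro mult_right_mono) auto
  then show "norm (w ^ n / (pochhammer a n * fact n)) \<le> (1 + 1 / a) * (inverse (fact n) * \<bar>w\<bar> ^ n)"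
    using pochhammer_pos[OF assms, of n] by (simp add: power_abs abs_mult field_simps)
qed

lemma hyp0F1_sums: "0 < a \<Longrightarrow> (\<lambda>n. w ^ n / (pochhammer a n * fact n)) sums hyp0F1 a w"
  unfolding hyp0F1_def by (intro summable_sums hyp0F1_summable)

lemma hyp0F1_has_derivative:
  assumes "0 < a"
  shows "(hyp0F1 a has_real_derivative hyp0F1 (a + 1) w / a) (at w)"
proof -
  define c where "c = (\<lambda>n. 1 / (pochhammer a n * fact n :: real))"
  have "((\<lambda>x. \<Sum>n. c n * x ^ n) has_real_derivative (\<Sum>n. diffs c n * w ^ n)) (at w)"
    by (rule termdiffs_strong_converges_everywhere) (use hyp0F1_summable[OF assms] in \<open>simp add: c_def\<close>)
  moreover have "(\<lambda>x. \<Sum>n. c n * x ^ n) = hyp0F1 a" by (simp add: fun_eq_iff hyp0F1_def c_def)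
  moreover have "diffs c n * w ^ n = (w ^ n / (pochhammer (a + 1) n * fact n)) / a" for n
    using assms by (simp add: diffs_def c_def pochhammer_rec field_simps del: of_nat_Suc)
  then have "(\<Sum>n. diffs c n * w ^ n) = hyp0F1 (a + 1) w / a"
    using suminf_divide[OF hyp0F1_summable[of "a + 1" w], of a] assms by (simp only: hyp0F1_def)
  ultimately show ?thesis by simp
qed

lemma hyp0F1_zero: "0 < a \<Longrightarrow> hyp0F1 a 0 = 1"
  using powser_sums_zero_iff[of "\<lambda>n. 1 / (pochhammer a n * fact n)" 1] hyp0F1_sums[of a 0]
  by (simp add: sums_iff)

lemma continuous_on_hyp0F1 [continuous_intros]:
  "continuous_on S f \<Longrightarrow> 0 < a \<Longrightarrow> continuous_on S (\<lambda>x. hyp0F1 a (f x))"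
  by (rule continuous_on_compose2[of UNIV "hyp0F1 a"])
     (auto intro!: continuous_at_imp_continuous_on DERIV_isCont hyp0F1_has_derivative)

text \<open>
  In view of \<open>hyp0F1_has_derivative\<close> this is the differential equation \<open>w F'' + a F' - F = 0\<close> of
  \<open>F = hyp0F1 a\<close>. The powers of \<open>w\<close> are compared after the factor \<open>w\<close> has shifted the first series
  by one place.
\<close>

lemma hyp0F1_contiguous:
  assumes a: "0 < a"
  shows "w * (hyp0F1 (a + 2) w / (a * (a + 1))) + hyp0F1 (a + 1) w = hyp0F1 a w"
proof -
  define f where "f = (\<lambda>n. w ^ n / (pochhammer a n * fact n) - w ^ n / (pochhammer (a + 1) n * fact n))"
  have "f sums (hyp0F1 a w - hyp0F1 (a + 1) w)"
    unfolding f_def by (intro sums_diff hyp0F1_sums) (use a in auto)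
  moreover have "f 0 = 0" by (simp add: f_def)
  ultimately have 1: "(\<lambda>n. f (Suc n)) sums (hyp0F1 a w - hyp0F1 (a + 1) w)"
    by (simp add: sums_Suc_iff)
  have "(\<lambda>n. w * (w ^ n / (pochhammer (a + 2) n * fact n) / (a * (a + 1)))) sums
     (w * (hyp0F1 (a + 2) w / (a * (a + 1))))"
    by (intro sums_mult sums_divide hyp0F1_sums) (use a in auto)
  moreover have "w * (w ^ n / (pochhammer (a + 2) n * fact n) / (a * (a + 1))) = f (Suc n)" for n
  proof -
    define P where "P = pochhammer (a + 2) n"
    have P: "P > 0" using a by (simp add: P_def pochhammer_pos)
    have 1: "pochhammer a (Suc n) * (a + 1 + n) = a * (a + 1) * P"
      using pochhammer_rec[of a "Suc n"] pochhammer_rec[of "a + 1" n] pochhammer_rec'[of a "Suc n"]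
      by (simp add: P_def add_ac mult_ac)
    have 2: "pochhammer (a + 1) (Suc n) = (a + 1) * P"
      using pochhammer_rec[of "a + 1" n] by (simp add: P_def add_ac)
    have n: "a + 1 + n > 0" using a by simp
    have 3: "pochhammer a (Suc n) = a * (a + 1) * P / (a + 1 + n)"
      using 1 n by (simp add: field_simps)
    have "f (Suc n) = w ^ Suc n / fact (Suc n) * ((a + 1 + n) / (a * (a + 1) * P) - 1 / ((a + 1) * P))"
    proof -
      have "X / (A / m * Y) - X / (B * Y) = X / Y * (m / A - 1 / B)"
        if "Y \<noteq> 0" "A \<noteq> 0" "B \<noteq> 0" "m \<noteq> 0" for X Y A B m :: real
        using that by (simp add: field_simps)
      from this[of "fact (Suc n)" "a * (a + 1) * P" "(a + 1) * P" "a + 1 + n" "w ^ Suc n"]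
      show ?thesis unfolding f_def 2 3 using n P a by simp
    qed
    also have "(a + 1 + n) / (a * (a + 1) * P) - 1 / ((a + 1) * P) = (1 + n) / (a * (a + 1) * P)"
    proof -
      have "1 / ((a + 1) * P) = a / (a * (a + 1) * P)" using a by simp
      then have "(a + 1 + n) / (a * (a + 1) * P) - 1 / ((a + 1) * P) = (a + 1 + n - a) / (a * (a + 1) * P)"
        by (simp only: diff_divide_distrib)
      then show ?thesis by simp
    qed
    also have "w ^ Suc n / fact (Suc n) * ((1 + n) / (a * (a + 1) * P))
       = w * (w ^ n / (P * fact n) / (a * (a + 1)))"
    proof -
      have "X * w / (m * Y) * (m / (A * P)) = w * (X / (P * Y) / A)" if "m \<noteq> 0" for X m Y A :: real
        using that by (simp add: mult_ac)
      from this[of "1 + n" "w ^ n" "fact n" "a * (a + 1)"] show ?thesis by (simp add: mult.commute)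
    qed
    finally show ?thesis by (simp add: P_def)
  qed
  ultimately have "(\<lambda>n. f (Suc n)) sums (w * (hyp0F1 (a + 2) w / (a * (a + 1))))" by simp
  with 1 show ?thesis by (metis sums_unique2 diff_add_cancel)
qed

section \<open>Integrals against a singular weight\<close>

lemma weighted_integrable:
  fixes k f :: "real \<Rightarrow> real"
  assumes k: "k integrable_on {a..b}" "\<And>s. s \<in> {a..b} \<Longrightarrow> 0 \<le> k s" and f: "continuous_on {a..b} f"
  shows "(\<lambda>s. k s * f s) integrable_on {a..b}"
proof -
  have "k absolutely_integrable_on {a..b}" by (rule nonnegative_absolutely_integrable_1[OF k])
  moreover have "f \<in> borel_measurable (lebesgue_on {a..b})"
    by (rule continuous_imp_measurable_on_sets_lebesgue[OF f]) auto
  moreover have "bounded (f ` {a..b})"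
    by (intro compact_imp_bounded compact_continuous_image f compact_Icc)
  ultimately have "(\<lambda>s. f s * k s) absolutely_integrable_on {a..b}"
    by (intro absolutely_integrable_bounded_measurable_product_real) auto
  then show ?thesis by (simp add: absolutely_integrable_on_def mult.commute)
qed

lemma weighted_integral_diff_le:
  fixes k f h :: "real \<Rightarrow> real"
  assumes k: "k integrable_on {a..b}" "\<And>s. s \<in> {a..b} \<Longrightarrow> 0 \<le> k s"
    and f: "continuous_on {a..b} f" and le: "\<And>s. s \<in> {a..b} \<Longrightarrow> \<bar>f s\<bar> \<le> e"
  shows "\<bar>integral {a..b} (\<lambda>s. k s * f s)\<bar> \<le> e * integral {a..b} k"
proof -
  have "norm (integral {a..b} (\<lambda>s. k s * f s)) \<le> integral {a..b} (\<lambda>s. k s * e)"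
  proof (rule integral_norm_bound_integral)
    show "(\<lambda>s. k s * f s) integrable_on {a..b}" by (rule weighted_integrable[OF k f])
    show "(\<lambda>s. k s * e) integrable_on {a..b}" by (rule weighted_integrable[OF k continuous_on_const])
    show "norm (k s * f s) \<le> k s * e" if "s \<in> {a..b}" for s
      using mult_left_mono[OF le[OF that] k(2)[OF that]] k(2)[OF that] by (simp add: abs_mult)
  qed
  then show ?thesis by (simp add: mult.commute)
qed

text \<open>
  The kernels have integrable end-point singularities, so the parameter dependence is put into a
  continuous factor and the singularity into a fixed non-negative weight; uniform continuity in the
  parameter over the compact interval then suffices.
\<close>

lemma weighted_integral_continuous:
  fixes f :: "'a::metric_space \<Rightarrow> real \<Rightarrow> real"
  assumes k: "k integrable_on {a..b}" "\<And>s. s \<in> {a..b} \<Longrightarrow> 0 \<le> k s"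
    and f: "continuous_on (U \<times> {a..b}) (\<lambda>(x, s). f x s)"
  shows "continuous_on U (\<lambda>x. integral {a..b} (\<lambda>s. k s * f x s))"
proof -
  have fs: "continuous_on {a..b} (f x)" if "x \<in> U" for x
    by (rule continuous_on_binary_compose[OF f])
       (use that in \<open>auto intro!: continuous_intros\<close>)
  define I where "I = integral {a..b} k"
  have I: "I \<ge> 0" unfolding I_def by (rule integral_nonneg[OF k])
  show ?thesis
    unfolding continuous_on_def
  proof (intro ballI tendstoI)
    fix x and e :: real assume x: "x \<in> U" and e: "0 < e"
    define e' where "e' = e / (I + 1)"
    have e': "0 < e'" "e' * I < e" using e I by (auto simp: e'_def field_simps)
    obtain X0 where X0: "x \<in> X0" "open X0" "\<forall>t\<in>X0 \<inter> U. \<forall>s\<in>{a..b}. dist (f t s) (f x s) \<le> e'"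
      by (rule continuous_on_prod_compactE[OF f compact_Icc x e'(1)]) simp
    have "dist (integral {a..b} (\<lambda>s. k s * f t s)) (integral {a..b} (\<lambda>s. k s * f x s)) < e"
      if t: "t \<in> X0" "t \<in> U" for t
    proof -
      have "integral {a..b} (\<lambda>s. k s * f t s) - integral {a..b} (\<lambda>s. k s * f x s)
         = integral {a..b} (\<lambda>s. k s * (f t s - f x s))"
        unfolding right_diff_distrib
        by (intro integral_diff[symmetric] weighted_integrable k fs t x)
      moreover have "\<bar>integral {a..b} (\<lambda>s. k s * (f t s - f x s))\<bar> \<le> e' * integral {a..b} k"
        by (rule weighted_integral_diff_le[OF k])
           (use X0 t in \<open>auto intro!: continuous_on_diff fs x simp: dist_real_def\<close>)
      ultimately show ?thesis using e'(2) by (simp add: dist_real_def I_def)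
    qed
    then show "\<forall>\<^sub>F t in at x within U. dist (integral {a..b} (\<lambda>s. k s * f t s)) (integral {a..b} (\<lambda>s. k s * f x s)) < e"
      unfolding eventually_at_topological using X0 by blast
  qed
qed

lemma weighted_integral_deriv:
  fixes f fx :: "real \<Rightarrow> real \<Rightarrow> real"
  assumes k: "k integrable_on {a..b}" "\<And>s. s \<in> {a..b} \<Longrightarrow> 0 \<le> k s"
    and S: "open S" "x \<in> S"
    and d: "\<And>t s. t \<in> S \<Longrightarrow> s \<in> {a..b} \<Longrightarrow> ((\<lambda>t. f t s) has_real_derivative fx t s) (at t)"
    and c: "\<And>t. t \<in> S \<Longrightarrow> continuous_on {a..b} (f t)"
    and cx: "continuous_on (S \<times> {a..b}) (\<lambda>(t, s). fx t s)"
  shows "((\<lambda>t. integral {a..b} (\<lambda>s. k s * f t s)) has_real_derivative integral {a..b} (\<lambda>s. k s * fx x s)) (at x)"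
proof -
  have fxs: "continuous_on {a..b} (fx x)"
    by (rule continuous_on_binary_compose[OF cx])
       (use S in \<open>auto intro!: continuous_intros\<close>)
  define I where "I = integral {a..b} k"
  have I: "I \<ge> 0" unfolding I_def by (rule integral_nonneg[OF k])
  define F where "F = (\<lambda>t. integral {a..b} (\<lambda>s. k s * f t s))"
  define D where "D = integral {a..b} (\<lambda>s. k s * fx x s)"
  have "((\<lambda>t. (F t - F x) / (t - x)) \<longlongrightarrow> D) (at x)"
  proof (rule tendstoI)
    fix e :: real assume e: "0 < e"
    define e' where "e' = e / (I + 1)"
    have e': "0 < e'" "e' * I < e" using e I by (auto simp: e'_def field_simps)
    obtain X0 where X0: "x \<in> X0" "open X0" "\<forall>t\<in>X0 \<inter> S. \<forall>s\<in>{a..b}. dist (fx t s) (fx x s) \<le> e'"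
      by (rule continuous_on_prod_compactE[OF cx compact_Icc S(2) e'(1)]) simp
    obtain r where r: "0 < r" "ball x r \<subseteq> X0 \<inter> S"
      using open_contains_ball_eq[of "X0 \<inter> S"] X0 S by (metis IntI open_Int)
    have "dist ((F t - F x) / (t - x)) D < e" if t: "t \<noteq> x" "dist t x < r" for t
    proof -
      have tS: "t \<in> ball x r" using t by (simp add: dist_commute)
      have bd: "\<bar>f t s - f x s - (t - x) * fx x s\<bar> \<le> e' * \<bar>t - x\<bar>" if s: "s \<in> {a..b}" for s
      proof -
        have "norm ((\<lambda>u. f u s - u * fx x s) t - (\<lambda>u. f u s - u * fx x s) x) \<le> e' * norm (t - x)"
        proof (rule field_differentiable_bound[of "ball x r" _ "\<lambda>u. fx u s - fx x s"])
          fix u assume u: "u \<in> ball x r"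
          have "((\<lambda>u. f u s - u * fx x s) has_real_derivative fx u s - 1 * fx x s) (at u)"
            by (intro DERIV_diff d DERIV_cmult_right DERIV_ident) (use u r s in auto)
          then show "((\<lambda>u. f u s - u * fx x s) has_real_derivative fx u s - fx x s) (at u within ball x r)"
            by (simp add: has_field_derivative_at_within)
          have "u \<in> X0 \<inter> S" using u r by blast
          then show "norm (fx u s - fx x s) \<le> e'" using X0(3) s by (simp add: dist_real_def)
        qed (use tS r in auto)
        then show ?thesis by (simp add: algebra_simps)
      qed
      have tS': "t \<in> S" using tS r by auto
      have "F t - F x - (t - x) * D = integral {a..b} (\<lambda>s. k s * (f t s - f x s - (t - x) * fx x s))"
      proof -
        have "((\<lambda>s. k s * f t s - k s * f x s - (t - x) * (k s * fx x s)) has_integral F t - F x - (t - x) * D) {a..b}"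
          unfolding F_def D_def
          by (intro has_integral_diff has_integral_mult_right integrable_integral weighted_integrable k c fxs S tS')
        then show ?thesis by (simp add: algebra_simps integral_unique)
      qed
      moreover have "\<bar>integral {a..b} (\<lambda>s. k s * (f t s - f x s - (t - x) * fx x s))\<bar> \<le> (e' * \<bar>t - x\<bar>) * integral {a..b} k"
        by (rule weighted_integral_diff_le[OF k]) (use bd in \<open>auto intro!: continuous_intros c fxs S tS'\<close>)
      ultimately have "\<bar>F t - F x - (t - x) * D\<bar> \<le> (e' * I) * \<bar>t - x\<bar>" by (simp add: I_def mult_ac)
      also have "\<dots> < e * \<bar>t - x\<bar>" using e' t by (intro mult_strict_right_mono) auto
      finally have "\<bar>F t - F x - (t - x) * D\<bar> / \<bar>t - x\<bar> < e" using t by (simp add: pos_divide_less_eq)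
      moreover have "(F t - F x) / (t - x) - D = (F t - F x - (t - x) * D) / (t - x)"
        using t by (simp add: field_simps)
      ultimately show ?thesis by (simp add: dist_real_def)
    qed
    then show "\<forall>\<^sub>F t in at x. dist ((F t - F x) / (t - x)) D < e"
      unfolding eventually_at using r(1) by auto
  qed
  then show ?thesis unfolding has_field_derivative_iff F_def D_def .
qed

section \<open>Solutions as Beta-weighted means\<close>

definition beta_weight :: "real \<Rightarrow> real \<Rightarrow> real" where
  "beta_weight q s = (s * (1 - s)) powr (q - 1)"

lemma beta_weight_has_integral:
  assumes "0 < q"
  shows "(beta_weight q has_integral Beta q q) {0..1}"
proof (rule has_integral_eq[OF _ has_integral_Beta_real[OF assms assms]])
  fix s :: real assume "s \<in> {0..1}"
  then show "s powr (q - 1) * (1 - s) powr (q - 1) = beta_weight q s"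
    by (simp add: beta_weight_def powr_mult)
qed

lemma beta_weight_integrable: "0 < q \<Longrightarrow> beta_weight q integrable_on {0..1}"
  using beta_weight_has_integral by blast

lemma beta_weight_nonneg: "0 \<le> beta_weight q s"
  by (simp add: beta_weight_def)

text \<open>
  The domain together with the relatively open part of the face \<open>z = x - y\<close>, to which the first
  derivatives of the \<open>beta_weight\<close> integrals extend continuously.
\<close>

definition domH_diag :: "(real \<times> real \<times> real) set" where
  "domH_diag = {(x, y, z). 0 < y \<and> 0 < z \<and> z \<le> x - y}"

lemma domH_subset_domH_diag: "domH \<subseteq> domH_diag"
  by (auto simp: domH_def domH_diag_def)

abbreviation continuous_integrand :: "(real \<Rightarrow> real \<Rightarrow> real \<Rightarrow> real \<Rightarrow> real) \<Rightarrow> bool" where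
  "continuous_integrand i \<equiv> continuous_on (domH_diag \<times> {0..1}) (\<lambda>(u, s). i (fst u) (fst (snd u)) (snd (snd u)) s)"

text \<open>
  The data on the slice with parameter \<open>z\<close> are the function \<open>r \<mapsto> g z r\<close> on its diagonal.
  Substituting \<open>y + (x - y - z) * s\<close> for the point on the diagonal, \<open>0 \<le> s \<le> 1\<close>, makes the singular
  weight independent of the point \<open>(x, y, z)\<close>.
\<close>

locale diagonal_kernel =
  fixes q lam :: real and g g1 g2 :: "real \<Rightarrow> real \<Rightarrow> real"
  assumes q: "0 < q"
    and g_cont: "continuous_on ({0..} \<times> {0..}) (\<lambda>(z, r). g z r)"
    and g1_cont: "continuous_on ({0<..} \<times> {0<..}) (\<lambda>(z, r). g1 z r)"
    and g2_cont: "continuous_on ({0<..} \<times> {0<..}) (\<lambda>(z, r). g2 z r)"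
    and g_deriv: "\<And>z r. 0 < z \<Longrightarrow> 0 < r \<Longrightarrow> (g z has_real_derivative g1 z r) (at r)"
    and g1_deriv: "\<And>z r. 0 < z \<Longrightarrow> 0 < r \<Longrightarrow> (g1 z has_real_derivative g2 z r) (at r)"
begin

text \<open>
  The hypergeometric factor and its first two derivatives with respect to the argument, at the
  argument that belongs to \<open>d = x - y - z\<close>.
\<close>

definition F0 :: "real \<Rightarrow> real \<Rightarrow> real" where "F0 d s = hyp0F1 q (- lam * (d\<^sup>2 * (s * (1 - s))))"
definition F1 :: "real \<Rightarrow> real \<Rightarrow> real" where "F1 d s = hyp0F1 (q + 1) (- lam * (d\<^sup>2 * (s * (1 - s)))) / q"
definition F2 :: "real \<Rightarrow> real \<Rightarrow> real" where
  "F2 d s = hyp0F1 (q + 2) (- lam * (d\<^sup>2 * (s * (1 - s)))) / (q * (q + 1))"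

lemma F_ode: "- lam * (d\<^sup>2 * (s * (1 - s))) * F2 d s + q * F1 d s = F0 d s"
  using hyp0F1_contiguous[OF q, of "- lam * (d\<^sup>2 * (s * (1 - s)))"] q
  by (simp add: F0_def F1_def F2_def)

lemma hyp0F1_q_deriv:
  "(hyp0F1 q has_real_derivative hyp0F1 (q + 1) v / q) (at v)"
  "((\<lambda>v. hyp0F1 (q + 1) v / q) has_real_derivative hyp0F1 (q + 2) v / (q * (q + 1))) (at v)"
  using hyp0F1_has_derivative[OF q, of v]
    DERIV_cdivide[OF hyp0F1_has_derivative[of "q + 1" v], of q] q
  by (simp_all add: add_ac mult_ac)

lemma F_deriv:
  assumes "(d has_real_derivative d') (at t)" "(s has_real_derivative s') (at t)"
  shows "((\<lambda>t. F0 (d t) (s t)) has_real_derivative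
       F1 (d t) (s t) * (- lam * (2 * d t * d' * (s t * (1 - s t)) + (d t)\<^sup>2 * (s' * (1 - 2 * s t))))) (at t)"
    and "((\<lambda>t. F1 (d t) (s t)) has_real_derivative
       F2 (d t) (s t) * (- lam * (2 * d t * d' * (s t * (1 - s t)) + (d t)\<^sup>2 * (s' * (1 - 2 * s t))))) (at t)"
proof -
  have v: "((\<lambda>t. - lam * ((d t)\<^sup>2 * (s t * (1 - s t)))) has_real_derivative
     - lam * (2 * d t * d' * (s t * (1 - s t)) + (d t)\<^sup>2 * (s' * (1 - 2 * s t)))) (at t)"
    by (auto intro!: derivative_eq_intros assms simp: algebra_simps)
  show "((\<lambda>t. F0 (d t) (s t)) has_real_derivative
       F1 (d t) (s t) * (- lam * (2 * d t * d' * (s t * (1 - s t)) + (d t)\<^sup>2 * (s' * (1 - 2 * s t))))) (at t)"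
    unfolding F0_def F1_def by (rule DERIV_chain2[OF hyp0F1_q_deriv(1) v])
  show "((\<lambda>t. F1 (d t) (s t)) has_real_derivative
       F2 (d t) (s t) * (- lam * (2 * d t * d' * (s t * (1 - s t)) + (d t)\<^sup>2 * (s' * (1 - 2 * s t))))) (at t)"
    unfolding F1_def F2_def by (rule DERIV_chain2[OF hyp0F1_q_deriv(2) v])
qed

text \<open>
  The integrand of the solution \<open>V\<close> below and its formal derivatives.
\<close>

definition i0 :: "real \<Rightarrow> real \<Rightarrow> real \<Rightarrow> real \<Rightarrow> real" where
  "i0 x y z s = g z (y + (x - y - z) * s) * F0 (x - y - z) s"
definition ix :: "real \<Rightarrow> real \<Rightarrow> real \<Rightarrow> real \<Rightarrow> real" where
  "ix x y z s = s * g1 z (y + (x - y - z) * s) * F0 (x - y - z) s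
     - 2 * lam * (x - y - z) * (s * (1 - s)) * g z (y + (x - y - z) * s) * F1 (x - y - z) s"
definition iy :: "real \<Rightarrow> real \<Rightarrow> real \<Rightarrow> real \<Rightarrow> real" where
  "iy x y z s = (1 - s) * g1 z (y + (x - y - z) * s) * F0 (x - y - z) s
     + 2 * lam * (x - y - z) * (s * (1 - s)) * g z (y + (x - y - z) * s) * F1 (x - y - z) s"
definition ixy :: "real \<Rightarrow> real \<Rightarrow> real \<Rightarrow> real \<Rightarrow> real" where
  "ixy x y z s = s * (1 - s) * g2 z (y + (x - y - z) * s) * F0 (x - y - z) s
     - 2 * lam * (x - y - z) * (s * (1 - s)) * (1 - 2 * s) * g1 z (y + (x - y - z) * s) * F1 (x - y - z) s
     + 2 * lam * (s * (1 - s)) * g z (y + (x - y - z) * s) * F1 (x - y - z) s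
     - 4 * lam\<^sup>2 * (x - y - z)\<^sup>2 * (s * (1 - s))\<^sup>2 * g z (y + (x - y - z) * s) * F2 (x - y - z) s"

text \<open>
  The solution with regular data: \<open>V\<close> is a Beta-weighted mean of \<open>g z\<close> over the diagonal segment from
  \<open>y\<close> to \<open>x - z\<close>, corrected by the hypergeometric factor.
\<close>

definition V :: "real \<Rightarrow> real \<Rightarrow> real \<Rightarrow> real" where
  "V x y z = integral {0..1} (\<lambda>s. beta_weight q s * i0 x y z s)"
definition Vx :: "real \<Rightarrow> real \<Rightarrow> real \<Rightarrow> real" where
  "Vx x y z = integral {0..1} (\<lambda>s. beta_weight q s * ix x y z s)"
definition Vy :: "real \<Rightarrow> real \<Rightarrow> real \<Rightarrow> real" where
  "Vy x y z = integral {0..1} (\<lambda>s. beta_weight q s * iy x y z s)"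
definition Vxy :: "real \<Rightarrow> real \<Rightarrow> real \<Rightarrow> real" where
  "Vxy x y z = integral {0..1} (\<lambda>s. beta_weight q s * ixy x y z s)"

lemma arg_nonneg: "0 \<le> s \<Longrightarrow> s \<le> 1 \<Longrightarrow> 0 \<le> y \<Longrightarrow> z \<le> x - y \<Longrightarrow> (0::real) \<le> y + (x - y - z) * s"
  by simp

lemma arg_pos: "0 \<le> s \<Longrightarrow> s \<le> 1 \<Longrightarrow> 0 < y \<Longrightarrow> z \<le> x - y \<Longrightarrow> (0::real) < y + (x - y - z) * s"
  by (simp add: add_pos_nonneg)

lemma F_cont [continuous_intros]:
  assumes "continuous_on S d" "continuous_on S s"
  shows "continuous_on S (\<lambda>u. F0 (d u) (s u))" "continuous_on S (\<lambda>u. F1 (d u) (s u))"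
    "continuous_on S (\<lambda>u. F2 (d u) (s u))"
  unfolding F0_def F1_def F2_def using q assms by (auto intro!: continuous_intros)

lemma g_arg_cont:
  "continuous_on (closure domH \<times> {0..1}) (\<lambda>u. g (snd (snd (fst u)))
     (fst (snd (fst u)) + (fst (fst u) - fst (snd (fst u)) - snd (snd (fst u))) * snd u))"
proof -
  have "continuous_on (closure domH \<times> {0..1}) (\<lambda>u. (\<lambda>(z, r). g z r) (snd (snd (fst u)),
     fst (snd (fst u)) + (fst (fst u) - fst (snd (fst u)) - snd (snd (fst u))) * snd u))"
    by (rule continuous_on_compose2[OF g_cont])
       (auto simp: closure_domH arg_nonneg intro!: continuous_intros)
  then show ?thesis by simp
qed

lemma g12_arg_cont:
  assumes "continuous_on ({0<..} \<times> {0<..}) (\<lambda>(z, r). h z r)"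
  shows "continuous_on (domH_diag \<times> {0..1}) (\<lambda>u. h (snd (snd (fst u)))
     (fst (snd (fst u)) + (fst (fst u) - fst (snd (fst u)) - snd (snd (fst u))) * snd u))"
proof -
  have "continuous_on (domH_diag \<times> {0..1}) (\<lambda>u. (\<lambda>(z, r). h z r) (snd (snd (fst u)),
     fst (snd (fst u)) + (fst (fst u) - fst (snd (fst u)) - snd (snd (fst u))) * snd u))"
    by (rule continuous_on_compose2[OF assms])
       (auto simp: domH_diag_def arg_pos intro!: continuous_intros)
  then show ?thesis by simp
qed

lemma domH_diag_subset_closure: "domH_diag \<subseteq> closure domH"
  by (auto simp: domH_diag_def closure_domH)

lemma i0_cont: "continuous_on (closure domH \<times> {0..1}) (\<lambda>(u, s). i0 (fst u) (fst (snd u)) (snd (snd u)) s)"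
  unfolding i0_def case_prod_unfold by (intro continuous_intros g_arg_cont)

lemma i_cont:
  "continuous_integrand i0"
  "continuous_integrand ix"
  "continuous_integrand iy"
  "continuous_integrand ixy"
proof -
  have g: "continuous_on (domH_diag \<times> {0..1}) (\<lambda>u. g (snd (snd (fst u)))
     (fst (snd (fst u)) + (fst (fst u) - fst (snd (fst u)) - snd (snd (fst u))) * snd u))"
    by (rule continuous_on_subset[OF g_arg_cont]) (use domH_diag_subset_closure in auto)
  note intros = continuous_intros g g12_arg_cont[OF g1_cont] g12_arg_cont[OF g2_cont]
  show "continuous_integrand i0"
    "continuous_integrand ix"
    "continuous_integrand iy"
    "continuous_integrand ixy"
    unfolding i0_def ix_def iy_def ixy_def case_prod_unfold by (intro intros)+
qed

lemma V_cont:
  "continuous3_on (closure domH) V"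
  "continuous3_on domH_diag Vx"
  "continuous3_on domH_diag Vy"
  "continuous3_on domH_diag Vxy"
proof -
  note wc = weighted_integral_continuous[OF beta_weight_integrable[OF q] beta_weight_nonneg]
  show "continuous3_on (closure domH) V"
    "continuous3_on domH_diag Vx"
    "continuous3_on domH_diag Vy"
    "continuous3_on domH_diag Vxy"
    using wc[OF i0_cont] wc[OF i_cont(2)] wc[OF i_cont(3)] wc[OF i_cont(4)]
    unfolding V_def Vx_def Vy_def Vxy_def case_prod_unfold by auto
qed

lemma V_diagonal:
  assumes "0 \<le> y" "y \<le> x"
  shows "V x y (x - y) = g (x - y) y * Beta q q"
  using integral_unique[OF has_integral_mult_left[OF beta_weight_has_integral[OF q], of "g (x - y) y"]] q
  by (simp add: V_def i0_def F0_def hyp0F1_zero mult.commute)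

lemma section_cont:
  assumes "continuous_integrand i"
    and "(x, y, z) \<in> domH_diag"
  shows "continuous_on {0..1} (i x y z :: real \<Rightarrow> real)"
proof -
  have "continuous_on {0..1} (\<lambda>s. (\<lambda>(u, s). i (fst u) (fst (snd u)) (snd (snd u)) s) ((x, y, z), s))"
    by (rule continuous_on_compose2[OF assms(1)]) (use assms(2) in \<open>auto intro!: continuous_intros\<close>)
  then show ?thesis by simp
qed

lemma param_deriv_x:
  assumes i: "continuous_integrand i"
    and j: "continuous_integrand j"
    and d: "\<And>x s. 0 < y \<Longrightarrow> 0 < z \<Longrightarrow> z < x - y \<Longrightarrow> 0 \<le> s \<Longrightarrow> s \<le> 1 \<Longrightarrow>
        ((\<lambda>t. i t y z s) has_real_derivative j x y z s) (at x)"
    and H: "(x, y, z) \<in> domH"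
  shows "((\<lambda>t. integral {0..1} (\<lambda>s. beta_weight q s * i t y z s)) has_real_derivative
           integral {0..1} (\<lambda>s. beta_weight q s * j x y z s)) (at x)"
proof (rule weighted_integral_deriv[where S = "{y + z<..}"])
  have "continuous_on ({y + z<..} \<times> {0..1}) (\<lambda>u. (\<lambda>(u, s). j (fst u) (fst (snd u)) (snd (snd u)) s) ((fst u, y, z), snd u))"
    by (rule continuous_on_compose2[OF j]) (use H in \<open>auto simp: domH_def domH_diag_def intro!: continuous_intros\<close>)
  then show "continuous_on ({y + z<..} \<times> {0..1}) (\<lambda>(t, s). j t y z s)" by (simp add: case_prod_unfold)
  show "continuous_on {0..1} (i t y z)" if "t \<in> {y + z<..}" for t
    by (rule section_cont[OF i]) (use that H in \<open>auto simp: domH_def domH_diag_def\<close>)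
qed (use H q d in \<open>auto simp: domH_def beta_weight_nonneg beta_weight_integrable\<close>)

lemma param_deriv_y:
  assumes i: "continuous_integrand i"
    and j: "continuous_integrand j"
    and d: "\<And>y s. 0 < y \<Longrightarrow> 0 < z \<Longrightarrow> z < x - y \<Longrightarrow> 0 \<le> s \<Longrightarrow> s \<le> 1 \<Longrightarrow>
        ((\<lambda>t. i x t z s) has_real_derivative j x y z s) (at y)"
    and H: "(x, y, z) \<in> domH"
  shows "((\<lambda>t. integral {0..1} (\<lambda>s. beta_weight q s * i x t z s)) has_real_derivative
           integral {0..1} (\<lambda>s. beta_weight q s * j x y z s)) (at y)"
proof (rule weighted_integral_deriv[where S = "{0<..<x - z}"])
  have "continuous_on ({0<..<x - z} \<times> {0..1}) (\<lambda>u. (\<lambda>(u, s). j (fst u) (fst (snd u)) (snd (snd u)) s) ((x, fst u, z), snd u))"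
    by (rule continuous_on_compose2[OF j]) (use H in \<open>auto simp: domH_def domH_diag_def intro!: continuous_intros\<close>)
  then show "continuous_on ({0<..<x - z} \<times> {0..1}) (\<lambda>(t, s). j x t z s)" by (simp add: case_prod_unfold)
  show "continuous_on {0..1} (i x t z)" if "t \<in> {0<..<x - z}" for t
    by (rule section_cont[OF i]) (use that H in \<open>auto simp: domH_def domH_diag_def\<close>)
qed (use H q d in \<open>auto simp: domH_def beta_weight_nonneg beta_weight_integrable\<close>)

lemma arg_deriv:
  shows "((\<lambda>t. y + (t - y - z) * s) has_real_derivative s) (at (x::real))"
    and "((\<lambda>t. t + (x - t - z) * s) has_real_derivative 1 - s) (at (y::real))"
    and "((\<lambda>t. t - y - z) has_real_derivative 1) (at (x::real))"
    and "((\<lambda>t. x - t - z) has_real_derivative - 1) (at (y::real))"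
  by (auto intro!: derivative_eq_intros)

lemma g_chain:
  assumes "0 < z" "0 < r t" "(r has_real_derivative r') (at t)"
  shows "((\<lambda>t. g z (r t)) has_real_derivative g1 z (r t) * r') (at t)"
    and "((\<lambda>t. g1 z (r t)) has_real_derivative g2 z (r t) * r') (at t)"
  by (rule DERIV_chain2[OF g_deriv assms(3)] DERIV_chain2[OF g1_deriv assms(3)]; use assms in simp)+

lemma V_derivs:
  assumes H: "(x, y, z) \<in> domH"
  shows "((\<lambda>t. V t y z) has_real_derivative Vx x y z) (at x)"
    and "((\<lambda>t. V x t z) has_real_derivative Vy x y z) (at y)"
    and "((\<lambda>t. Vy t y z) has_real_derivative Vxy x y z) (at x)"
proof -
  show "((\<lambda>t. V t y z) has_real_derivative Vx x y z) (at x)"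
    unfolding V_def Vx_def
  proof (rule param_deriv_x[OF i_cont(1,2) _ H])
    fix x s assume *: "0 < y" "0 < z" "z < x - y" "0 \<le> s" "s \<le> (1::real)"
    have "0 < y + (x - y - z) * s" by (rule arg_pos) (use * in auto)
    from DERIV_mult[OF g_chain(1)[OF *(2) this arg_deriv(1)] F_deriv(1)[OF arg_deriv(3) DERIV_const]]
    show "((\<lambda>t. i0 t y z s) has_real_derivative ix x y z s) (at x)"
      unfolding i0_def by (rule DERIV_cong) (simp add: ix_def algebra_simps)
  qed
  show "((\<lambda>t. V x t z) has_real_derivative Vy x y z) (at y)"
    unfolding V_def Vy_def
  proof (rule param_deriv_y[OF i_cont(1,3) _ H])
    fix y s assume *: "0 < y" "0 < z" "z < x - y" "0 \<le> s" "s \<le> (1::real)"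
    have "0 < y + (x - y - z) * s" by (rule arg_pos) (use * in auto)
    from DERIV_mult[OF g_chain(1)[OF *(2) this arg_deriv(2)] F_deriv(1)[OF arg_deriv(4) DERIV_const]]
    show "((\<lambda>t. i0 x t z s) has_real_derivative iy x y z s) (at y)"
      unfolding i0_def by (rule DERIV_cong) (simp add: iy_def algebra_simps)
  qed
  show "((\<lambda>t. Vy t y z) has_real_derivative Vxy x y z) (at x)"
    unfolding Vy_def Vxy_def
  proof (rule param_deriv_x[OF i_cont(3,4) _ H])
    fix x s assume *: "0 < y" "0 < z" "z < x - y" "0 \<le> s" "s \<le> (1::real)"
    have r: "0 < y + (x - y - z) * s" by (rule arg_pos) (use * in auto)
    note dg = g_chain[OF *(2) r arg_deriv(1)]
    note dF = F_deriv[OF arg_deriv(3)[of y z x] DERIV_const[of s]]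
    have lin: "((\<lambda>t. 2 * lam * (t - y - z) * (s * (1 - s))) has_real_derivative 2 * lam * (s * (1 - s))) (at x)"
      by (auto intro!: derivative_eq_intros)
    from DERIV_add[OF DERIV_mult[OF DERIV_cmult[OF dg(2), of "1 - s"] dF(1)]
        DERIV_mult[OF DERIV_mult[OF lin dg(1)] dF(2)]]
    show "((\<lambda>t. iy t y z s) has_real_derivative ixy x y z s) (at x)"
      unfolding iy_def by (rule DERIV_cong) (simp add: ixy_def algebra_simps power2_eq_square)
  qed
qed

text \<open>
  The defect of the equation is an exact derivative in \<open>s\<close>. The function \<open>G\<close> arises by integrating by
  parts twice: first to remove the second derivative of the data, then to remove the remaining first
  derivative multiplied by \<open>F1\<close>. What is left is \<open>g\<close> times the differential equation of \<open>hyp0F1\<close>. The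
  factor \<open>(s * (1 - s)) powr q\<close> makes \<open>G\<close> vanish at both ends because \<open>q > 0\<close>.
\<close>

lemma V_pde:
  assumes H: "(x, y, z) \<in> domH"
  shows "Vxy x y z = q / (x - y - z) * (Vx x y z - Vy x y z) + lam * V x y z"
proof -
  have h: "0 < z" "z < x - y" "0 < y" using H by (auto simp: domH_def)
  have Hz: "(x, y, z) \<in> domH_diag" using H domH_subset_domH_diag by auto
  define d where "d = x - y - z"
  have d: "d > 0" using h by (simp add: d_def)
  define r where "r = (\<lambda>s. y + d * s)"
  define G where "G = (\<lambda>s. (s * (1 - s)) powr q *
     (F0 d s * g1 z (r s) / d - lam * (1 - 2 * s) * F1 d s * g z (r s)))"
  have wi: "(\<lambda>s. beta_weight q s * i x y z s) integrable_on {0..1}"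
    if "continuous_integrand i" for i
    by (rule weighted_integrable[OF beta_weight_integrable[OF q] beta_weight_nonneg section_cont[OF that Hz]])
  have I1: "((\<lambda>s. beta_weight q s * ixy x y z s - q / d * (beta_weight q s * ix x y z s - beta_weight q s * iy x y z s)
      - lam * (beta_weight q s * i0 x y z s)) has_integral G 1 - G 0) {0..1}"
  proof (rule fundamental_theorem_of_calculus_interior)
    have c12: "continuous_on {0..1} (\<lambda>s. g z (r s))" "continuous_on {0..1} (\<lambda>s. g1 z (r s))"
    proof -
      have "continuous_on {0..1} (\<lambda>s. (\<lambda>(z, r). g z r) (z, r s))"
        by (rule continuous_on_compose2[OF g_cont]) (use h d in \<open>auto simp: r_def intro!: continuous_intros\<close>)
      moreover have "continuous_on {0..1} (\<lambda>s. (\<lambda>(z, r). g1 z r) (z, r s))"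
        by (rule continuous_on_compose2[OF g1_cont])
           (use h d in \<open>auto simp: r_def add_pos_nonneg intro!: continuous_intros\<close>)
      ultimately show "continuous_on {0..1} (\<lambda>s. g z (r s))" "continuous_on {0..1} (\<lambda>s. g1 z (r s))" by simp_all
    qed
    have c3: "continuous_on {0..1} (\<lambda>s::real. (s * (1 - s)) powr q)"
      by (intro continuous_on_powr' continuous_intros) (use q in auto)
    show "continuous_on {0..1} G"
      unfolding G_def
      by (intro continuous_on_mult continuous_on_diff continuous_on_divide F_cont continuous_on_const
          continuous_on_id c12 c3 ballI) (use d in auto)
  next
    fix s :: real assume s: "s \<in> {0<..<1}"
    define m where "m = s * (1 - s)"
    have m: "m > 0" using s by (simp add: m_def)
    have r: "r s > 0" using s d h by (simp add: r_def add_pos_pos)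
    have dr: "(r has_real_derivative d) (at s)"
      unfolding r_def by (auto intro!: derivative_eq_intros)
    note dg = g_chain[OF h(1) r dr]
    note dF = F_deriv[OF DERIV_const[of d] DERIV_ident]
    have dm: "((\<lambda>s. (s * (1 - s)) powr q) has_real_derivative q * m powr (q - 1) * (1 - 2 * s)) (at s)"
      using m unfolding m_def by (auto intro!: derivative_eq_intros simp: algebra_simps)
    have lin: "((\<lambda>s. lam * (1 - 2 * s)) has_real_derivative - 2 * lam) (at s)"
      by (auto intro!: derivative_eq_intros)
    define a0 a1 a2 f0 f1 f2 where "a0 = g z (r s)" and "a1 = g1 z (r s)" and "a2 = g2 z (r s)"
      and "f0 = F0 d s" and "f1 = F1 d s" and "f2 = F2 d s"
    note abbr = a0_def[symmetric] a1_def[symmetric] a2_def[symmetric] f0_def[symmetric] f1_def[symmetric] f2_def[symmetric]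
    have ode: "f0 = q * f1 - lam * d\<^sup>2 * m * f2" using F_ode[of d s] by (simp add: f0_def f1_def f2_def m_def)
    have mq: "m powr q = beta_weight q s * m"
      using m by (simp add: beta_weight_def m_def powr_diff)
    have "(G has_real_derivative
        q * m powr (q - 1) * (1 - 2 * s) * (f0 * a1 / d - lam * (1 - 2 * s) * f1 * a0)
        + (((f1 * (- lam * (2 * d * 0 * (s * (1 - s)) + d\<^sup>2 * (1 * (1 - 2 * s)))) * a1 + a2 * d * f0) / d)
          - (((- 2 * lam) * f1 + f2 * (- lam * (2 * d * 0 * (s * (1 - s)) + d\<^sup>2 * (1 * (1 - 2 * s)))) * (lam * (1 - 2 * s))) * a0
             + a1 * d * (lam * (1 - 2 * s) * f1))) * (s * (1 - s)) powr q) (at s)"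
      unfolding G_def a0_def a1_def a2_def f0_def f1_def f2_def
      by (intro DERIV_mult DERIV_diff DERIV_cdivide dm lin dF dg)
    moreover have "q * m powr (q - 1) * (1 - 2 * s) * (f0 * a1 / d - lam * (1 - 2 * s) * f1 * a0)
        + (((f1 * (- lam * (2 * d * 0 * (s * (1 - s)) + d\<^sup>2 * (1 * (1 - 2 * s)))) * a1 + a2 * d * f0) / d)
          - (((- 2 * lam) * f1 + f2 * (- lam * (2 * d * 0 * (s * (1 - s)) + d\<^sup>2 * (1 * (1 - 2 * s)))) * (lam * (1 - 2 * s))) * a0
             + a1 * d * (lam * (1 - 2 * s) * f1))) * (s * (1 - s)) powr q
      = beta_weight q s * ixy x y z s - q / d * (beta_weight q s * ix x y z s - beta_weight q s * iy x y z s)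
      - lam * (beta_weight q s * i0 x y z s)"
    proof -
      define B where "B = beta_weight q s"
      define e where "e = 1 / d"
      have e: "d * e = 1" using d by (simp add: e_def)
      have id: "i0 x y z s = a0 * f0" "ix x y z s = s * a1 * f0 - 2 * lam * d * m * a0 * f1"
         "iy x y z s = (1 - s) * a1 * f0 + 2 * lam * d * m * a0 * f1"
         "ixy x y z s = m * a2 * f0 - 2 * lam * d * m * (1 - 2 * s) * a1 * f1 + 2 * lam * m * a0 * f1
            - 4 * lam\<^sup>2 * d\<^sup>2 * m\<^sup>2 * a0 * f2"
        unfolding i0_def ix_def iy_def ixy_def a0_def a1_def a2_def f0_def f1_def f2_def m_def r_def d_def[symmetric]
        by (simp_all add: d_def)
      have div: "X / d = X * e" for X by (simp add: e_def)
      have mB: "m powr (q - 1) = B" by (simp add: B_def beta_weight_def m_def)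
      have "q * B * (1 - 2 * s) * (f0 * a1 * e - lam * (1 - 2 * s) * f1 * a0)
        + ((f1 * (- lam * (2 * d * 0 * m + d\<^sup>2 * (1 * (1 - 2 * s)))) * a1 + a2 * d * f0) * e
          - (((- 2 * lam) * f1 + f2 * (- lam * (2 * d * 0 * m + d\<^sup>2 * (1 * (1 - 2 * s)))) * (lam * (1 - 2 * s))) * a0
             + a1 * d * (lam * (1 - 2 * s) * f1))) * (B * m)
       = B * (m * a2 * f0 - 2 * lam * d * m * (1 - 2 * s) * a1 * f1 + 2 * lam * m * a0 * f1
            - 4 * lam\<^sup>2 * d\<^sup>2 * m\<^sup>2 * a0 * f2)
        - q * e * (B * (s * a1 * f0 - 2 * lam * d * m * a0 * f1) - B * ((1 - s) * a1 * f0 + 2 * lam * d * m * a0 * f1))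
        - lam * (B * (a0 * f0))"
        using ode e m_def by algebra
      then show ?thesis
        unfolding div id m_def[symmetric] mq mB B_def[symmetric] .
    qed
    ultimately show "(G has_vector_derivative
      beta_weight q s * ixy x y z s - q / d * (beta_weight q s * ix x y z s - beta_weight q s * iy x y z s)
      - lam * (beta_weight q s * i0 x y z s)) (at s)"
      by (simp add: has_real_derivative_iff_has_vector_derivative)
  qed simp
  have G0: "G 1 - G 0 = 0" using q by (simp add: G_def)
  have I2: "((\<lambda>s. beta_weight q s * ixy x y z s - q / d * (beta_weight q s * ix x y z s - beta_weight q s * iy x y z s)
      - lam * (beta_weight q s * i0 x y z s)) has_integral Vxy x y z - q / d * (Vx x y z - Vy x y z) - lam * V x y z) {0..1}"
    unfolding V_def Vx_def Vy_def Vxy_def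
    by (intro has_integral_diff has_integral_mult_right integrable_integral wi i_cont)
  from has_integral_unique[OF I2 I1] G0 show ?thesis by (simp add: d_def)
qed

end

section \<open>From the derivative in z to the solution\<close>

lemma closure_domD_superset: "0 \<le> y \<Longrightarrow> y \<le> x \<Longrightarrow> (x, y) \<in> closure domD"
proof -
  assume H: "0 \<le> y" "y \<le> x"
  have "((\<lambda>e. (x + 2 * e, y + e)) \<longlongrightarrow> (x + 2 * 0, y + 0)) (at_right 0)"
    by (intro tendsto_intros)
  moreover have "eventually (\<lambda>e. (x + 2 * e, y + e) \<in> domD) (at_right 0)"
    using H by (auto simp: domD_def eventually_at_right_field intro!: exI[of _ 1])
  then have "eventually (\<lambda>e. (x + 2 * e, y + e) \<in> closure domD) (at_right 0)"
    by (rule eventually_mono) (use closure_subset in blast)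
  ultimately have "(x + 2 * 0, y + 0) \<in> closure domD"
    by (intro Lim_in_closed_set[OF closed_closure _ trivial_limit_at_right_real])
  then show "(x, y) \<in> closure domD" by simp
qed

lemma has_integral_rescale_to_unit:
  fixes f :: "real \<Rightarrow> real"
  assumes "0 < d" "((\<lambda>s. f (y + d * s)) has_integral I) {0..1}"
  shows "(f has_integral d * I) {y..y + d}"
proof -
  have "((\<lambda>x. f (d *\<^sub>R x + y)) has_integral ((d * I) /\<^sub>R d ^ DIM(real)))
      (cbox ((y - y) /\<^sub>R d) ((y + d - y) /\<^sub>R d))"
    using assms by (simp add: add.commute mult.assoc[symmetric])
  from has_integral_affinity_iff[THEN iffD1, OF assms(1) this] show ?thesis by simp
qed

lemma integral_rescale_continuous:
  fixes f :: "real \<Rightarrow> real"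
  assumes "0 \<le> d" "continuous_on {y..y + d} f"
  shows "integral {y..y + d} f = d * integral {0..1} (\<lambda>s. f (y + d * s))"
proof (cases "d = 0")
  case False
  have "continuous_on {0..1} (\<lambda>s. f (y + d * s))"
    by (rule continuous_on_compose2[OF assms(2)]) (use assms(1) mult_left_le in \<open>auto intro!: continuous_intros\<close>)
  then have "((\<lambda>s. f (y + d * s)) has_integral integral {0..1} (\<lambda>s. f (y + d * s))) {0..1}"
    by (intro integrable_integral integrable_continuous_interval)
  from has_integral_rescale_to_unit[OF _ this] False assms(1) show ?thesis
    by (simp add: integral_unique)
qed simp

lemma deriv_transform_domH:
  assumes "\<And>x y z. (x, y, z) \<in> domH \<Longrightarrow> A x y z = B x y z" and H: "(x, y, z) \<in> domH"
  shows "((\<lambda>t. B t y z) has_real_derivative D) (at x) \<Longrightarrow> ((\<lambda>t. A t y z) has_real_derivative D) (at x)"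
    and "((\<lambda>t. B x t z) has_real_derivative D) (at y) \<Longrightarrow> ((\<lambda>t. A x t z) has_real_derivative D) (at y)"
proof -
  assume "((\<lambda>t. B t y z) has_real_derivative D) (at x)"
  then show "((\<lambda>t. A t y z) has_real_derivative D) (at x)"
    by (rule has_field_derivative_transform_within_open[of _ _ _ "{y + z<..}"])
       (use assms in \<open>auto simp: domH_def\<close>)
next
  assume "((\<lambda>t. B x t z) has_real_derivative D) (at y)"
  then show "((\<lambda>t. A x t z) has_real_derivative D) (at y)"
    by (rule has_field_derivative_transform_within_open[of _ _ _ "{0<..<x - z}"])
       (use assms in \<open>auto simp: domH_def\<close>)
qed

text \<open>
  The first boundary condition selects the primitive of \<open>W\<close> in \<open>z\<close>. Its continuity up to the boundary
  follows after rescaling the interval of integration to \<open>{0..1}\<close>.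
\<close>

lemma (in classical_z_derivative) solves_problem_C_from_z_derivative:
  assumes c\<tau>: "continuous_on (closure domD) (\<lambda>(x, y). \<tau> x y)"
    and cc: "continuous3_on (closure domH) W"
    and bd: "\<And>x y. 0 < y \<Longrightarrow> y < x \<Longrightarrow> W x y (x - y) = \<nu> x y"
    and limN: "\<And>x y. 0 < y \<Longrightarrow> y < x \<Longrightarrow>
       ((\<lambda>z. (x - y - z) powr (2 * p) * (Wx x y z - Wy x y z)) \<longlongrightarrow> \<mu> x y) (at_left (x - y))"
  shows "solves_problem_C p lam \<tau> \<nu> \<mu> (\<lambda>x y z. \<tau> x y - integral {z..x - y} (W x y))"
proof -
  define U where "U = (\<lambda>x y z. \<tau> x y - integral {z..x - y} (W x y))"
  have sec: "continuous_on {a..x - y} (W x y)" if "0 \<le> y" "0 \<le> a" for a x y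
    by (rule continuous_on_ternary_compose[OF cc])
       (use that in \<open>auto simp: closure_domH intro!: continuous_intros\<close>)
  have cU: "continuous3_on (closure domH) U"
  proof -
    have 1: "continuous_on (closure domH) (\<lambda>q. \<tau> (fst q) (fst (snd q)))"
    proof -
      have "continuous_on (closure domH) (\<lambda>q. (\<lambda>(x, y). \<tau> x y) (fst q, fst (snd q)))"
        by (rule continuous_on_compose2[OF c\<tau>])
           (auto simp: closure_domH intro!: continuous_intros closure_domD_superset)
      then show ?thesis by simp
    qed
    have "continuous_on (closure domH \<times> {0..1::real}) (\<lambda>u. (\<lambda>(x, y, z). W x y z) (fst (fst u), fst (snd (fst u)),
        snd (snd (fst u)) + (fst (fst u) - fst (snd (fst u)) - snd (snd (fst u))) * snd u))"
    proof (rule continuous_on_compose2[OF cc])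
      show "(\<lambda>u. (fst (fst u), fst (snd (fst u)),
        snd (snd (fst u)) + (fst (fst u) - fst (snd (fst u)) - snd (snd (fst u))) * snd u)) ` (closure domH \<times> {0..1::real}) \<subseteq> closure domH"
      proof (rule image_subsetI)
        fix u :: "(real \<times> real \<times> real) \<times> real" assume "u \<in> closure domH \<times> {0..1}"
        then obtain x y z t where u: "u = ((x, y, z), t)" and h: "0 \<le> z" "z \<le> x - y" "0 \<le> y" "0 \<le> t" "t \<le> 1"
          by (cases u) (auto simp: closure_domH)
        have "(x - y - z) * t \<le> x - y - z" "0 \<le> (x - y - z) * t"
          using h by (simp_all add: mult_left_le)
        then show "(fst (fst u), fst (snd (fst u)),
            snd (snd (fst u)) + (fst (fst u) - fst (snd (fst u)) - snd (snd (fst u))) * snd u) \<in> closure domH"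
          using h by (simp add: u closure_domH)
      qed
    qed (intro continuous_intros)
    then have "continuous_on (closure domH) (\<lambda>q. integral (cbox 0 1) (\<lambda>t. W (fst q) (fst (snd q))
        (snd (snd q) + (fst q - fst (snd q) - snd (snd q)) * t)))"
      by (intro integral_continuous_on_param) (simp add: case_prod_unfold)
    then have "continuous_on (closure domH) (\<lambda>q. \<tau> (fst q) (fst (snd q)) - (fst q - fst (snd q) - snd (snd q)) *
        integral {0..1} (\<lambda>t. W (fst q) (fst (snd q)) (snd (snd q) + (fst q - fst (snd q) - snd (snd q)) * t)))"
      using 1 by (intro continuous_intros) simp_all
    moreover have "U x y z = \<tau> x y - (x - y - z) * integral {0..1} (\<lambda>t. W x y (z + (x - y - z) * t))"
      if "(x, y, z) \<in> closure domH" for x y z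
      using integral_rescale_continuous[of "x - y - z" z "W x y"] sec[of y z x] that
      by (simp add: closure_domH U_def)
    ultimately show ?thesis by (subst continuous_on_cong[OF refl]) auto
  qed
  have dU: "((\<lambda>t. U x y t) has_real_derivative W x y z) (at z)" if "(x, y, z) \<in> domH" for x y z
  proof -
    have h: "0 < z" "z < x - y" "0 < y" using that by (auto simp: domH_def)
    have "((\<lambda>t. integral {t..x - y} (W x y)) has_real_derivative - W x y z) (at z within {0..x - y})"
      by (rule integral_has_real_derivative') (use h sec in auto)
    then have "((\<lambda>t. integral {t..x - y} (W x y)) has_real_derivative - W x y z) (at z)"
      using h at_within_Icc_at[of 0 z "x - y"] by simp
    from DERIV_diff[OF DERIV_const[of "\<tau> x y"] this] show ?thesis by (simp add: U_def)
  qed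
  have pz: "pdz3 U x y z = W x y z" if "(x, y, z) \<in> domH" for x y z
    unfolding pdz3_def by (rule DERIV_imp_deriv[OF dU[OF that]])
  have Dx: "((\<lambda>t. pdz3 U t y z) has_real_derivative Wx x y z) (at x)" if "(x, y, z) \<in> domH" for x y z
    by (rule deriv_transform_domH(1)[where A = "pdz3 U" and B = W, OF pz that dx[OF that]])
  have Dy: "((\<lambda>t. pdz3 U x t z) has_real_derivative Wy x y z) (at y)" if "(x, y, z) \<in> domH" for x y z
    by (rule deriv_transform_domH(2)[where A = "pdz3 U" and B = W, OF pz that dy[OF that]])
  have px: "pdx3 (pdz3 U) x y z = Wx x y z" if "(x, y, z) \<in> domH" for x y z
    unfolding pdx3_def by (rule DERIV_imp_deriv[OF Dx[OF that]])
  have py: "pdy3 (pdz3 U) x y z = Wy x y z" if "(x, y, z) \<in> domH" for x y z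
    unfolding pdy3_def by (rule DERIV_imp_deriv[OF Dy[OF that]])
  have Dxy: "((\<lambda>t. pdy3 (pdz3 U) t y z) has_real_derivative Wxy x y z) (at x)" if "(x, y, z) \<in> domH" for x y z
    by (rule deriv_transform_domH(1)[where A = "pdy3 (pdz3 U)" and B = Wy, OF py that dxy[OF that]])
  have pxy: "pdx3 (pdy3 (pdz3 U)) x y z = Wxy x y z" if "(x, y, z) \<in> domH" for x y z
    unfolding pdx3_def[of "pdy3 (pdz3 U)"] by (rule DERIV_imp_deriv[OF Dxy[OF that]])
  have cong: "continuous3_on domH A"
    if "\<And>x y z. (x, y, z) \<in> domH \<Longrightarrow> A x y z = B x y z" "continuous3_on domH B"
    for A B :: "real \<Rightarrow> real \<Rightarrow> real \<Rightarrow> real"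
    by (rule continuous_on_eq[OF that(2)]) (use that(1) in auto)
  have reg: "classical_regularity U"
    unfolding classical_regularity_def
  proof (intro conjI)
    show "has_pdz3 U" unfolding has_pdz3_def field_differentiable_def
      by (clarify, rule exI, rule dU)
    show "has_pdx3 (pdz3 U)" unfolding has_pdx3_def field_differentiable_def
      by (clarify, rule exI, rule Dx)
    show "has_pdy3 (pdz3 U)" unfolding has_pdy3_def field_differentiable_def
      by (clarify, rule exI, rule Dy)
    show "has_pdx3 (pdy3 (pdz3 U))" unfolding has_pdx3_def field_differentiable_def
      by (clarify, rule exI, rule Dxy)
    show "continuous3_on domH (pdz3 U)"
      by (rule cong[where A = "pdz3 U" and B = W, OF pz c])
    show "continuous3_on domH (pdx3 (pdz3 U))" by (rule cong[where A = "pdx3 (pdz3 U)" and B = Wx, OF px cx])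
    show "continuous3_on domH (pdy3 (pdz3 U))" by (rule cong[where A = "pdy3 (pdz3 U)" and B = Wy, OF py cy])
    show "continuous3_on domH (pdx3 (pdy3 (pdz3 U)))" by (rule cong[where A = "pdx3 (pdy3 (pdz3 U))" and B = Wxy, OF pxy cxy])
  qed
  have ev: "eventually (\<lambda>z. (x, y, z) \<in> domH) (at_left (x - y))" if "0 < y" "y < x" for x y
    unfolding eventually_at_left_field using that by (intro exI[of _ 0]) (auto simp: domH_def)
  show ?thesis
    unfolding solves_problem_C_def U_def[symmetric]
  proof (intro conjI ballI allI impI cU reg)
    show "case q of (x, y, z) \<Rightarrow> pdx3 (pdy3 (pdz3 U)) x y z - p / (x - y - z) * pdx3 (pdz3 U) x y z
        + p / (x - y - z) * pdy3 (pdz3 U) x y z - lam * pdz3 U x y z = 0" if "q \<in> domH" for q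
      using that by (auto simp: pz px py pxy pde right_diff_distrib)
    show "U x y (x - y) = \<tau> x y" if "0 \<le> y \<and> y \<le> x" for x y by (simp add: U_def)
    fix x y :: real assume xy: "0 < y \<and> y < x"
    have "(W x y \<longlongrightarrow> W x y (x - y)) (at (x - y) within {0..x - y})"
      using sec[of y 0 x] xy by (auto simp: continuous_on_def)
    then have "(W x y \<longlongrightarrow> \<nu> x y) (at_left (x - y))"
      using xy bd at_within_Icc_at_left[of 0 "x - y"] by simp
    then show "((\<lambda>z. pdz3 U x y z) \<longlongrightarrow> \<nu> x y) (at_left (x - y))"
      by (rule Lim_transform_eventually) (rule eventually_mono[OF ev], use xy pz in auto)
    have "((\<lambda>z. (x - y - z) powr (2 * p) * (Wx x y z - Wy x y z)) \<longlongrightarrow> \<mu> x y) (at_left (x - y))"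
      by (rule limN) (use xy in auto)
    then show "((\<lambda>z. (x - y - z) powr (2 * p) * (pdx3 (pdz3 U) x y z - pdy3 (pdz3 U) x y z)) \<longlongrightarrow> \<mu> x y) (at_left (x - y))"
      by (rule Lim_transform_eventually) (rule eventually_mono[OF ev], use xy px py in auto)
  qed
qed

lemma cont_ext_D_continuous_on:
  assumes "cont_ext_D f"
  shows "continuous_on domD (\<lambda>(x, y). f x y)"
proof -
  obtain g where g: "continuous_on (closure domD) g" "\<forall>(x, y)\<in>domD. g (x, y) = f x y"
    using assms by (auto simp: cont_ext_D_def)
  show ?thesis
    by (rule continuous_on_eq[OF continuous_on_subset[OF g(1) closure_subset]]) (use g(2) in auto)
qed

text \<open>
  The kernels only ever differentiate the data along the diagonal direction, so the first and second
  derivatives of \<open>r \<mapsto> f (z + r) r\<close> are sums of partial derivatives of \<open>f\<close>.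
\<close>

lemma diagonal_kernel_of_C2:
  assumes f: "Ck_closed_D 2 f" and q: "0 < q"
  shows "\<exists>g1 g2. diagonal_kernel q (\<lambda>z r. f (z + r) r) g1 g2"
proof -
  have s: "continuous_on (closure domD) (\<lambda>(x, y). f x y)"
    "has_pdx2 f" "has_pdy2 f" "has_pdx2 (pdx2 f)" "has_pdy2 (pdx2 f)" "has_pdx2 (pdy2 f)" "has_pdy2 (pdy2 f)"
    "cont_ext_D (pdx2 f)" "cont_ext_D (pdy2 f)" "cont_ext_D (pdx2 (pdx2 f))" "cont_ext_D (pdy2 (pdx2 f))"
    "cont_ext_D (pdx2 (pdy2 f))" "cont_ext_D (pdy2 (pdy2 f))"
    using f by (simp_all add: Ck_closed_D_def numeral_2_eq_2)
  have dx: "((\<lambda>t. h t y) has_real_derivative pdx2 h x y) (at x)" if "has_pdx2 h" "0 < y" "y < x" for h x y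
    using that by (auto simp: has_pdx2_def pdx2_def domD_def DERIV_deriv_iff_field_differentiable)
  have dy: "((\<lambda>t. h x t) has_real_derivative pdy2 h x y) (at y)" if "has_pdy2 h" "0 < y" "y < x" for h x y
    using that by (auto simp: has_pdy2_def pdy2_def domD_def DERIV_deriv_iff_field_differentiable)
  have diag: "((\<lambda>r. h (z + r) r) has_real_derivative pdx2 h (z + r) r + pdy2 h (z + r) r) (at r)"
    if "has_pdx2 h" "has_pdy2 h" "cont_ext_D (pdy2 h)" "0 < z" "0 < r" for h z r
    using deriv_along_diagonal[OF dx[OF that(1)] dy[OF that(2)] cont_ext_D_continuous_on[OF that(3)], of 0 r z] that by simp
  have cont: "continuous_on ({0<..} \<times> {0<..}) (\<lambda>u. h (fst u + snd u) (snd u))"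
    if "cont_ext_D h" for h
    by (rule continuous_on_binary_compose[OF cont_ext_D_continuous_on[OF that]])
       (auto simp: domD_def intro!: continuous_intros)
  have cont0: "continuous_on ({0..} \<times> {0..}) (\<lambda>u. f (fst u + snd u) (snd u))"
    by (rule continuous_on_binary_compose[OF s(1)])
       (auto intro!: continuous_intros closure_domD_superset)
  have "diagonal_kernel q (\<lambda>z r. f (z + r) r) (\<lambda>z r. pdx2 f (z + r) r + pdy2 f (z + r) r)
      (\<lambda>z r. (pdx2 (pdx2 f) (z + r) r + pdy2 (pdx2 f) (z + r) r) + (pdx2 (pdy2 f) (z + r) r + pdy2 (pdy2 f) (z + r) r))"
  proof
    show "continuous_on ({0..} \<times> {0..}) (\<lambda>(z, r). f (z + r) r)" using cont0 by (simp add: case_prod_unfold)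
    show "continuous_on ({0<..} \<times> {0<..}) (\<lambda>(z, r). pdx2 f (z + r) r + pdy2 f (z + r) r)"
      unfolding case_prod_unfold by (intro continuous_on_add cont s)
    show "continuous_on ({0<..} \<times> {0<..}) (\<lambda>(z, r). (pdx2 (pdx2 f) (z + r) r + pdy2 (pdx2 f) (z + r) r)
        + (pdx2 (pdy2 f) (z + r) r + pdy2 (pdy2 f) (z + r) r))"
      unfolding case_prod_unfold by (intro continuous_on_add cont s)
  qed (intro q DERIV_add diag s | assumption)+
  then show ?thesis by blast
qed

section \<open>Fubini on a triangle with boundary singularities\<close>

lemma truncated_powr_integrable:
  assumes "0 < q" "0 \<le> L"
  shows "integrable lborel (\<lambda>u. indicator {0..L} u * u powr (q - 1) :: real)"
proof -
  have "((\<lambda>u. u powr (q - 1)) has_integral L powr (q - 1 + 1) / (q - 1 + 1)) {0..L}"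
    by (rule has_integral_powr_from_0) (use assms in auto)
  then have "((\<lambda>u. if u \<in> {0..L} then u powr (q - 1) else 0) has_integral L powr (q - 1 + 1) / (q - 1 + 1)) UNIV"
    by (simp only: has_integral_restrict_UNIV)
  then have I: "((\<lambda>u. indicator {0..L} u * u powr (q - 1)) has_integral L powr (q - 1 + 1) / (q - 1 + 1)) UNIV"
    by (rule has_integral_eq[rotated]) (auto simp: indicator_def)
  have m: "(\<lambda>u. indicator {0..L} u * u powr (q - 1) :: real) \<in> borel_measurable borel" by measurable
  show ?thesis
    by (rule integrableI_nn_integral_finite[OF _ _ nn_integral_has_integral_lborel[OF m _ I]]) (use m in auto)
qed

text \<open>
  Fubini's theorem on a triangle. The integrand is dominated by a multiple of
  \<open>B (s - y0) * B (x0 - r - s)\<close>, whose two factors separate after a reflection and a translation in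
  \<open>r\<close>. Every section is integrable, not merely almost every one: on a section of
  length \<open>l > 0\<close> one of the two factors stays below \<open>(l / 2) powr (q - 1)\<close>. The gauge integrals of the
  statement therefore agree with Lebesgue integrals section by section.
\<close>

lemma triangle_Fubini:
  fixes G :: "real \<Rightarrow> real \<Rightarrow> real"
  assumes q: "0 < q" "q < 1" and ord: "y0 + z0 \<le> x0"
    and G: "continuous_on {(r, s). z0 \<le> r \<and> y0 \<le> s \<and> r + s \<le> x0} (\<lambda>(r, s). G r s)"
  shows "integral {z0..x0 - y0} (\<lambda>r. integral {y0..x0 - r} (\<lambda>s. (s - y0) powr (q - 1) * (x0 - r - s) powr (q - 1) * G r s))
       = integral {y0..x0 - z0} (\<lambda>s. integral {z0..x0 - s} (\<lambda>r. (s - y0) powr (q - 1) * (x0 - r - s) powr (q - 1) * G r s))"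
proof -
  define T where "T = {(r, s). z0 \<le> r \<and> y0 \<le> s \<and> r + s \<le> x0}"
  define L where "L = x0 - y0 - z0"
  have L: "0 \<le> L" using ord by (simp add: L_def)
  define B where "B = (\<lambda>u. indicator {0..L} u * u powr (q - 1) :: real)"
  have B0: "0 \<le> B u" for u by (simp add: B_def)
  have Bint: "integrable lborel B" unfolding B_def by (rule truncated_powr_integrable[OF q(1) L])
  have Bm[measurable]: "B \<in> borel_measurable borel" unfolding B_def by measurable
  have Bshift: "integrable lborel (\<lambda>s. B (s - c))" for c
    using lborel_integrable_real_affine[OF Bint, of 1 "-c"] by (simp add: add.commute)
  have Brefl: "integrable lborel (\<lambda>s. B (c - s))" for c
    using lborel_integrable_real_affine[OF Bint, of "-1" c] by simp
  define f where "f = (\<lambda>r s. indicator T (r, s) * G r s * (B (s - y0) * B (x0 - r - s)))"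
  have "T = ({q. z0 \<le> fst q} \<inter> {q. y0 \<le> snd q} \<inter> {q. fst q + snd q \<le> x0})" by (auto simp: T_def)
  moreover have "closed ({q :: real \<times> real. z0 \<le> fst q} \<inter> {q. y0 \<le> snd q} \<inter> {q. fst q + snd q \<le> x0})"
    by (intro closed_Int closed_Collect_le continuous_intros)
  ultimately have closedT: "closed T" by simp
  have "T \<subseteq> cbox (z0, y0) (x0 - y0, x0 - z0)" by (auto simp: T_def)
  then have compT: "compact T" using closedT compact_eq_bounded_closed bounded_subset bounded_cbox by blast
  have GT: "continuous_on T (\<lambda>(r, s). G r s)" using G by (simp add: T_def)
  obtain C where C: "\<And>u. u \<in> (\<lambda>(r, s). G r s) ` T \<Longrightarrow> norm u \<le> C"
    using compact_imp_bounded[OF compact_continuous_image[OF GT compT]] unfolding bounded_iff by blast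
  have C': "\<bar>indicator T (r, s) * G r s\<bar> \<le> max C 0" for r s
    using C[of "G r s"] by (cases "(r, s) \<in> T") (force intro: max.coboundedI1)+
  define D where "D = max C 0"
  have fb: "norm (f r s) \<le> norm (D * (B (s - y0) * B (x0 - r - s)))" for r s
    using mult_right_mono[OF C'[of r s], of "B (s - y0) * B (x0 - r - s)"] B0
    by (simp add: f_def D_def abs_mult)
  have Gm: "(\<lambda>q. indicator T q *\<^sub>R (case q of (r, s) \<Rightarrow> G r s)) \<in> borel_measurable borel"
    by (rule borel_measurable_continuous_on_indicator[OF _ GT]) (use closedT in auto)
  have Bc: "(\<lambda>q. B (h q)) \<in> borel_measurable borel" if "continuous_on UNIV h" for h :: "real \<times> real \<Rightarrow> real"
    by (rule measurable_compose[OF borel_measurable_continuous_onI[OF that] Bm])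
  have fm: "case_prod f \<in> borel_measurable (lborel \<Otimes>\<^sub>M lborel)"
  proof -
    have "(\<lambda>q. (indicator T q *\<^sub>R (case q of (r, s) \<Rightarrow> G r s)) * (B (snd q - y0) * B (x0 - fst q - snd q)))
       \<in> borel_measurable (borel :: (real \<times> real) measure)"
      by (intro borel_measurable_times Gm Bc continuous_intros)
    then show ?thesis
      by (simp add: f_def case_prod_unfold lborel_prod)
  qed
  have dom: "integrable (lborel \<Otimes>\<^sub>M lborel) (\<lambda>(r, s). D * (B (s - y0) * B (x0 - r - s)))"
  proof -
    have sw: "integrable (lborel \<Otimes>\<^sub>M lborel) (\<lambda>(s, r). D * (B (s - y0) * B (x0 - r - s)))"
    proof (rule lborel_pair.Fubini_integrable)
      have "(\<lambda>q. D * (B (fst q - y0) * B (x0 - snd q - fst q))) \<in> borel_measurable borel"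
        by (intro borel_measurable_times borel_measurable_const Bc continuous_intros)
      then show "(\<lambda>(s, r). D * (B (s - y0) * B (x0 - r - s))) \<in> borel_measurable (lborel \<Otimes>\<^sub>M lborel)"
        by (simp add: case_prod_unfold lborel_prod)
      have "(\<integral>r. norm (D * (B (s - y0) * B (x0 - r - s))) \<partial>lborel) = D * B (s - y0) * (\<integral>r. B r \<partial>lborel)" for s
      proof -
        have "(\<integral>r. norm (D * (B (s - y0) * B (x0 - r - s))) \<partial>lborel) = (\<integral>r. D * B (s - y0) * B ((x0 - s) + (-1) * r) \<partial>lborel)"
          using B0 by (intro Bochner_Integration.integral_cong) (auto simp: abs_mult D_def algebra_simps)
        also have "\<dots> = D * B (s - y0) * (\<integral>r. B ((x0 - s) + (-1) * r) \<partial>lborel)" by simp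
        also have "(\<integral>r. B ((x0 - s) + (-1) * r) \<partial>lborel) = (\<integral>r. B r \<partial>lborel)"
          using lborel_integral_real_affine[of "-1" B "x0 - s"] by simp
        finally show ?thesis .
      qed
      then show "integrable lborel (\<lambda>s. \<integral>r. norm (case (s, r) of (s, r) \<Rightarrow> D * (B (s - y0) * B (x0 - r - s))) \<partial>lborel)"
        using Bshift by simp
      show "AE s in lborel. integrable lborel (\<lambda>r. case (s, r) of (s, r) \<Rightarrow> D * (B (s - y0) * B (x0 - r - s)))"
      proof (rule AE_I2)
        fix s :: real
        have "integrable lborel (\<lambda>r. B (x0 - s - r))" by (rule Brefl)
        then have "integrable lborel (\<lambda>r. B (x0 - r - s))" by (simp add: algebra_simps)
        then show "integrable lborel (\<lambda>r. case (s, r) of (s, r) \<Rightarrow> D * (B (s - y0) * B (x0 - r - s)))" by simp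
      qed
    qed
    from lborel_pair.integrable_product_swap[OF this] show ?thesis by (simp add: case_prod_unfold)
  qed
  have fint: "integrable (lborel \<Otimes>\<^sub>M lborel) (case_prod f)"
    by (rule Bochner_Integration.integrable_bound[OF dom fm]) (use fb in auto)
  have sec2: "integrable lborel (\<lambda>r. f r s)" for s
  proof (rule Bochner_Integration.integrable_bound)
    have "integrable lborel (\<lambda>r. B (x0 - s - r))" by (rule Brefl)
    then have "integrable lborel (\<lambda>r. B (x0 - r - s))" by (simp add: algebra_simps)
    then show "integrable lborel (\<lambda>r. D * (B (s - y0) * B (x0 - r - s)))" by simp
    show "(\<lambda>r. f r s) \<in> borel_measurable lborel"
      using measurable_compose[OF measurable_Pair1'[of s lborel lborel] measurable_pair_swap[OF fm]] by (simp add: case_prod_unfold)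
    show "AE r in lborel. norm (f r s) \<le> norm (D * (B (s - y0) * B (x0 - r - s)))" using fb by simp
  qed
  have sec1: "integrable lborel (\<lambda>s. f r s)" for r
  proof (cases "x0 - r - y0 > 0")
    case True
    define l where "l = x0 - r - y0"
    show ?thesis
    proof (rule Bochner_Integration.integrable_bound)
      have "integrable lborel (\<lambda>s. B (x0 - r - s))" by (rule Brefl)
      then show "integrable lborel (\<lambda>s. D * ((l / 2) powr (q - 1) * (B (s - y0) + B (x0 - r - s))))"
        using Bshift by simp
      show "(\<lambda>s. f r s) \<in> borel_measurable lborel"
        using measurable_compose[OF measurable_Pair1'[of r lborel lborel] fm] by simp
      \<comment> \<open>one of \<open>u\<close> and \<open>v\<close> is at least \<open>l / 2\<close>, and \<open>B\<close> is decreasing where it is positive\<close>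
      have "B u * B v \<le> (l / 2) powr (q - 1) * (B u + B v)" if "u + v = l" for u v
      proof (cases "l / 2 \<le> u")
        case u: True
        have "B u \<le> 1 * (l / 2) powr (q - 1)" unfolding B_def
          using u True q by (intro mult_mono powr_mono2') (auto simp: l_def indicator_def)
        then have "B u * B v \<le> (l / 2) powr (q - 1) * B v" using B0 by (intro mult_right_mono) auto
        also have "\<dots> \<le> (l / 2) powr (q - 1) * (B u + B v)" using B0 by (intro mult_left_mono) auto
        finally show ?thesis .
      next
        case u: False
        then have "l / 2 \<le> v" using that by simp
        then have "B v \<le> 1 * (l / 2) powr (q - 1)" unfolding B_def
          using True q by (intro mult_mono powr_mono2') (auto simp: l_def indicator_def)
        then have "B u * B v \<le> B u * (l / 2) powr (q - 1)" using B0 by (intro mult_left_mono) auto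
        also have "\<dots> \<le> (B u + B v) * (l / 2) powr (q - 1)" using B0 by (intro mult_right_mono) auto
        finally show ?thesis by (simp add: mult.commute)
      qed
      from this[of "_ - y0" "x0 - r - _"]
      have "B (s - y0) * B (x0 - r - s) \<le> (l / 2) powr (q - 1) * (B (s - y0) + B (x0 - r - s))" for s
        by (simp add: l_def)
      then have "norm (D * (B (s - y0) * B (x0 - r - s))) \<le> norm (D * ((l / 2) powr (q - 1) * (B (s - y0) + B (x0 - r - s))))" for s
        using B0 by (auto simp: abs_mult D_def intro!: mult_left_mono)
      then show "AE s in lborel. norm (f r s) \<le> norm (D * ((l / 2) powr (q - 1) * (B (s - y0) + B (x0 - r - s))))"
        using fb order_trans by blast
    qed
  next
    case False
    have "f r s = 0" for s
    proof (cases "(r, s) \<in> T")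
      case True
      \<comment> \<open>the section is a single point, where the power of zero has the value zero\<close>
      then have "s = y0" using False by (auto simp: T_def)
      then show ?thesis by (simp add: f_def B_def)
    qed (simp add: f_def)
    then show ?thesis by simp
  qed
  have eq1: "(\<integral>s. f r s \<partial>lborel) = (if r \<in> {z0..x0 - y0} then integral {y0..x0 - r} (\<lambda>s. (s - y0) powr (q - 1) * (x0 - r - s) powr (q - 1) * G r s) else 0)" for r
  proof (cases "r \<in> {z0..x0 - y0}")
    case True
    have "f r = (\<lambda>s. if s \<in> {y0..x0 - r} then (s - y0) powr (q - 1) * (x0 - r - s) powr (q - 1) * G r s else 0)"
      using True by (intro ext) (auto simp: f_def T_def B_def L_def indicator_def)
    then have "integral UNIV (f r) = integral {y0..x0 - r} (\<lambda>s. (s - y0) powr (q - 1) * (x0 - r - s) powr (q - 1) * G r s)"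
      by (simp only: integral_restrict_UNIV)
    then show ?thesis using integral_lborel[OF sec1[of r]] True by simp
  next
    case False
    then have "f r s = 0" for s by (auto simp: f_def T_def indicator_def)
    then show ?thesis using False by (simp del: atLeastAtMost_iff)
  qed
  have eq2: "(\<integral>r. f r s \<partial>lborel) = (if s \<in> {y0..x0 - z0} then integral {z0..x0 - s} (\<lambda>r. (s - y0) powr (q - 1) * (x0 - r - s) powr (q - 1) * G r s) else 0)" for s
  proof (cases "s \<in> {y0..x0 - z0}")
    case True
    have "(\<lambda>r. f r s) = (\<lambda>r. if r \<in> {z0..x0 - s} then (s - y0) powr (q - 1) * (x0 - r - s) powr (q - 1) * G r s else 0)"
      using True by (intro ext) (auto simp: f_def T_def B_def L_def indicator_def)
    then have "integral UNIV (\<lambda>r. f r s) = integral {z0..x0 - s} (\<lambda>r. (s - y0) powr (q - 1) * (x0 - r - s) powr (q - 1) * G r s)"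
      by (simp only: integral_restrict_UNIV)
    then show ?thesis using integral_lborel[OF sec2[of s]] True by simp
  next
    case False
    then have "f r s = 0" for r by (auto simp: f_def T_def indicator_def)
    then show ?thesis using False by (simp del: atLeastAtMost_iff)
  qed
  have "integral {z0..x0 - y0} (\<lambda>r. integral {y0..x0 - r} (\<lambda>s. (s - y0) powr (q - 1) * (x0 - r - s) powr (q - 1) * G r s))
     = integral UNIV (\<lambda>r. \<integral>s. f r s \<partial>lborel)"
    unfolding eq1 by (simp only: integral_restrict_UNIV)
  also have "\<dots> = (\<integral>r. (\<integral>s. f r s \<partial>lborel) \<partial>lborel)"
    using lborel_pair.integrable_fst[OF fint] by (intro integral_lborel) simp
  also have "\<dots> = (\<integral>s. (\<integral>r. f r s \<partial>lborel) \<partial>lborel)"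
    using lborel_pair.Fubini_integral[OF fint] by simp
  also have "\<dots> = integral UNIV (\<lambda>s. \<integral>r. f r s \<partial>lborel)"
    using lborel_pair.integrable_snd[OF fint] by (intro integral_lborel[symmetric]) simp
  also have "\<dots> = integral {y0..x0 - z0} (\<lambda>s. integral {z0..x0 - s} (\<lambda>r. (s - y0) powr (q - 1) * (x0 - r - s) powr (q - 1) * G r s))"
    unfolding eq2 by (simp only: integral_restrict_UNIV)
  finally show ?thesis .
qed

section \<open>The conjugate solution and the double integrals\<close>

context diagonal_kernel
begin

text \<open>
  The power \<open>(x - y - z) powr (2 * q - 1)\<close> intertwines the equations with exponents \<open>q\<close> and \<open>1 - q\<close>. With
  \<open>q = 1 - p\<close> it turns \<open>V\<close> into the second solution for the exponent \<open>p\<close>, which vanishes on the diagonal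
  and carries the weighted normal derivative.
\<close>

definition Y :: "real \<Rightarrow> real \<Rightarrow> real \<Rightarrow> real" where
  "Y x y z = (x - y - z) powr (2 * q - 1) * V x y z"
definition Yx :: "real \<Rightarrow> real \<Rightarrow> real \<Rightarrow> real" where
  "Yx x y z = (x - y - z) powr (2 * q - 1) * Vx x y z + (2 * q - 1) * (x - y - z) powr (2 * q - 2) * V x y z"
definition Yy :: "real \<Rightarrow> real \<Rightarrow> real \<Rightarrow> real" where
  "Yy x y z = (x - y - z) powr (2 * q - 1) * Vy x y z - (2 * q - 1) * (x - y - z) powr (2 * q - 2) * V x y z"
definition Yxy :: "real \<Rightarrow> real \<Rightarrow> real \<Rightarrow> real" where
  "Yxy x y z = (x - y - z) powr (2 * q - 1) * Vxy x y z
     + (2 * q - 1) * (x - y - z) powr (2 * q - 2) * (Vy x y z - Vx x y z)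
     - (2 * q - 1) * (2 * q - 2) * (x - y - z) powr (2 * q - 3) * V x y z"

lemma powr_derivs:
  assumes "0 < x - y - z"
  shows "((\<lambda>t. (t - y - z) powr e) has_real_derivative e * (x - y - z) powr (e - 1)) (at (x::real))"
    and "((\<lambda>t. (x - t - z) powr e) has_real_derivative - (e * (x - y - z) powr (e - 1))) (at y)"
  using assms by (auto intro!: derivative_eq_intros)

lemma Y_derivs:
  assumes H: "(x, y, z) \<in> domH"
  shows "((\<lambda>t. Y t y z) has_real_derivative Yx x y z) (at x)"
    and "((\<lambda>t. Y x t z) has_real_derivative Yy x y z) (at y)"
    and "((\<lambda>t. Yy t y z) has_real_derivative Yxy x y z) (at x)"
proof -
  have d: "0 < x - y - z" using H by (auto simp: domH_def)
  have e: "2 * q - 1 - 1 = 2 * q - 2" "2 * q - 2 - 1 = 2 * q - 3" by auto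
  note D = powr_derivs[OF d, of "2 * q - 1", unfolded e] powr_derivs(1)[OF d, of "2 * q - 2", unfolded e]
  show "((\<lambda>t. Y t y z) has_real_derivative Yx x y z) (at x)"
    unfolding Y_def Yx_def
    by (rule DERIV_cong[OF DERIV_mult[OF D(1) V_derivs(1)[OF H]]]) (simp add: algebra_simps)
  show "((\<lambda>t. Y x t z) has_real_derivative Yy x y z) (at y)"
    unfolding Y_def Yy_def
    by (rule DERIV_cong[OF DERIV_mult[OF D(2) V_derivs(2)[OF H]]]) (simp add: algebra_simps)
  show "((\<lambda>t. Yy t y z) has_real_derivative Yxy x y z) (at x)"
    unfolding Yy_def Yxy_def
    by (rule DERIV_cong[OF DERIV_diff[OF DERIV_mult[OF D(1) V_derivs(3)[OF H]]
          DERIV_mult[OF DERIV_cmult[OF D(3)] V_derivs(1)[OF H]]]]) (simp add: algebra_simps)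
qed

lemma Y_pde:
  assumes H: "(x, y, z) \<in> domH"
  shows "Yxy x y z = (1 - q) / (x - y - z) * (Yx x y z - Yy x y z) + lam * Y x y z"
proof -
  define d where "d = x - y - z"
  have d: "0 < d" using H by (auto simp: domH_def d_def)
  define P where "P = d powr (2 * q - 3)"
  have P: "d powr (2 * q - 2) = P * d" "d powr (2 * q - 1) = P * d\<^sup>2"
    using d powr_add[of d "2 * q - 3" 1] powr_add[of d "2 * q - 3" 2] by (simp_all add: P_def)
  define e where "e = 1 / d"
  have e: "d * e = 1" and div: "t / d = t * e" for t using d by (simp_all add: e_def)
  have pde: "Vxy x y z = q * e * (Vx x y z - Vy x y z) + lam * V x y z"
    using V_pde[OF H] by (simp add: d_def[symmetric] div)
  show ?thesis
    unfolding Y_def Yx_def Yy_def Yxy_def d_def[symmetric] P div P_def[symmetric]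
    using pde e by algebra
qed

lemma Y_cont:
  "1 / 2 < q \<Longrightarrow> continuous3_on (closure domH) Y"
  "continuous3_on domH Yx"
  "continuous3_on domH Yy"
  "continuous3_on domH Yxy"
proof -
  have V: "continuous_on domH (\<lambda>u. V (fst u) (fst (snd u)) (snd (snd u)))"
    "continuous_on domH (\<lambda>u. Vx (fst u) (fst (snd u)) (snd (snd u)))"
    "continuous_on domH (\<lambda>u. Vy (fst u) (fst (snd u)) (snd (snd u)))"
    "continuous_on domH (\<lambda>u. Vxy (fst u) (fst (snd u)) (snd (snd u)))"
    using continuous_on_subset[OF V_cont(1) closure_subset] V_cont(2-4)[THEN continuous_on_subset, OF domH_subset_domH_diag]
    by (simp_all add: case_prod_unfold)
  have P: "continuous_on domH (\<lambda>u. (fst u - fst (snd u) - snd (snd u)) powr e)" for e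
    by (intro continuous_on_powr continuous_intros) (auto simp: domH_def)
  show "continuous3_on domH Yx" "continuous3_on domH Yy"
    "continuous3_on domH Yxy"
    unfolding Yx_def Yy_def Yxy_def case_prod_unfold
    by (intro continuous_on_add continuous_on_diff continuous_on_mult continuous_on_const P V)+
  assume "1 / 2 < q"
  then have "continuous_on (closure domH) (\<lambda>u. (fst u - fst (snd u) - snd (snd u)) powr (2 * q - 1))"
    by (intro continuous_on_powr' continuous_intros) (auto simp: closure_domH)
  then show "continuous3_on (closure domH) Y"
    using V_cont(1) unfolding Y_def case_prod_unfold by (intro continuous_on_mult)
qed

lemma V_left_limits:
  assumes "0 < y" "y < x"
  shows "((\<lambda>z. V x y z) \<longlongrightarrow> V x y (x - y)) (at_left (x - y))"
    and "((\<lambda>z. Vx x y z) \<longlongrightarrow> Vx x y (x - y)) (at_left (x - y))"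
    and "((\<lambda>z. Vy x y z) \<longlongrightarrow> Vy x y (x - y)) (at_left (x - y))"
proof -
  have lim: "(A x y \<longlongrightarrow> A x y (x - y)) (at_left (x - y))"
    if A: "continuous3_on domH_diag A" for A :: "real \<Rightarrow> real \<Rightarrow> real \<Rightarrow> real"
  proof -
    have "continuous_on {(x - y) / 2..x - y} (\<lambda>z. (\<lambda>(x, y, z). A x y z) (x, y, z))"
      by (rule continuous_on_compose2[OF A]) (use assms in \<open>auto simp: domH_diag_def intro!: continuous_intros\<close>)
    then have "(A x y \<longlongrightarrow> A x y (x - y)) (at (x - y) within {(x - y) / 2..x - y})"
      using assms by (auto simp: continuous_on_def)
    then show ?thesis using assms at_within_Icc_at_left[of "(x - y) / 2" "x - y"] by simp
  qed
  show "((\<lambda>z. V x y z) \<longlongrightarrow> V x y (x - y)) (at_left (x - y))"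
    "((\<lambda>z. Vx x y z) \<longlongrightarrow> Vx x y (x - y)) (at_left (x - y))"
    "((\<lambda>z. Vy x y z) \<longlongrightarrow> Vy x y (x - y)) (at_left (x - y))"
    by (intro lim V_cont continuous_on_subset[OF V_cont(1) domH_diag_subset_closure])+
qed

text \<open>
  Undoing the substitution \<open>r = y + d * s\<close>: the weight contributes \<open>d powr (2 * q - 2)\<close> and the
  differential one more factor \<open>d\<close>.
\<close>

lemma V_eq_interval_integral:
  assumes "0 \<le> y" "0 \<le> z" "z \<le> x - y"
  shows "(x - y - z) powr (2 * q - 1) * V x y z = integral {y..x - z}
     (\<lambda>s. (s - y) powr (q - 1) * (x - z - s) powr (q - 1) * (g z s * hyp0F1 q (lam * (x - z - s) * (y - s))))"
proof (cases "z = x - y")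
  case False
  define d where "d = x - y - z"
  have d: "d > 0" using assms False by (simp add: d_def)
  define f where "f = (\<lambda>s. (s - y) powr (q - 1) * (x - z - s) powr (q - 1) * (g z s * hyp0F1 q (lam * (x - z - s) * (y - s))))"
  have "continuous_on {0..1} (i0 x y z)"
  proof -
    have "continuous_on {0..1} (\<lambda>s. (\<lambda>(u, s). i0 (fst u) (fst (snd u)) (snd (snd u)) s) ((x, y, z), s))"
      by (rule continuous_on_compose2[OF i0_cont]) (use assms in \<open>auto simp: closure_domH intro!: continuous_intros\<close>)
    then show ?thesis by simp
  qed
  then have "((\<lambda>s. beta_weight q s * i0 x y z s) has_integral V x y z) {0..1}"
    unfolding V_def by (intro integrable_integral weighted_integrable beta_weight_integrable q beta_weight_nonneg)
  from has_integral_mult_right[OF this, of "d powr (2 * q - 2)"]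
  have "((\<lambda>s. f (y + d * s)) has_integral d powr (2 * q - 2) * V x y z) {0..1}"
  proof (rule has_integral_eq[rotated])
    fix s :: real assume s: "s \<in> {0..1}"
    have 1: "x - z - (y + d * s) = d * (1 - s)" "y - (y + d * s) = - (d * s)" "y + d * s - y = d * s"
      by (simp_all add: d_def algebra_simps)
    have "(d * s) powr (q - 1) * (d * (1 - s)) powr (q - 1) = (d powr (q - 1) * d powr (q - 1)) * beta_weight q s"
      using s d by (simp add: powr_mult beta_weight_def)
    also have "d powr (q - 1) * d powr (q - 1) = d powr (2 * q - 2)" by (simp add: powr_add[symmetric])
    finally show "d powr (2 * q - 2) * (beta_weight q s * i0 x y z s) = f (y + d * s)"
      unfolding f_def 1 by (simp add: i0_def F0_def d_def[symmetric] power2_eq_square mult_ac)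
  qed
  from has_integral_rescale_to_unit[OF d this]
  have "integral {y..y + d} f = d * (d powr (2 * q - 2) * V x y z)" by (rule integral_unique)
  moreover have "d * d powr (2 * q - 2) = d powr (2 * q - 1)"
    using d powr_add[of d 1 "2 * q - 2"] by simp
  moreover have "y + d = x - z" by (simp add: d_def)
  ultimately show ?thesis by (simp add: f_def d_def[symmetric] mult.assoc[symmetric])
qed simp

text \<open>
  Integrating over \<open>z\<close>, exchanging the integrals over the triangle, and writing \<open>t = z + s\<close> brings the
  solution into the form of \<open>formula_C\<close>. The free factor \<open>\<phi>\<close> accommodates the additional power
  of \<open>x0 - y0 - t + s\<close> in the integral that contains \<open>\<nu>\<close>.
\<close>

lemma weighted_V_double_integral:
  assumes q1: "q < 1" and H: "0 \<le> y0" "0 \<le> z0" "z0 \<le> x0 - y0"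
    and \<phi>: "continuous_on {z0..x0 - y0} \<phi>"
  shows "integral {z0..x0 - y0} (\<lambda>z. \<phi> z * ((x0 - y0 - z) powr (2 * q - 1) * V x0 y0 z))
    = integral {y0..x0 - z0} (\<lambda>s. integral {z0 + s..x0} (\<lambda>t. (s - y0) powr (q - 1) * (x0 - t) powr (q - 1) *
        (\<phi> (t - s) * (g (t - s) s * hyp0F1 q (lam * (x0 - t) * (y0 - s))))))"
proof -
  define G where "G = (\<lambda>z s. \<phi> z * (g z s * hyp0F1 q (lam * (x0 - z - s) * (y0 - s))))"
  have cG: "continuous_on {(r, s). z0 \<le> r \<and> y0 \<le> s \<and> r + s \<le> x0} (\<lambda>(r, s). G r s)"
  proof -
    let ?T = "{(r, s). z0 \<le> r \<and> y0 \<le> s \<and> r + s \<le> x0}"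
    have "continuous_on ?T (\<lambda>u. (\<lambda>(z, r). g z r) (fst u, snd u))"
      by (rule continuous_on_compose2[OF g_cont]) (use H in \<open>auto intro!: continuous_intros\<close>)
    then have 1: "continuous_on ?T (\<lambda>u. g (fst u) (snd u))" by (simp only: prod.case)
    have 2: "continuous_on ?T (\<lambda>u. \<phi> (fst u))"
      by (rule continuous_on_compose2[OF \<phi>]) (auto intro!: continuous_intros)
    show ?thesis unfolding G_def case_prod_unfold
      by (intro continuous_on_mult 2[unfolded case_prod_unfold] 1[unfolded case_prod_unfold] continuous_on_hyp0F1 q)
         (intro continuous_intros)+
  qed
  have "integral {z0..x0 - y0} (\<lambda>z. \<phi> z * ((x0 - y0 - z) powr (2 * q - 1) * V x0 y0 z))
    = integral {z0..x0 - y0} (\<lambda>z. integral {y0..x0 - z} (\<lambda>s. (s - y0) powr (q - 1) * (x0 - z - s) powr (q - 1) * G z s))"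
  proof (rule Henstock_Kurzweil_Integration.integral_cong)
    fix z assume z: "z \<in> {z0..x0 - y0}"
    show "\<phi> z * ((x0 - y0 - z) powr (2 * q - 1) * V x0 y0 z)
      = integral {y0..x0 - z} (\<lambda>s. (s - y0) powr (q - 1) * (x0 - z - s) powr (q - 1) * G z s)"
      using V_eq_interval_integral[of y0 z x0] z H
      by (simp add: G_def mult_ac flip: integral_mult_right)
  qed
  also have "\<dots> = integral {y0..x0 - z0} (\<lambda>s. integral {z0..x0 - s} (\<lambda>r. (s - y0) powr (q - 1) * (x0 - r - s) powr (q - 1) * G r s))"
    by (rule triangle_Fubini[OF q q1 _ cG]) (use H in simp)
  also have "\<dots> = integral {y0..x0 - z0} (\<lambda>s. integral {z0 + s..x0} (\<lambda>t. (s - y0) powr (q - 1) * (x0 - t) powr (q - 1) *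
        (\<phi> (t - s) * (g (t - s) s * hyp0F1 q (lam * (x0 - t) * (y0 - s))))))"
  proof (rule Henstock_Kurzweil_Integration.integral_cong)
    fix s
    show "integral {z0..x0 - s} (\<lambda>r. (s - y0) powr (q - 1) * (x0 - r - s) powr (q - 1) * G r s)
      = integral {z0 + s..x0} (\<lambda>t. (s - y0) powr (q - 1) * (x0 - t) powr (q - 1) *
        (\<phi> (t - s) * (g (t - s) s * hyp0F1 q (lam * (x0 - t) * (y0 - s)))))"
      using integral_shift_real_ivl[of z0 "- s" "x0 - s" "\<lambda>r. (s - y0) powr (q - 1) * (x0 - r - s) powr (q - 1) * G r s"]
      by (simp add: G_def)
  qed
  finally show ?thesis .
qed

end

section \<open>Existence and the explicit formula\<close>

text \<open>
  \<open>W\<close> is the sum of the two basic solutions, with exponent \<open>p\<close> for \<open>\<nu>\<close> and the conjugate one for \<open>\<mu>\<close>.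
  On the diagonal the first has the value \<open>Beta p p * \<nu>\<close> and no weighted normal derivative, whereas the
  second vanishes and has the weighted normal derivative \<open>2 * (1 - 2 * p) * Beta (1 - p) (1 - p) * \<mu>\<close>.
  The constants of \<open>formula_C\<close> are the reciprocals of these factors.
\<close>

lemma problem_C_solution_exists:
  assumes p: "0 < p" "p < 1 / 2"
    and \<tau>: "continuous_on (closure domD) (\<lambda>(x, y). \<tau> x y)"
    and \<nu>: "Ck_closed_D 2 \<nu>" and \<mu>: "Ck_closed_D 2 \<mu>"
  shows "\<exists>U. solves_problem_C p lam \<tau> \<nu> \<mu> U \<and>
    (\<forall>(x, y, z)\<in>closure domH. U x y z = formula_C p lam \<tau> \<nu> \<mu> x y z)"
proof -
  obtain n1 n2 where N: "diagonal_kernel p (\<lambda>z r. \<nu> (z + r) r) n1 n2"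
    using diagonal_kernel_of_C2[OF \<nu> p(1)] by blast
  obtain m1 m2 where M: "diagonal_kernel (1 - p) (\<lambda>z r. \<mu> (z + r) r) m1 m2"
    using diagonal_kernel_of_C2[OF \<mu>, of "1 - p"] p by auto
  interpret N: diagonal_kernel p lam "\<lambda>z r. \<nu> (z + r) r" n1 n2 by (rule N)
  interpret M: diagonal_kernel "1 - p" lam "\<lambda>z r. \<mu> (z + r) r" m1 m2 by (rule M)
  define c1 c2 where "c1 = 1 / 2 * (Gamma (1 - 2 * p) / (Gamma (1 - p))\<^sup>2)"
    and "c2 = Gamma (2 * p) / (Gamma p)\<^sup>2"
  have G: "Gamma p > 0" "Gamma (1 - p) > 0" "Gamma (2 * p) > 0" "Gamma (1 - 2 * p) > 0"
    using p by (auto intro!: Gamma_real_pos)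
  have c2: "c2 * Beta p p = 1"
    using G by (simp add: c2_def Beta_altdef rGamma_inverse_Gamma power2_eq_square)
  have "Gamma ((1 - 2 * p) + 1) = (1 - 2 * p) * Gamma (1 - 2 * p)"
    by (rule Gamma_plus1) (use p in \<open>auto elim!: nonpos_Ints_cases\<close>)
  then have G2: "Gamma ((1 - p) + (1 - p)) = (1 - 2 * p) * Gamma (1 - 2 * p)" by (simp add: algebra_simps)
  have c1: "c1 * (2 * (1 - 2 * p) * Beta (1 - p) (1 - p)) = 1"
  proof -
    have "1 / 2 * (A / B\<^sup>2) * (2 * a * (B * B * inverse (a * A))) = 1"
      if "A \<noteq> 0" "B \<noteq> 0" "a \<noteq> 0" for A B a :: real
      using that by (simp add: field_simps power2_eq_square)
    from this[of "Gamma (1 - 2 * p)" "Gamma (1 - p)" "1 - 2 * p"] show ?thesis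
      using G p by (simp only: c1_def Beta_altdef rGamma_inverse_Gamma G2)
  qed
  define W Wx Wy Wxy where "W = (\<lambda>x y z. c1 * M.Y x y z + c2 * N.V x y z)"
    and "Wx = (\<lambda>x y z. c1 * M.Yx x y z + c2 * N.Vx x y z)"
    and "Wy = (\<lambda>x y z. c1 * M.Yy x y z + c2 * N.Vy x y z)"
    and "Wxy = (\<lambda>x y z. c1 * M.Yxy x y z + c2 * N.Vxy x y z)"
  note NV = N.V_cont(2-4)[THEN continuous_on_subset, OF domH_subset_domH_diag]
  have q: "1 / 2 < 1 - p" using p by simp
  have cW: "continuous3_on (closure domH) W"
    using M.Y_cont(1)[OF q] N.V_cont(1) unfolding W_def case_prod_unfold
    by (intro continuous_on_add continuous_on_mult continuous_on_const)
  interpret W: classical_z_derivative p lam W Wx Wy Wxy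
  proof
    show "continuous3_on domH W" by (rule continuous_on_subset[OF cW closure_subset])
    show "continuous3_on domH Wx"
      using M.Y_cont(2) NV(1) unfolding Wx_def case_prod_unfold
      by (intro continuous_on_add continuous_on_mult continuous_on_const)
    show "continuous3_on domH Wy"
      using M.Y_cont(3) NV(2) unfolding Wy_def case_prod_unfold
      by (intro continuous_on_add continuous_on_mult continuous_on_const)
    show "continuous3_on domH Wxy"
      using M.Y_cont(4) NV(3) unfolding Wxy_def case_prod_unfold
      by (intro continuous_on_add continuous_on_mult continuous_on_const)
  next
    fix x y z assume H: "(x, y, z) \<in> domH"
    show "((\<lambda>t. W t y z) has_real_derivative Wx x y z) (at x)"
      unfolding W_def Wx_def by (intro DERIV_add DERIV_cmult M.Y_derivs N.V_derivs H)
    show "((\<lambda>t. W x t z) has_real_derivative Wy x y z) (at y)"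
      unfolding W_def Wy_def by (intro DERIV_add DERIV_cmult M.Y_derivs N.V_derivs H)
    show "((\<lambda>t. Wy t y z) has_real_derivative Wxy x y z) (at x)"
      unfolding Wy_def Wxy_def by (intro DERIV_add DERIV_cmult M.Y_derivs N.V_derivs H)
    show "Wxy x y z = p / (x - y - z) * (Wx x y z - Wy x y z) + lam * W x y z"
      unfolding W_def Wx_def Wy_def Wxy_def M.Y_pde[OF H] N.V_pde[OF H] by (simp add: algebra_simps)
  qed
  have sol: "solves_problem_C p lam \<tau> \<nu> \<mu> (\<lambda>x y z. \<tau> x y - integral {z..x - y} (W x y))"
  proof (rule W.solves_problem_C_from_z_derivative[OF \<tau> cW])
    fix x y :: real assume xy: "0 < y" "y < x"
    show "W x y (x - y) = \<nu> x y"
      using N.V_diagonal[of y x] xy c2 by (simp add: W_def M.Y_def)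
    define d where "d = (\<lambda>z. x - y - z)"
    have d0: "(d \<longlongrightarrow> 0) (at_left (x - y))" unfolding d_def by (auto intro!: tendsto_eq_intros)
    have ev: "eventually (\<lambda>z. z < x - y) (at_left (x - y))" by (simp add: eventually_at_filter)
    have "((\<lambda>z. d z powr (2 * p)) \<longlongrightarrow> 0 powr (2 * p)) (at_left (x - y))"
      by (rule tendsto_powr'[OF d0 tendsto_const])
         (use p in \<open>auto simp: d_def intro: eventually_mono[OF ev]\<close>)
    then have "((\<lambda>z. c1 * (d z * (M.Vx x y z - M.Vy x y z) + 2 * (1 - 2 * p) * M.V x y z)
        + c2 * (d z powr (2 * p) * (N.Vx x y z - N.Vy x y z))) \<longlongrightarrow>
        c1 * (0 * (M.Vx x y (x - y) - M.Vy x y (x - y)) + 2 * (1 - 2 * p) * M.V x y (x - y))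
        + c2 * (0 powr (2 * p) * (N.Vx x y (x - y) - N.Vy x y (x - y)))) (at_left (x - y))"
      by (intro tendsto_add tendsto_mult tendsto_diff tendsto_const d0 M.V_left_limits N.V_left_limits xy)
    moreover have "c1 * (0 * (M.Vx x y (x - y) - M.Vy x y (x - y)) + 2 * (1 - 2 * p) * M.V x y (x - y))
        + c2 * (0 powr (2 * p) * (N.Vx x y (x - y) - N.Vy x y (x - y)))
        = (c1 * (2 * (1 - 2 * p) * Beta (1 - p) (1 - p))) * \<mu> x y"
      using M.V_diagonal[of y x] xy by simp
    ultimately have "((\<lambda>z. c1 * (d z * (M.Vx x y z - M.Vy x y z) + 2 * (1 - 2 * p) * M.V x y z)
        + c2 * (d z powr (2 * p) * (N.Vx x y z - N.Vy x y z))) \<longlongrightarrow> \<mu> x y) (at_left (x - y))"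
      by (simp only: c1) simp
    then show "((\<lambda>z. (x - y - z) powr (2 * p) * (Wx x y z - Wy x y z)) \<longlongrightarrow> \<mu> x y) (at_left (x - y))"
    proof (rule Lim_transform_eventually, intro eventually_mono[OF ev])
      fix z assume "z < x - y"
      then have dz: "d z > 0" by (simp add: d_def)
      define P where "P = d z powr (2 * p)"
      have P: "P * d z powr (2 * (1 - p) - 1) = d z" "P * d z powr (2 * (1 - p) - 2) = 1"
        using dz by (simp_all add: P_def powr_add[symmetric])
      have "Wx x y z - Wy x y z = c1 * (d z powr (2 * (1 - p) - 1) * (M.Vx x y z - M.Vy x y z)
         + 2 * (1 - 2 * p) * d z powr (2 * (1 - p) - 2) * M.V x y z) + c2 * (N.Vx x y z - N.Vy x y z)"
        unfolding Wx_def Wy_def M.Yx_def M.Yy_def d_def by (simp add: algebra_simps)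
      then have "P * (Wx x y z - Wy x y z) = c1 * ((P * d z powr (2 * (1 - p) - 1)) * (M.Vx x y z - M.Vy x y z)
         + 2 * (1 - 2 * p) * (P * d z powr (2 * (1 - p) - 2)) * M.V x y z) + c2 * (P * (N.Vx x y z - N.Vy x y z))"
        by algebra
      then show "c1 * (d z * (M.Vx x y z - M.Vy x y z) + 2 * (1 - 2 * p) * M.V x y z)
        + c2 * (d z powr (2 * p) * (N.Vx x y z - N.Vy x y z)) = (x - y - z) powr (2 * p) * (Wx x y z - Wy x y z)"
        unfolding P by (simp add: P_def d_def)
    qed
  qed
  have form: "\<tau> x0 y0 - integral {z0..x0 - y0} (W x0 y0) = formula_C p lam \<tau> \<nu> \<mu> x0 y0 z0"
    if H: "(x0, y0, z0) \<in> closure domH" for x0 y0 z0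
  proof -
    have h: "0 \<le> y0" "0 \<le> z0" "z0 \<le> x0 - y0" using H by (auto simp: closure_domH)
    define \<phi> where "\<phi> = (\<lambda>z. (x0 - y0 - z) powr (1 - 2 * p))"
    have c\<phi>: "continuous_on {z0..x0 - y0} \<phi>"
      unfolding \<phi>_def by (intro continuous_on_powr' continuous_intros) (use p in auto)
    have sec: "continuous_on {z0..x0 - y0} (A x0 y0)"
      if A: "continuous3_on (closure domH) A" for A :: "real \<Rightarrow> real \<Rightarrow> real \<Rightarrow> real"
      by (rule continuous_on_ternary_compose[OF A])
         (use h in \<open>auto simp: closure_domH intro!: continuous_intros\<close>)
    have "((\<lambda>z. c1 * M.Y x0 y0 z + c2 * N.V x0 y0 z) has_integral
        c1 * integral {z0..x0 - y0} (M.Y x0 y0) + c2 * integral {z0..x0 - y0} (N.V x0 y0)) {z0..x0 - y0}"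
      by (intro has_integral_add has_integral_mult_right integrable_integral integrable_continuous_interval
            sec M.Y_cont(1)[OF q] N.V_cont(1))
    then have "integral {z0..x0 - y0} (W x0 y0) = c1 * integral {z0..x0 - y0} (M.Y x0 y0) + c2 * integral {z0..x0 - y0} (N.V x0 y0)"
      by (simp add: W_def integral_unique)
    moreover have "integral {z0..x0 - y0} (M.Y x0 y0) =
       integral {y0..x0 - z0} (\<lambda>s. integral {z0 + s..x0} (\<lambda>t.
         \<mu> t s * (x0 - t) powr (- p) * (s - y0) powr (- p) *
         hyp0F1 (1 - p) (lam * (x0 - t) * (y0 - s))))"
    proof -
      have "M.Y x0 y0 = (\<lambda>z. (x0 - y0 - z) powr (2 * (1 - p) - 1) * M.V x0 y0 z)"
        by (simp add: M.Y_def fun_eq_iff)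
      then show ?thesis
        using M.weighted_V_double_integral[of y0 z0 x0 "\<lambda>_. 1"] h p by (simp add: mult_ac)
    qed
    moreover have "integral {z0..x0 - y0} (N.V x0 y0) =
       integral {y0..x0 - z0} (\<lambda>s. integral {z0 + s..x0} (\<lambda>t.
         \<nu> t s * (x0 - t) powr (p - 1) * (s - y0) powr (p - 1) *
         (x0 - y0 - t + s) powr (1 - 2 * p) *
         hyp0F1 p (lam * (x0 - t) * (y0 - s))))"
    proof -
      have "integral {z0..x0 - y0} (N.V x0 y0) = integral {z0..x0 - y0} (\<lambda>z. \<phi> z * ((x0 - y0 - z) powr (2 * p - 1) * N.V x0 y0 z))"
      \<comment> \<open>on the diagonal itself \<open>\<phi>\<close> vanishes and the two integrands differ at that one point\<close>
      proof (rule integral_spike[of "{x0 - y0}"])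
        fix z assume "z \<in> {z0..x0 - y0} - {x0 - y0}"
        then have "\<phi> z * (x0 - y0 - z) powr (2 * p - 1) = 1"
          by (simp add: \<phi>_def powr_add[symmetric])
        then show "\<phi> z * ((x0 - y0 - z) powr (2 * p - 1) * N.V x0 y0 z) = N.V x0 y0 z"
          by (simp add: mult.assoc[symmetric])
      qed simp
      also have "\<dots> = integral {y0..x0 - z0} (\<lambda>s. integral {z0 + s..x0} (\<lambda>t. (s - y0) powr (p - 1) * (x0 - t) powr (p - 1) *
        (\<phi> (t - s) * (\<nu> (t - s + s) s * hyp0F1 p (lam * (x0 - t) * (y0 - s))))))"
        by (rule N.weighted_V_double_integral[OF _ h c\<phi>]) (use p in simp)
      finally show ?thesis by (simp add: \<phi>_def mult_ac diff_diff_eq2 algebra_simps)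
    qed
    ultimately show ?thesis by (simp only: formula_C_def c1_def c2_def)
  qed
  show ?thesis using sol form by (intro exI[of _ "\<lambda>x y z. \<tau> x y - integral {z..x - y} (W x y)"]) auto
qed

theorem theorem1:
  fixes p lam :: real and \<tau> \<nu> \<mu> :: "real \<Rightarrow> real \<Rightarrow> real"
  assumes "0 < p" and "p < 1 / 2"
    and "continuous_on (closure domD) (\<lambda>(x, y). \<tau> x y)"
    and "mixed_C_closed_D \<tau>"
    and "Ck_closed_D 2 \<nu>"
    and "Ck_closed_D 2 \<mu>"
  shows "(\<exists>U. solves_problem_C p lam \<tau> \<nu> \<mu> U) \<and>
    (\<forall>U V. solves_problem_C p lam \<tau> \<nu> \<mu> U \<and> solves_problem_C p lam \<tau> \<nu> \<mu> V \<longrightarrow>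
       (\<forall>(x, y, z)\<in>closure domH. U x y z = V x y z)) \<and>
    (\<forall>U. solves_problem_C p lam \<tau> \<nu> \<mu> U \<longrightarrow>
       (\<forall>(x0, y0, z0)\<in>closure domH. U x0 y0 z0 = formula_C p lam \<tau> \<nu> \<mu> x0 y0 z0))"
proof -
  obtain S where S: "solves_problem_C p lam \<tau> \<nu> \<mu> S"
    and F: "\<And>x y z. (x, y, z) \<in> closure domH \<Longrightarrow> S x y z = formula_C p lam \<tau> \<nu> \<mu> x y z"
    using problem_C_solution_exists[OF assms(1,2,3,5,6), of lam] by fast
  have uniq: "U x y z = V x y z"
    if "solves_problem_C p lam \<tau> \<nu> \<mu> U" "solves_problem_C p lam \<tau> \<nu> \<mu> V" "(x, y, z) \<in> closure domH"
    for U V x y z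
    by (rule problem_C_solution_unique[OF assms(1,2) that])
  show ?thesis
  proof (intro conjI allI impI)
    show "\<exists>U. solves_problem_C p lam \<tau> \<nu> \<mu> U" using S by blast
    show "\<forall>(x, y, z)\<in>closure domH. U x y z = V x y z"
      if "solves_problem_C p lam \<tau> \<nu> \<mu> U \<and> solves_problem_C p lam \<tau> \<nu> \<mu> V" for U V
      using uniq that by blast
    show "\<forall>(x0, y0, z0)\<in>closure domH. U x0 y0 z0 = formula_C p lam \<tau> \<nu> \<mu> x0 y0 z0"
      if U: "solves_problem_C p lam \<tau> \<nu> \<mu> U" for U
    proof clarify
      fix x y z assume H: "(x, y, z) \<in> closure domH"
      show "U x y z = formula_C p lam \<tau> \<nu> \<mu> x y z"
        using uniq[OF U S H] F[OF H] by simp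
    qed
  qed
qed

end
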